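(* Let $d\ge1$ and let $h_n$ ($n\ge1$) and $h$ be measurable functions from $\mathbb{R}_+\times\mathbb{R}^d$ to $\mathbb{R}$ such that each $k\in\{h\}\cup\{h_n:n\ge1\}$ satisfies $$\int_0^{+\infty}\int_{\mathbb{R}^d\setminus\{0\}}(|k(t,x)|^2\wedge1)\,dt\,\sigma(dx)<+\infty$$ and is such that the following limit exists: $$a(k):=\lim_{s\to+\infty}\int_0^s\int_{\mathbb{R}^d\setminus\{0\}}k(t,x)\mathbf{1}_{|k(t,x)|\le1}\,dt\,\sigma(dx).$$ Let $I_n=\sum_{i\ge1}h_n(T_i,\Delta_i)$ and $I=\sum_{i\ge1}h(T_i,\Delta_i)$. Suppose that: 1. $\lim_{n\to+\infty}a(h_n)=a(h)$; 2. $\lim_{n\to+\infty}\int_0^{+\infty}\int_{\mathbb{R}^d\setminus\{0\}}(|h_n(t,x)-h(t,x)|^2\wedge1)\,dt\,\sigma(dx)=0$; 3. for some integer $p\ge1$, $\big((\lambda_{\mathbb{R}_+}\otimes\sigma)h^{-1}\big)^{*p}\ll\lambda$ and, for all $t>0$, as $n\to+\infty$, $$\big((\lambda_{[0,t]}\otimes\sigma)h_n^{-1}\big)^{*p}\stackrel{var}{\longrightarrow}\big((\lambda_{[0,t]}\otimes\sigma)h^{-1}\big)^{*p}.$$ Then $\mathcal{L}(I_n)\stackrel{var}{\longrightarrow}\mathcal{L}(I)$ as $n\to+\infty$.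
   Context: $(\Delta_i)_{i\ge1}$ is an i.i.d. sequence of random vectors in $\mathbb{R}^d$ with common law $\sigma$, where $\sigma(\{0\})=0$. Independently, $(T_i)_{i\ge1}$ is the sequence of partial sums of i.i.d. exponential random variables with parameter $\alpha>0$. Under the integrability condition and the existence of the limit $a(k)$, the series $\sum_{i\ge1}k(T_i,\Delta_i)$ converges almost surely (known result). $\lambda$ is Lebesgue measure on $\mathbb{R}$, and $\lambda_A$ is its restriction to a Borel set $A$. $mk^{-1}$ is the image (pushforward) of a measure $m$ under $k$. The $p$-fold convolution $(mk^{-1})^{*p}$ is the image of the product measure $m^{\otimes p}$ under $(z_1,\dots,z_p)\mapsto k(z_1)+\dots+k(z_p)$. $\mathcal{L}(X)$ is the law of $X$, $\ll$ denotes absolute continuity, and $\mu_n\stackrel{var}{\longrightarrow}\mu$ means $\|\mu_n-\mu\|\to0$, where $\|\mu\|=\mu_+(\mathbb{R})+\mu_-(\mathbb{R})$ is the total variation norm of a signed measure $\mu$ with Hahn–Jordan decomposition $\mu=\mu_+-\mu_-$. *)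

theory Defs
  imports "HOL-Probability.Probability"
begin

text \<open>
  Sequences indexed in the literature by integers \<open>i \<ge> 1\<close> are indexed here by \<open>i \<ge> 0\<close>.
  Functions on \<open>\<real>\<^sub>+ \<times> \<real>\<^sup>d\<close> are total functions of type \<open>real \<times> 'a \<Rightarrow> real\<close>, with
  \<open>'a :: euclidean_space\<close> in the role of \<open>\<real>\<^sup>d\<close> (so that \<open>d = DIM('a) \<ge> 1\<close>); only their
  values on \<open>{0..} \<times> UNIV\<close> matter, and measurability is required only there.
\<close>

definition small_jump_integral :: "'a::euclidean_space measure \<Rightarrow> (real \<times> 'a \<Rightarrow> real) \<Rightarrow> ennreal"
  where "small_jump_integral \<sigma> k =
    (\<integral>\<^sup>+z\<in>{0..} \<times> (UNIV - {0}). ennreal (min (\<bar>k z\<bar>\<^sup>2) 1) \<partial>(lborel \<Otimes>\<^sub>M \<sigma>))"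

definition truncated_integral :: "'a::euclidean_space measure \<Rightarrow> (real \<times> 'a \<Rightarrow> real) \<Rightarrow> real \<Rightarrow> real"
  where "truncated_integral \<sigma> k s =
    (LINT z:{0..s} \<times> (UNIV - {0})|(lborel \<Otimes>\<^sub>M \<sigma>). k z * indicator {z. \<bar>k z\<bar> \<le> 1} z)"

definition centering_exists :: "'a::euclidean_space measure \<Rightarrow> (real \<times> 'a \<Rightarrow> real) \<Rightarrow> bool"
  where "centering_exists \<sigma> k \<longleftrightarrow> (\<exists>l. (truncated_integral \<sigma> k \<longlongrightarrow> l) at_top)"

definition centering :: "'a::euclidean_space measure \<Rightarrow> (real \<times> 'a \<Rightarrow> real) \<Rightarrow> real"
  where "centering \<sigma> k = Lim at_top (truncated_integral \<sigma> k)"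

text \<open>
  The \<open>p\<close>-fold convolution \<open>(m k\<^sup>-\<^sup>1)\<^sup>*\<^sup>p\<close>, as the image of \<open>m\<^sup>\<otimes>\<^sup>p\<close>. It is not defined from the
  measure \<open>m k\<^sup>-\<^sup>1\<close> itself, because that measure need not be \<open>\<sigma>\<close>-finite when \<open>m\<close> is.
\<close>

definition image_convolution_power :: "'b measure \<Rightarrow> ('b \<Rightarrow> real) \<Rightarrow> nat \<Rightarrow> real measure"
  where "image_convolution_power m k p =
    distr (\<Pi>\<^sub>M i\<in>{..<p}. m) borel (\<lambda>z. \<Sum>i<p. k (z i))"

text \<open>
  A finite signed measure on the line is represented by its values on Borel sets.
\<close>

definition hahn_jordan :: "(real set \<Rightarrow> real) \<Rightarrow> real measure \<Rightarrow> real measure \<Rightarrow> bool"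
  where "hahn_jordan \<mu> \<mu>p \<mu>n \<longleftrightarrow>
    finite_measure \<mu>p \<and> finite_measure \<mu>n \<and> sets \<mu>p = sets borel \<and> sets \<mu>n = sets borel \<and>
    (\<forall>A\<in>sets borel. \<mu> A = measure \<mu>p A - measure \<mu>n A) \<and>
    (\<exists>P\<in>sets borel. measure \<mu>p (- P) = 0 \<and> measure \<mu>n P = 0)"

definition tv_norm :: "(real set \<Rightarrow> real) \<Rightarrow> real"
  where "tv_norm \<mu> =
    (THE r. \<exists>\<mu>p \<mu>n. hahn_jordan \<mu> \<mu>p \<mu>n \<and> r = measure \<mu>p UNIV + measure \<mu>n UNIV)"

text \<open>Convergence in variation; meaningful for finite Borel measures.\<close>

definition converges_in_variation :: "(nat \<Rightarrow> real measure) \<Rightarrow> real measure \<Rightarrow> bool"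
  where "converges_in_variation \<mu>s \<mu> \<longleftrightarrow>
    (\<lambda>n. tv_norm (\<lambda>A. measure (\<mu>s n) A - measure \<mu> A)) \<longlonglongrightarrow> 0"

text \<open>
  The definite description in \<open>tv_norm\<close> is legitimate: the decomposition of a difference of
  finite Borel measures exists, and the decomposition is unique.
\<close>

lemma hahn_jordan_le:
  assumes "hahn_jordan \<mu> \<mu>p \<mu>n" "hahn_jordan \<mu> \<nu>p \<nu>n" and A: "A \<in> sets borel"
  shows "measure \<mu>p A \<le> measure \<nu>p A" "measure \<mu>n A \<le> measure \<nu>n A"
proof -
  interpret p: finite_measure \<mu>p using assms by (simp add: hahn_jordan_def)
  interpret n: finite_measure \<mu>n using assms by (simp add: hahn_jordan_def)
  interpret p': finite_measure \<nu>p using assms by (simp add: hahn_jordan_def)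
  interpret n': finite_measure \<nu>n using assms by (simp add: hahn_jordan_def)
  have s: "sets \<mu>p = sets borel" "sets \<mu>n = sets borel" "sets \<nu>p = sets borel" "sets \<nu>n = sets borel"
    using assms by (simp_all add: hahn_jordan_def)
  obtain P where P: "P \<in> sets borel" "measure \<mu>p (- P) = 0" "measure \<mu>n P = 0"
    using assms(1) by (auto simp: hahn_jordan_def)
  have P': "- P \<in> sets borel" using P(1) by (simp add: borel_comp)
  have AP: "A \<inter> P \<in> sets borel" "A \<inter> - P \<in> sets borel" using A P(1) P' by auto
  have eq: "measure \<mu>p B - measure \<mu>n B = measure \<nu>p B - measure \<nu>n B" if "B \<in> sets borel" for B
    using assms that by (simp add: hahn_jordan_def)
  have split: "A = (A \<inter> P) \<union> (A \<inter> - P)" by blast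
  have sp: "measure \<mu>p A = measure \<mu>p (A \<inter> P) + measure \<mu>p (A \<inter> - P)"
    using p.finite_measure_Union[of "A \<inter> P" "A \<inter> - P"] AP s by (auto simp flip: split)
  have sn: "measure \<mu>n A = measure \<mu>n (A \<inter> P) + measure \<mu>n (A \<inter> - P)"
    using n.finite_measure_Union[of "A \<inter> P" "A \<inter> - P"] AP s by (auto simp flip: split)
  have z: "measure \<mu>p (A \<inter> - P) = 0"
    using p.finite_measure_mono[of "A \<inter> - P" "- P"] P P' s measure_nonneg[of \<mu>p "A \<inter> - P"] by simp
  have z': "measure \<mu>n (A \<inter> P) = 0"
    using n.finite_measure_mono[of "A \<inter> P" "P"] P s measure_nonneg[of \<mu>n "A \<inter> P"] by simp
  show "measure \<mu>p A \<le> measure \<nu>p A"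
  proof -
    have "measure \<nu>p (A \<inter> P) \<le> measure \<nu>p A"
      using p'.finite_measure_mono[of "A \<inter> P" A] A s by simp
    then show ?thesis
      using sp z z' eq[OF AP(1)] measure_nonneg[of \<nu>n "A \<inter> P"] by linarith
  qed
  show "measure \<mu>n A \<le> measure \<nu>n A"
  proof -
    have "measure \<nu>n (A \<inter> - P) \<le> measure \<nu>n A"
      using n'.finite_measure_mono[of "A \<inter> - P" A] A s by simp
    then show ?thesis
      using sn z z' eq[OF AP(2)] measure_nonneg[of \<nu>p "A \<inter> - P"] by linarith
  qed
qed

lemma tv_norm_eq:
  assumes "hahn_jordan \<mu> \<mu>p \<mu>n"
  shows "tv_norm \<mu> = measure \<mu>p UNIV + measure \<mu>n UNIV"
  unfolding tv_norm_def
proof (rule the_equality)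
  show "\<exists>\<mu>p' \<mu>n'. hahn_jordan \<mu> \<mu>p' \<mu>n' \<and>
      measure \<mu>p UNIV + measure \<mu>n UNIV = measure \<mu>p' UNIV + measure \<mu>n' UNIV"
    using assms by blast
next
  fix r assume "\<exists>\<mu>p \<mu>n. hahn_jordan \<mu> \<mu>p \<mu>n \<and> r = measure \<mu>p UNIV + measure \<mu>n UNIV"
  then obtain \<nu>p \<nu>n where *: "hahn_jordan \<mu> \<nu>p \<nu>n" "r = measure \<nu>p UNIV + measure \<nu>n UNIV"
    by blast
  show "r = measure \<mu>p UNIV + measure \<mu>n UNIV"
    using hahn_jordan_le[OF assms *(1), of UNIV] hahn_jordan_le[OF *(1) assms, of UNIV] *(2)
    by simp
qed

lemma hahn_jordan_exists:
  assumes "finite_measure \<mu>" "finite_measure \<nu>" and s: "sets \<mu> = sets borel" "sets \<nu> = sets borel"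
  shows "\<exists>\<mu>p \<mu>n. hahn_jordan (\<lambda>A. measure \<mu> A - measure \<nu> A) \<mu>p \<mu>n"
proof -
  interpret m: finite_measure \<mu> by fact
  interpret n: finite_measure \<nu> by fact
  obtain P where P: "P \<in> sets borel"
    "\<And>X. X \<in> sets borel \<Longrightarrow> X \<subseteq> P \<Longrightarrow> emeasure \<nu> X \<le> emeasure \<mu> X"
    "\<And>X. X \<in> sets borel \<Longrightarrow> X \<inter> P = {} \<Longrightarrow> emeasure \<mu> X \<le> emeasure \<nu> X"
    using finite_unsigned_Hahn_decomposition[OF assms(1,2)] s by auto
  have P': "- P \<in> sets borel" using P(1) by (simp add: borel_comp)
  have part: "\<exists>\<rho>. finite_measure \<rho> \<and> sets \<rho> = sets borel \<and>
      (\<forall>A\<in>sets borel. measure \<rho> A = measure \<alpha> (A \<inter> Q) - measure \<beta> (A \<inter> Q))"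
    if fin: "finite_measure \<alpha>" "finite_measure \<beta>"
      and sb: "sets \<alpha> = sets borel" "sets \<beta> = sets borel" and Q: "Q \<in> sets borel"
      and le: "\<And>X. X \<in> sets borel \<Longrightarrow> X \<subseteq> Q \<Longrightarrow> emeasure \<beta> X \<le> emeasure \<alpha> X"
    for \<alpha> \<beta> :: "real measure" and Q
  proof -
    interpret a: finite_measure \<alpha> by fact
    interpret b: finite_measure \<beta> by fact
    define a' where "a' = density \<alpha> (indicator Q)"
    define b' where "b' = density \<beta> (indicator Q)"
    have ea: "emeasure a' A = emeasure \<alpha> (A \<inter> Q)" "emeasure b' A = emeasure \<beta> (A \<inter> Q)"
      if "A \<in> sets borel" for A
      using that Q sb unfolding a'_def b'_def
      by (auto simp: emeasure_density indicator_inter_arith[symmetric] mult.commute Int_commute)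
    have sa: "sets a' = sets borel" "sets b' = sets borel" using sb by (simp_all add: a'_def b'_def)
    have fa: "finite_measure a'" "finite_measure b'"
      using sets_eq_imp_space_eq[OF sa(1)] sets_eq_imp_space_eq[OF sa(2)]
      by (auto intro!: finite_measureI simp: ea)
    define \<rho> where "\<rho> = diff_measure a' b'"
    have er: "emeasure \<rho> A = emeasure \<alpha> (A \<inter> Q) - emeasure \<beta> (A \<inter> Q)" if A: "A \<in> sets borel" for A
      unfolding \<rho>_def using fa sa A le Q
      by (subst emeasure_diff_measure) (auto simp: ea)
    have sr: "sets \<rho> = sets borel" using sa by (simp add: \<rho>_def)
    have "finite_measure \<rho>"
      using sets_eq_imp_space_eq[OF sr] by (auto intro!: finite_measureI simp: er)
    moreover have "measure \<rho> A = measure \<alpha> (A \<inter> Q) - measure \<beta> (A \<inter> Q)" if A: "A \<in> sets borel" for A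
    proof -
      have "emeasure \<beta> (A \<inter> Q) \<le> emeasure \<alpha> (A \<inter> Q)" using le A Q by auto
      then show ?thesis
        unfolding Sigma_Algebra.measure_def[of \<rho>] er[OF A]
        by (simp add: ennreal_minus a.emeasure_eq_measure b.emeasure_eq_measure)
    qed
    ultimately show ?thesis using sr by blast
  qed
  obtain p where p: "finite_measure p" "sets p = sets borel"
      "\<And>A. A \<in> sets borel \<Longrightarrow> measure p A = measure \<mu> (A \<inter> P) - measure \<nu> (A \<inter> P)"
    using part[OF assms(1,2) s P(1)] P(2) by metis
  obtain q where q: "finite_measure q" "sets q = sets borel"
      "\<And>A. A \<in> sets borel \<Longrightarrow> measure q A = measure \<nu> (A \<inter> - P) - measure \<mu> (A \<inter> - P)"
    using part[OF assms(2,1) s(2,1) P'] P(3) by (metis Int_commute disjoint_eq_subset_Compl)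
  have "measure \<mu> A - measure \<nu> A = measure p A - measure q A" if A: "A \<in> sets borel" for A
  proof -
    have split: "A = (A \<inter> P) \<union> (A \<inter> - P)" by blast
    have AP: "A \<inter> P \<in> sets borel" "A \<inter> - P \<in> sets borel" using A P(1) P' by auto
    have "measure \<mu> A = measure \<mu> (A \<inter> P) + measure \<mu> (A \<inter> - P)"
      using m.finite_measure_Union[of "A \<inter> P" "A \<inter> - P"] AP s by (auto simp flip: split)
    moreover have "measure \<nu> A = measure \<nu> (A \<inter> P) + measure \<nu> (A \<inter> - P)"
      using n.finite_measure_Union[of "A \<inter> P" "A \<inter> - P"] AP s by (auto simp flip: split)
    ultimately show ?thesis using p(3)[OF A] q(3)[OF A] by simp
  qed
  moreover have "measure p (- P) = 0" "measure q P = 0" using p(3)[OF P'] q(3)[OF P(1)] by simp_all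
  ultimately have "hahn_jordan (\<lambda>A. measure \<mu> A - measure \<nu> A) p q"
    using p(1,2) q(1,2) P(1) unfolding hahn_jordan_def by blast
  then show ?thesis by blast
qed

end

theory Submission
  imports Defs
begin

text \<open>
  Condition on the arrival time \<open>T\<^sub>p\<^sub>+\<^sub>1\<close>. Given it, the first \<open>p\<close> points are, up to their order,
  independent with law \<open>\<lambda>\<^bsub>[0,T]\<^esub> \<otimes> \<sigma>\<close> normalised, and they are independent of all later
  points. So \<open>I\<^sub>n = S\<^sub>n + R\<^sub>n\<close>, where conditionally \<open>S\<^sub>n\<close> has the normalised law
  \<open>((\<lambda>\<^bsub>[0,T]\<^esub> \<otimes> \<sigma>) h\<^sub>n\<^sup>-\<^sup>1)\<^sup>*\<^sup>p\<close> and is independent of \<open>R\<^sub>n\<close>. The third hypothesis replaces this law by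
  the one of \<open>h\<close>, which is absolutely continuous, so that its translations are continuous in
  variation; and \<open>R\<^sub>n\<close> converges to \<open>R\<close> in probability.

  The last fact follows from \<open>I\<^sub>n \<rightarrow> I\<close> in probability. The series of the truncated terms minus
  its compensator is a martingale with orthogonal increments, whose maximal inequality
  gives both the almost sure convergence of the series and an \<open>L\<^sup>2\<close> bound. Truncation at level
  one is not continuous in the integrand at the values \<open>\<plusminus>1\<close>, but absolute continuity of the
  convolution power shows that \<open>h\<close> takes these values with intensity zero only.
\<close>

section \<open>Total variation and translations\<close>

text \<open>The third hypothesis concerns one horizon at a time, whereas the arrival time
  conditioned on is random, so an estimate uniform in the horizon is needed. Two facts supply it:
  the convolution powers over \<open>{0..t}\<close> increase with \<open>t\<close>, and their total
  mass \<open>t ^ p\<close> is continuous in \<open>t\<close> and the same for every integrand.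
  Equality of the masses also lets the exceptional events (late arrival, remainders far apart) be
  charged to the limit law.

  Laws are compared by one-sided inequalities that hold for all Borel sets at once; between
  probability measures these control the variation distance.

  The martingale is observed at the arrival times only. Its increment is a function of the last
  arrival time and of the next pair of waiting time and mark, so everything takes place on a space
  of i.i.d. sequences and no process in continuous time is needed. Convolution powers are handled as
  iterated integrals, which depend measurably on the horizon and on the remainder.

  The values \<plusminus>1 have intensity zero because an atom \<open>c\<close> of the image
  intensity would produce an atom \<open>p * c\<close> of the convolution power.\<close>

lemma measure_diff_le_tv_norm:
  assumes "finite_measure \<mu>" "finite_measure \<nu>" "sets \<mu> = sets borel" "sets \<nu> = sets borel"
    and B: "B \<in> sets borel"
  shows "\<bar>measure \<mu> B - measure \<nu> B\<bar> \<le> tv_norm (\<lambda>A. measure \<mu> A - measure \<nu> A)"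
proof -
  obtain \<rho>p \<rho>n where hj: "hahn_jordan (\<lambda>A. measure \<mu> A - measure \<nu> A) \<rho>p \<rho>n"
    using hahn_jordan_exists[OF assms(1-4)] by blast
  interpret p: finite_measure \<rho>p using hj by (simp add: hahn_jordan_def)
  interpret n: finite_measure \<rho>n using hj by (simp add: hahn_jordan_def)
  have "measure \<mu> B - measure \<nu> B = measure \<rho>p B - measure \<rho>n B"
    using hj B by (simp add: hahn_jordan_def)
  moreover have "measure \<rho>p B \<le> measure \<rho>p UNIV" "measure \<rho>n B \<le> measure \<rho>n UNIV"
    using hj B by (auto simp: hahn_jordan_def intro!: p.finite_measure_mono n.finite_measure_mono)
  ultimately show ?thesis
    using tv_norm_eq[OF hj] measure_nonneg[of \<rho>p B] measure_nonneg[of \<rho>n B] by linarith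
qed

text \<open>The positive part of the difference is carried by a single set \<open>P\<close>, and the
  one-sided bound for \<open>P\<close> controls its mass. As both measures have mass one, the
  negative part has the same mass as the positive part; this gives the factor 2.\<close>

lemma tv_norm_le:
  assumes "prob_space \<mu>" "prob_space \<nu>" and s: "sets \<mu> = sets borel" "sets \<nu> = sets borel"
    and le: "\<And>B. B \<in> sets borel \<Longrightarrow> measure \<mu> B \<le> measure \<nu> B + e"
  shows "0 \<le> tv_norm (\<lambda>A. measure \<mu> A - measure \<nu> A)"
    and "tv_norm (\<lambda>A. measure \<mu> A - measure \<nu> A) \<le> 2 * e"
proof -
  interpret m: prob_space \<mu> by fact
  interpret n: prob_space \<nu> by fact
  have sp: "space \<mu> = UNIV" "space \<nu> = UNIV"
    using s[THEN sets_eq_imp_space_eq] by auto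
  obtain \<rho>p \<rho>n where hj: "hahn_jordan (\<lambda>A. measure \<mu> A - measure \<nu> A) \<rho>p \<rho>n"
    using hahn_jordan_exists[OF m.finite_measure_axioms n.finite_measure_axioms s] by blast
  interpret p: finite_measure \<rho>p using hj by (simp add: hahn_jordan_def)
  interpret q: finite_measure \<rho>n using hj by (simp add: hahn_jordan_def)
  obtain P where P: "P \<in> sets borel" "measure \<rho>p (- P) = 0" "measure \<rho>n P = 0"
    using hj by (auto simp: hahn_jordan_def)
  have P': "- P \<in> sets borel" using P(1) by (simp add: borel_comp)
  have eq: "measure \<mu> B - measure \<nu> B = measure \<rho>p B - measure \<rho>n B" if "B \<in> sets borel" for B
    using hj that by (simp add: hahn_jordan_def)
  have sr: "sets \<rho>p = sets borel" using hj by (simp add: hahn_jordan_def)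
  have "measure \<rho>p UNIV = measure \<rho>p P + measure \<rho>p (- P)"
    using p.finite_measure_Union[of P "- P"] P P' sr by (simp add: Compl_partition)
  moreover have "measure \<rho>p P \<le> e" using eq[OF P(1)] le[OF P(1)] P(3) by linarith
  moreover have "measure \<rho>p UNIV = measure \<rho>n UNIV"
    using eq[of UNIV] m.prob_space n.prob_space sp by simp
  ultimately show "tv_norm (\<lambda>A. measure \<mu> A - measure \<nu> A) \<le> 2 * e"
    using tv_norm_eq[OF hj] P(2) by linarith
  show "0 \<le> tv_norm (\<lambda>A. measure \<mu> A - measure \<nu> A)"
    using tv_norm_eq[OF hj] by simp
qed

lemma emeasure_lborel_translate:
  assumes "A \<in> sets borel"
  shows "emeasure lborel {x::real. x + r \<in> A} = emeasure lborel A"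
proof -
  have "emeasure lborel A = emeasure (distr lborel borel ((+) r)) A"
    by (subst lborel_distr_plus) simp
  also have "\<dots> = emeasure lborel {x. x + r \<in> A}"
    using assms by (subst emeasure_distr) (simp_all add: vimage_def add.commute)
  finally show ?thesis by simp
qed

text \<open>Squeeze \<open>A\<close> between a compact \<open>K\<close> and an open
  \<open>B\<close>. A shift shorter than the distance from \<open>K\<close> to the complement of
  \<open>B\<close> keeps \<open>K\<close> inside \<open>B\<close>, so the indicator can change only
  if \<open>x\<close> or \<open>x + r\<close> lies in \<open>A - K\<close> or \<open>B - A\<close>.
  These are four terms, each at most \<open>e/4\<close>.\<close>

lemma L1_translate_indicator:
  fixes A :: "real set"
  assumes A: "A \<in> sets borel" "emeasure lborel A < \<infinity>" and e: "e > 0"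
  shows "\<exists>d>0. \<forall>r. \<bar>r\<bar> < d \<longrightarrow>
    (\<integral>\<^sup>+x. ennreal \<bar>indicator A (x + r) - indicator A x\<bar> \<partial>lborel) \<le> ennreal e"
proof -
  note [measurable] = A(1)
  obtain B where B: "open B" "A \<subseteq> B" "emeasure lborel (B - A) < ennreal (e/4)"
    using outer_regular_lborel[of A "e/4"] A e by auto
  note [measurable] = borel_open[OF B(1)]
  \<comment> \<open>Inner regularity is applied to a finite measure, so Lebesgue measure is first
    cut down to \<open>A\<close>.\<close>
  define N where "N = density lborel (indicator A)"
  have N: "emeasure N X = emeasure lborel (A \<inter> X)" if "X \<in> sets borel" for X
    using that by (simp add: N_def emeasure_density indicator_inter_arith[symmetric])
  have "\<exists>K\<in>{K. K \<subseteq> A \<and> compact K}. emeasure N A < emeasure N K + ennreal (e/4)"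
  proof -
    have fin: "emeasure N A < \<infinity>" using N[of A] A by simp
    have *: "emeasure N A = (SUP K \<in> {K. K \<subseteq> A \<and> compact K}. emeasure N K)"
      using N[of UNIV] A by (intro inner_regular) (auto simp: N_def)
    show ?thesis
      by (rule SUP_approx_ennreal[OF _ _ *]) (use fin e in auto)
  qed
  then obtain K where K: "compact K" "K \<subseteq> A" "emeasure N A < emeasure N K + ennreal (e/4)"
    by auto
  have Kb[measurable]: "K \<in> sets borel" using K by (simp add: borel_compact)
  have AK: "emeasure lborel (A - K) \<le> ennreal (e/4)"
  proof -
    have "emeasure lborel A = emeasure lborel (A - K) + emeasure lborel K"
      using K by (subst plus_emeasure) (auto simp: Un_absorb2)
    moreover have "emeasure lborel A < emeasure lborel K + ennreal (e/4)"
      using K(2,3) N[of A] N[of K] by (simp add: Int_absorb1 inf.absorb2)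
    moreover have "emeasure lborel K < \<infinity>"
      using A(2) K(2) emeasure_mono[of K A lborel] by (auto intro: le_less_trans)
    ultimately show ?thesis
      by (metis add.commute ennreal_add_left_cancel_less less_imp_le order_less_imp_le)
  qed
  obtain d where d: "d > 0" "\<And>x y. x \<in> K \<Longrightarrow> dist x y < d \<Longrightarrow> y \<in> B"
  proof -
    obtain d where "d > 0" "\<forall>x\<in>K. \<forall>y\<in>-B. d \<le> dist x y"
      using separate_compact_closed[OF K(1), of "- B"] B K by auto
    then show thesis using that[of d] by (metis ComplI linorder_not_le)
  qed
  show ?thesis
  proof (intro exI[of _ d] conjI allI impI d)
    fix r :: real assume r: "\<bar>r\<bar> < d"
    have "(\<integral>\<^sup>+x. ennreal \<bar>indicator A (x + r) - indicator A x\<bar> \<partial>lborel)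
      \<le> (\<integral>\<^sup>+x. (indicator (A - K) (x + r) + indicator (B - A) x) +
          (indicator (A - K) x + indicator (B - A) (x + r)) \<partial>lborel)"
    proof (rule nn_integral_mono)
      fix x :: real
      have "x + r \<in> K \<Longrightarrow> x \<in> B" using d(2)[of "x + r" x] r by (simp add: dist_real_def)
      moreover have "x \<in> K \<Longrightarrow> x + r \<in> B" using d(2)[of x "x + r"] r by (simp add: dist_real_def)
      ultimately show "ennreal \<bar>indicator A (x + r) - indicator A x\<bar> \<le>
         (indicator (A - K) (x + r) + indicator (B - A) x) + (indicator (A - K) x + indicator (B - A) (x + r))"
        using K(2) B(2) by (auto simp: indicator_def split: if_splits)
    qed
    also have "\<dots> = emeasure lborel {x. x + r \<in> A - K} + emeasure lborel (B - A)
       + (emeasure lborel (A - K) + emeasure lborel {x. x + r \<in> B - A})"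
    proof -
      have *: "(indicator X (x + r) :: ennreal) = indicator {x. x + r \<in> X} x" for X :: "real set" and x
        by (simp add: indicator_def)
      show ?thesis
        unfolding * by (subst nn_integral_add; (subst nn_integral_add)?; simp add: nn_integral_indicator)
          (simp add: nn_integral_add)
    qed
    also have "\<dots> = 2 * emeasure lborel (A - K) + 2 * emeasure lborel (B - A)"
      by (simp only: emeasure_lborel_translate[of "A - K"] emeasure_lborel_translate[of "B - A"] sets.Diff A(1) Kb borel_open[OF B(1)])
         (simp add: mult_2 ac_simps)
    also have "\<dots> \<le> 2 * ennreal (e/4) + 2 * ennreal (e/4)"
      using AK B(3) by (intro add_mono mult_left_mono) auto
    also have "\<dots> = ennreal e" using e by (simp flip: ennreal_plus ennreal_numeral ennreal_mult)
    finally show "(\<integral>\<^sup>+x. ennreal \<bar>indicator A (x + r) - indicator A x\<bar> \<partial>lborel) \<le> ennreal e" .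
  qed
qed

lemma L1_translate:
  fixes f :: "real \<Rightarrow> real"
  assumes "integrable lborel f" and "e > 0"
  shows "\<exists>d>0. \<forall>r. \<bar>r\<bar> < d \<longrightarrow> (\<integral>\<^sup>+x. ennreal \<bar>f (x + r) - f x\<bar> \<partial>lborel) \<le> ennreal e"
  using assms
proof (induction arbitrary: e rule: integrable_induct)
  case (base A c)
  note [measurable] = base(1)
  \<comment> \<open>The added 1 covers the case \<open>c = 0\<close>.\<close>
  have e: "e / (\<bar>c\<bar> + 1) > 0" using base by simp
  obtain d where d: "d > 0" "\<And>r. \<bar>r\<bar> < d \<Longrightarrow>
    (\<integral>\<^sup>+x. ennreal \<bar>indicator A (x + r) - indicator A x\<bar> \<partial>lborel) \<le> ennreal (e / (\<bar>c\<bar> + 1))"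
    using L1_translate_indicator[OF _ base(2) e] base(1) by auto
  show ?case
  proof (intro exI[of _ d] conjI allI impI d(1))
    fix r :: real assume r: "\<bar>r\<bar> < d"
    have "(\<integral>\<^sup>+x. ennreal \<bar>indicator A (x + r) *\<^sub>R c - indicator A x *\<^sub>R c\<bar> \<partial>lborel)
      = (\<integral>\<^sup>+x. ennreal \<bar>c\<bar> * ennreal \<bar>indicator A (x + r) - indicator A x\<bar> \<partial>lborel)"
      by (intro nn_integral_cong) (auto simp: ennreal_mult[symmetric] abs_mult[symmetric] algebra_simps)
    also have "\<dots> = ennreal \<bar>c\<bar> * (\<integral>\<^sup>+x. ennreal \<bar>indicator A (x + r) - indicator A x\<bar> \<partial>lborel)"
      using base(1) by (intro nn_integral_cmult) auto
    also have "\<dots> \<le> ennreal \<bar>c\<bar> * ennreal (e / (\<bar>c\<bar> + 1))" using d(2)[OF r] by (rule mult_left_mono) simp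
    also have "\<dots> \<le> ennreal e"
      using base(3) by (auto simp: ennreal_mult[symmetric] field_simps intro!: ennreal_leI)
    finally show "(\<integral>\<^sup>+x. ennreal \<bar>indicator A (x + r) *\<^sub>R c - indicator A x *\<^sub>R c\<bar> \<partial>lborel) \<le> ennreal e" .
  qed
next
  case (add f g)
  note [measurable] = borel_measurable_integrable[OF add.hyps(1)] borel_measurable_integrable[OF add.hyps(2)]
  obtain d1 where d1: "d1 > 0" "\<And>r. \<bar>r\<bar> < d1 \<Longrightarrow> (\<integral>\<^sup>+x. ennreal \<bar>f (x + r) - f x\<bar> \<partial>lborel) \<le> ennreal (e/2)"
    using add.IH(1)[of "e/2"] add.prems by auto
  obtain d2 where d2: "d2 > 0" "\<And>r. \<bar>r\<bar> < d2 \<Longrightarrow> (\<integral>\<^sup>+x. ennreal \<bar>g (x + r) - g x\<bar> \<partial>lborel) \<le> ennreal (e/2)"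
    using add.IH(2)[of "e/2"] add.prems by auto
  show ?case
  proof (intro exI[of _ "min d1 d2"] conjI allI impI)
    show "min d1 d2 > 0" using d1 d2 by simp
    fix r :: real assume r: "\<bar>r\<bar> < min d1 d2"
    have "(\<integral>\<^sup>+x. ennreal \<bar>f (x + r) + g (x + r) - (f x + g x)\<bar> \<partial>lborel)
      \<le> (\<integral>\<^sup>+x. ennreal \<bar>f (x + r) - f x\<bar> + ennreal \<bar>g (x + r) - g x\<bar> \<partial>lborel)"
      by (intro nn_integral_mono) (auto simp: ennreal_plus[symmetric] simp del: ennreal_plus intro!: ennreal_leI)
    also have "\<dots> = (\<integral>\<^sup>+x. ennreal \<bar>f (x + r) - f x\<bar> \<partial>lborel) + (\<integral>\<^sup>+x. ennreal \<bar>g (x + r) - g x\<bar> \<partial>lborel)"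
      by (intro nn_integral_add) auto
    also have "\<dots> \<le> ennreal (e/2) + ennreal (e/2)" using d1(2)[of r] d2(2)[of r] r by (intro add_mono) auto
    also have "\<dots> = ennreal e" using add.prems by (simp flip: ennreal_plus)
    finally show "(\<integral>\<^sup>+x. ennreal \<bar>f (x + r) + g (x + r) - (f x + g x)\<bar> \<partial>lborel) \<le> ennreal e" .
  qed
next
  case (lim f s)
  note [measurable] = borel_measurable_integrable[OF lim.hyps(1)] borel_measurable_integrable[OF lim.hyps(4)]
  have "(\<lambda>i. \<integral>\<^sup>+x. ennreal (norm (f x - s i x)) \<partial>lborel) \<longlonglongrightarrow> 0"
  proof (rule nn_integral_dominated_convergence_norm)
    show "(\<integral>\<^sup>+x. ennreal (2 * norm (f x)) \<partial>lborel) < \<infinity>"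
      using integrable_mult_right[OF integrable_norm[OF lim.hyps(4)], of 2]
      by (simp add: integrable_iff_bounded ennreal_mult nn_integral_cmult ennreal_mult_less_top)
  qed (use lim.hyps in auto)
  then have "\<forall>\<^sub>F i in sequentially. (\<integral>\<^sup>+x. ennreal (norm (f x - s i x)) \<partial>lborel) < ennreal (e/3)"
    using lim.prems by (intro order_tendstoD) auto
  then obtain i where i: "(\<integral>\<^sup>+x. ennreal \<bar>s i x - f x\<bar> \<partial>lborel) \<le> ennreal (e/3)"
    by (auto simp: eventually_sequentially abs_minus_commute intro: less_imp_le)
  obtain d where d: "d > 0" "\<And>r. \<bar>r\<bar> < d \<Longrightarrow> (\<integral>\<^sup>+x. ennreal \<bar>s i (x + r) - s i x\<bar> \<partial>lborel) \<le> ennreal (e/3)"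
    using lim.IH[of "e/3" i] lim.prems by auto
  show ?case
  proof (intro exI[of _ d] conjI allI impI d(1))
    fix r :: real assume r: "\<bar>r\<bar> < d"
    have "(\<integral>\<^sup>+x. ennreal \<bar>f (x + r) - f x\<bar> \<partial>lborel)
      \<le> (\<integral>\<^sup>+x. ennreal \<bar>s i (x + r) - f (x + r)\<bar> + (ennreal \<bar>s i (x + r) - s i x\<bar> + ennreal \<bar>s i x - f x\<bar>) \<partial>lborel)"
      by (intro nn_integral_mono) (auto simp: ennreal_plus[symmetric] simp del: ennreal_plus intro!: ennreal_leI)
    also have "\<dots> = (\<integral>\<^sup>+x. ennreal \<bar>s i (x + r) - f (x + r)\<bar> \<partial>lborel) +
       ((\<integral>\<^sup>+x. ennreal \<bar>s i (x + r) - s i x\<bar> \<partial>lborel) + (\<integral>\<^sup>+x. ennreal \<bar>s i x - f x\<bar> \<partial>lborel))"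
      by (subst nn_integral_add; (subst nn_integral_add)?; measurable)
    also have "(\<integral>\<^sup>+x. ennreal \<bar>s i (x + r) - f (x + r)\<bar> \<partial>lborel) = (\<integral>\<^sup>+x. ennreal \<bar>s i x - f x\<bar> \<partial>lborel)"
      using nn_integral_real_affine[of "\<lambda>x. ennreal \<bar>s i x - f x\<bar>" 1 r] by (simp add: add.commute)
    also have "\<dots> + ((\<integral>\<^sup>+x. ennreal \<bar>s i (x + r) - s i x\<bar> \<partial>lborel) + \<dots>) \<le> ennreal (e/3) + (ennreal (e/3) + ennreal (e/3))"
      using i d(2)[OF r] by (intro add_mono) auto
    also have "\<dots> = ennreal e" using lim.prems by (simp flip: ennreal_plus)
    finally show "(\<integral>\<^sup>+x. ennreal \<bar>f (x + r) - f x\<bar> \<partial>lborel) \<le> ennreal e" .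
  qed
qed

text \<open>The density of \<open>\<nu>\<close> is integrable, and a shift changes the mass of any
  set by at most the \<open>L^1\<close> distance between the density and its translate. That
  distance does not involve \<open>B\<close>, hence the uniformity.\<close>

lemma absolutely_continuous_translate:
  fixes \<nu> :: "real measure"
  assumes fin: "finite_measure \<nu>" and s: "sets \<nu> = sets borel"
    and ac: "absolutely_continuous lborel \<nu>" and e: "e > 0"
  shows "\<exists>d>0. \<forall>r B. \<bar>r\<bar> < d \<longrightarrow> B \<in> sets borel \<longrightarrow>
    emeasure \<nu> {x. x + r \<in> B} \<le> emeasure \<nu> B + ennreal e"
proof -
  interpret finite_measure \<nu> by fact
  define g where "g = RN_deriv lborel \<nu>"
  have [measurable]: "g \<in> borel_measurable borel" unfolding g_def using borel_measurable_RN_deriv[of lborel \<nu>] by simp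
  have dg: "density lborel g = \<nu>"
    unfolding g_def using ac s by (intro sigma_finite_measure.density_RN_deriv sigma_finite_lborel) auto
  have int: "(\<integral>\<^sup>+x. g x \<partial>lborel) < \<infinity>"
    using emeasure_finite[of UNIV] emeasure_density[of g lborel UNIV] unfolding dg by (simp add: top.not_eq_extremum)
  then have "AE x in lborel. g x \<noteq> \<infinity>" by (intro nn_integral_noteq_infinite) auto
  then have ae: "AE x in lborel. g x = ennreal (enn2real (g x))"
    by eventually_elim (simp add: ennreal_enn2real_if)
  define f where "f x = enn2real (g x)" for x
  have [measurable]: "f \<in> borel_measurable borel" unfolding f_def by simp
  have f0: "f x \<ge> 0" for x by (simp add: f_def)
  have nuf: "emeasure \<nu> B = (\<integral>\<^sup>+x. ennreal (f x) * indicator B x \<partial>lborel)" if "B \<in> sets borel" for B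
    using ae that by (subst dg[symmetric], subst emeasure_density) (auto simp: f_def intro!: nn_integral_cong_AE)
  have "integrable lborel f"
  proof (rule integrableI_bounded)
    have "(\<integral>\<^sup>+x. ennreal (f x) \<partial>lborel) = (\<integral>\<^sup>+x. g x \<partial>lborel)"
      using ae by (intro nn_integral_cong_AE) (auto simp: f_def)
    then show "(\<integral>\<^sup>+ x. ennreal (norm (f x)) \<partial>lborel) < \<infinity>" using int f0 by simp
  qed simp
  then obtain d where d: "d > 0" "\<And>r. \<bar>r\<bar> < d \<Longrightarrow> (\<integral>\<^sup>+x. ennreal \<bar>f (x + r) - f x\<bar> \<partial>lborel) \<le> ennreal e"
    using L1_translate[OF _ e] by blast
  show ?thesis
  proof (intro exI[of _ d] conjI allI impI d(1))
    fix r B assume r: "\<bar>r\<bar> < d" and B[measurable]: "B \<in> sets (borel :: real measure)"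
    have "emeasure \<nu> {x. x + r \<in> B} = (\<integral>\<^sup>+x. ennreal (f x) * indicator B (x + r) \<partial>lborel)"
      by (subst nuf) (auto intro!: nn_integral_cong simp: indicator_def)
    also have "\<dots> = (\<integral>\<^sup>+x. ennreal (f (x + (-r))) * indicator B x \<partial>lborel)"
      using nn_integral_real_affine[of "\<lambda>x. ennreal (f (x + (-r))) * indicator B x" 1 r] by (simp add: add.commute)
    also have "\<dots> \<le> (\<integral>\<^sup>+x. ennreal (f x) * indicator B x + ennreal \<bar>f (x + (-r)) - f x\<bar> \<partial>lborel)"
      using f0 by (intro nn_integral_mono)
        (auto simp: indicator_def ennreal_plus[symmetric] simp del: ennreal_plus intro!: ennreal_leI)
    also have "\<dots> = emeasure \<nu> B + (\<integral>\<^sup>+x. ennreal \<bar>f (x + (-r)) - f x\<bar> \<partial>lborel)"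
      by (subst nn_integral_add) (auto simp: nuf)
    also have "\<dots> \<le> emeasure \<nu> B + ennreal e" using d(2)[of "-r"] r by (intro add_left_mono) auto
    finally show "emeasure \<nu> {x. x + r \<in> B} \<le> emeasure \<nu> B + ennreal e" .
  qed
qed

section \<open>Integrals against convolution powers\<close>

text \<open>Time windows such as \<open>{fst z..t}\<close> have end points that depend on the
  integration variable.\<close>

lemma pred_mem_interval[measurable (raw)]:
  fixes f g h :: "'c \<Rightarrow> real"
  assumes [measurable]: "f \<in> borel_measurable M" "g \<in> borel_measurable M" "h \<in> borel_measurable M"
  shows "Measurable.pred M (\<lambda>x. f x \<in> {g x..h x})" "Measurable.pred M (\<lambda>x. f x \<in> {g x<..h x})"
    "Measurable.pred M (\<lambda>x. f x \<in> {g x..})"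
  unfolding atLeastAtMost_iff greaterThanAtMost_iff atLeast_iff by measurable

text \<open>The integral of \<open>G (r + s)\<close> in \<open>s\<close> against the
  \<open>m\<close>-fold convolution of the image under \<open>k\<close> of Lebesgue measure on
  \<open>J\<close> times \<open>\<sigma>\<close>. The iterated form with a running argument
  \<open>r\<close> gives induction on \<open>m\<close> and joint measurability in all parameters,
  and it never integrates against the image measure, which may fail to be \<sigma>-finite.\<close>

primrec conv_integral ::
  "'b measure \<Rightarrow> (real \<times> 'b \<Rightarrow> real) \<Rightarrow> nat \<Rightarrow> real set \<Rightarrow> (real \<Rightarrow> ennreal) \<Rightarrow> real \<Rightarrow> ennreal" where
  "conv_integral \<sigma> k 0 J G r = G r"
| "conv_integral \<sigma> k (Suc m) J G r =
    (\<integral>\<^sup>+z. indicator J (fst z) * conv_integral \<sigma> k m J G (r + k z) \<partial>(lborel \<Otimes>\<^sub>M \<sigma>))"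

locale mark_space = prob_space \<sigma> for \<sigma> :: "'b measure"
begin

abbreviation "\<Lambda> \<equiv> (lborel :: real measure) \<Otimes>\<^sub>M \<sigma>"
abbreviation "W \<equiv> conv_integral \<sigma>"
abbreviation "integrand (k :: real \<times> 'b \<Rightarrow> _) \<equiv> k \<in> borel_measurable (borel \<Otimes>\<^sub>M \<sigma>)"

sublocale intensity: pair_sigma_finite lborel \<sigma> ..

lemma AE_fst_neq: "AE z in \<Lambda>. fst z \<noteq> s"
proof (rule AE_I')
  have "emeasure \<Lambda> ({s} \<times> space \<sigma>) = emeasure lborel {s} * emeasure \<sigma> (space \<sigma>)"
    by (intro emeasure_pair_measure_Times) auto
  then show "{s} \<times> space \<sigma> \<in> null_sets \<Lambda>" by (auto simp: null_sets_def)
qed (auto simp: space_pair_measure)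

text \<open>Window and integrand carry a parameter because the horizon and the remainder will vary.
  The induction runs only for the joint statement in the parameter and \<open>r\<close>, since each
  step shifts \<open>r\<close> by \<open>k z\<close>.\<close>

lemma measurable_conv_integral:
  assumes k[measurable]: "integrand k"
    and G[measurable]: "(\<lambda>(x, r). G x r) \<in> borel_measurable (N \<Otimes>\<^sub>M borel)"
    and J[measurable]: "Measurable.pred (N \<Otimes>\<^sub>M borel) (\<lambda>(x, s). s \<in> J x)"
  shows "(\<lambda>(x, r). W k m (J x) (G x) r) \<in> borel_measurable (N \<Otimes>\<^sub>M borel)"
proof (induction m)
  case 0
  then show ?case using G by simp
next
  case (Suc m)
  note [measurable] = Suc
  have [measurable]: "Measurable.pred ((N \<Otimes>\<^sub>M borel) \<Otimes>\<^sub>M \<Lambda>) (\<lambda>y. fst (snd y) \<in> J (fst (fst y)))"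
    by (rule measurable_compose[of "\<lambda>y. (fst (fst y), fst (snd y))" _ "N \<Otimes>\<^sub>M borel", OF _ J, simplified])
       measurable
  have [measurable]: "(\<lambda>y. W k m (J (fst (fst y))) (G (fst (fst y))) (snd (fst y) + k (snd y)))
     \<in> borel_measurable ((N \<Otimes>\<^sub>M borel) \<Otimes>\<^sub>M \<Lambda>)"
    by (rule measurable_compose[of "\<lambda>y. (fst (fst y), snd (fst y) + k (snd y))" _ "N \<Otimes>\<^sub>M borel", OF _ Suc, simplified])
       measurable
  have "(\<lambda>y. \<integral>\<^sup>+z. indicator (J (fst y)) (fst z) * W k m (J (fst y)) (G (fst y)) (snd y + k z) \<partial>\<Lambda>)
      \<in> borel_measurable (N \<Otimes>\<^sub>M borel)"
    by (rule intensity.borel_measurable_nn_integral) (simp add: split_beta' indicator_def)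
  then show ?case by (simp add: split_beta')
qed

lemma measurable_conv_integral'[measurable (raw)]:
  assumes k: "integrand k"
    and G: "(\<lambda>(x, r). G x r) \<in> borel_measurable (N \<Otimes>\<^sub>M borel)"
    and J: "Measurable.pred (N \<Otimes>\<^sub>M borel) (\<lambda>(x, s). s \<in> J x)"
    and f: "f \<in> N \<rightarrow>\<^sub>M borel"
  shows "(\<lambda>x. W k m (J x) (G x) (f x)) \<in> borel_measurable N"
  using measurable_compose[of "\<lambda>x. (x, f x)" _ "N \<Otimes>\<^sub>M borel", OF _ measurable_conv_integral[OF k G J]] f
  by simp

lemma conv_integral_mono:
  assumes "\<And>s. G s \<le> G' s" "J \<subseteq> J'"
  shows "W k m J G r \<le> W k m J' G' r"
  using assms
  by (induction m arbitrary: r) (auto intro!: nn_integral_mono mult_mono simp: indicator_def)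

text \<open>The total mass depends on the window but not on \<open>k\<close>, so it can be exchanged
  between two integrands when no finer comparison is available.\<close>

lemma conv_integral_const:
  assumes [measurable]: "J \<in> sets borel"
  shows "W k m J (\<lambda>_. c) r = emeasure lborel J ^ m * c"
proof (induction m arbitrary: r)
  case (Suc m)
  have "(\<integral>\<^sup>+z. indicator J (fst z) \<partial>\<Lambda>) = emeasure \<Lambda> (J \<times> space \<sigma>)"
    using nn_integral_indicator[of "J \<times> space \<sigma>" \<Lambda>]
    by (auto cong: nn_integral_cong simp: space_pair_measure indicator_def
        intro!: nn_integral_cong elim!: trans[rotated])
  also have "\<dots> = emeasure lborel J"
    by (subst emeasure_pair_measure_Times) (auto simp: emeasure_space_1)
  finally show ?case
    by (simp add: Suc nn_integral_multc mult.assoc)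
qed simp

lemma conv_integral_nn_integral:
  assumes [measurable]: "integrand k" "J \<in> sets borel"
    and N: "sigma_finite_measure N"
    and G[measurable]: "(\<lambda>(x, r). G x r) \<in> borel_measurable (N \<Otimes>\<^sub>M borel)"
  shows "W k m J (\<lambda>r. \<integral>\<^sup>+x. G x r \<partial>N) r = (\<integral>\<^sup>+x. W k m J (G x) r \<partial>N)"
proof (induction m arbitrary: r)
  case (Suc m)
  interpret N: sigma_finite_measure N by fact
  interpret NL: pair_sigma_finite N \<Lambda> ..
  have [measurable]: "(\<lambda>y. W k m J (G (fst y)) (r + k (snd y))) \<in> borel_measurable (N \<Otimes>\<^sub>M \<Lambda>)"
    by (rule measurable_conv_integral') auto
  have "W k (Suc m) J (\<lambda>r. \<integral>\<^sup>+x. G x r \<partial>N) r =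
      (\<integral>\<^sup>+z. (\<integral>\<^sup>+x. indicator J (fst z) * W k m J (G x) (r + k z) \<partial>N) \<partial>\<Lambda>)"
    unfolding conv_integral.simps Suc
    by (intro nn_integral_cong nn_integral_cmult[symmetric]) measurable
  also have "\<dots> = (\<integral>\<^sup>+x. (\<integral>\<^sup>+z. indicator J (fst z) * W k m J (G x) (r + k z) \<partial>\<Lambda>) \<partial>N)"
    by (intro NL.Fubini') (simp add: split_beta')
  finally show ?case by simp
qed simp

text \<open>The smallest of the \<open>m + 1\<close> time coordinates is split off; by symmetry every coordinate
  is the smallest one equally often.\<close>

lemma conv_integral_split_min:
  assumes k[measurable]: "integrand k"
    and G[measurable]: "G \<in> borel_measurable borel"
  shows "W k (Suc m) {u..t} G r =
    of_nat (Suc m) * (\<integral>\<^sup>+z. indicator {u..t} (fst z) * W k m {fst z..t} G (r + k z) \<partial>\<Lambda>)"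
proof (induction m arbitrary: u r)
  case 0
  show ?case by simp
next
  case (Suc m)
  interpret LL: pair_sigma_finite \<Lambda> \<Lambda> ..
  define H where "H y z = W k m {fst z..t} G (r + k y + k z)" for y z
  have [measurable]: "(\<lambda>(y, z). H y z) \<in> borel_measurable (\<Lambda> \<Otimes>\<^sub>M \<Lambda>)"
    unfolding H_def split_beta'
    by (rule measurable_conv_integral') (auto simp: split_beta')
  then have [measurable]: "(\<lambda>x. H (fst x) (snd x)) \<in> borel_measurable (\<Lambda> \<Otimes>\<^sub>M \<Lambda>)" by (simp add: split_beta')
  have [measurable]: "(\<lambda>y. H (f y) (g y)) \<in> borel_measurable M"
      if "f \<in> M \<rightarrow>\<^sub>M \<Lambda>" "g \<in> M \<rightarrow>\<^sub>M \<Lambda>" for f g and M :: "'z measure"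
    using that measurable_compose[of "\<lambda>x. (f x, g x)" M "\<Lambda> \<Otimes>\<^sub>M \<Lambda>" "\<lambda>y. H (fst y) (snd y)"] \<open>(\<lambda>x. H (fst x) (snd x)) \<in> _\<close> by simp
  let ?c = "of_nat (Suc m) :: ennreal"
  let ?R = "\<integral>\<^sup>+z. indicator {u..t} (fst z) * W k (Suc m) {fst z..t} G (r + k z) \<partial>\<Lambda>"
  have "W k (Suc (Suc m)) {u..t} G r = (\<integral>\<^sup>+y. indicator {u..t} (fst y) * W k (Suc m) {u..t} G (r + k y) \<partial>\<Lambda>)"
    by simp
  also have "\<dots> = (\<integral>\<^sup>+y. ?c * (\<integral>\<^sup>+z. indicator {u..t} (fst y) * indicator {u..t} (fst z) * H y z \<partial>\<Lambda>) \<partial>\<Lambda>)"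
    unfolding Suc H_def[symmetric]
    by (intro nn_integral_cong) (simp add: mult.assoc nn_integral_cmult mult.left_commute[of _ "1 + of_nat m"])
  also have "\<dots> = ?c * (\<integral>\<^sup>+y. (\<integral>\<^sup>+z. indicator {u..t} (fst y) * indicator {u..t} (fst z) * H y z \<partial>\<Lambda>) \<partial>\<Lambda>)"
    by (intro nn_integral_cmult) measurable
  \<comment> \<open>The induction hypothesis has singled out \<open>z\<close>, the earliest among
    the other coordinates. Either \<open>z\<close> remains the earliest once \<open>y\<close> joins,
    or \<open>y\<close> comes strictly before it.\<close>
  also have "\<dots> = ?c * (\<integral>\<^sup>+y. (\<integral>\<^sup>+z. indicator {u..t} (fst z) * indicator {fst z..t} (fst y) * H y z +
       indicator {u..t} (fst y) * indicator {fst y<..t} (fst z) * H y z \<partial>\<Lambda>) \<partial>\<Lambda>)"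
    by (intro arg_cong[where f="\<lambda>x. ?c * x"] nn_integral_cong) (auto simp: indicator_def)
  also have "\<dots> = ?c * ((\<integral>\<^sup>+y. (\<integral>\<^sup>+z. indicator {u..t} (fst z) * indicator {fst z..t} (fst y) * H y z \<partial>\<Lambda>) \<partial>\<Lambda>) +
      (\<integral>\<^sup>+y. (\<integral>\<^sup>+z. indicator {u..t} (fst y) * indicator {fst y<..t} (fst z) * H y z \<partial>\<Lambda>) \<partial>\<Lambda>))"
    by (subst nn_integral_add[symmetric], measurable)
      (rule arg_cong[where f="\<lambda>x. ?c * x"], rule nn_integral_cong, rule nn_integral_add; measurable)
  also have "(\<integral>\<^sup>+y. (\<integral>\<^sup>+z. indicator {u..t} (fst z) * indicator {fst z..t} (fst y) * H y z \<partial>\<Lambda>) \<partial>\<Lambda>) =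
      (\<integral>\<^sup>+z. (\<integral>\<^sup>+y. indicator {u..t} (fst z) * indicator {fst z..t} (fst y) * H y z \<partial>\<Lambda>) \<partial>\<Lambda>)"
    by (intro LL.Fubini') measurable
  also have "\<dots> = ?R"
    by (intro nn_integral_cong, subst conv_integral.simps(2), subst nn_integral_cmult[symmetric])
      (auto simp: H_def ac_simps intro!: nn_integral_cong, measurable)
  also have "?c * (?R + (\<integral>\<^sup>+y. (\<integral>\<^sup>+z. indicator {u..t} (fst y) * indicator {fst y<..t} (fst z) * H y z \<partial>\<Lambda>) \<partial>\<Lambda>)) =
     ?c * ?R + (\<integral>\<^sup>+y. indicator {u..t} (fst y) * (?c * (\<integral>\<^sup>+z. indicator {fst y..t} (fst z) * H y z \<partial>\<Lambda>)) \<partial>\<Lambda>)"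
  proof -
    \<comment> \<open>Equal times form a null set, so the half-open window may be closed.\<close>
    have "(\<integral>\<^sup>+z. indicator {u..t} (fst y) * indicator {fst y<..t} (fst z) * H y z \<partial>\<Lambda>) =
        indicator {u..t} (fst y) * (\<integral>\<^sup>+z. indicator {fst y..t} (fst z) * H y z \<partial>\<Lambda>)" if "y \<in> space \<Lambda>" for y
      using that
      apply (subst nn_integral_cmult[symmetric])
       apply measurable
      apply (intro nn_integral_cong_AE)
      using AE_fst_neq[of "fst y"] by eventually_elim (auto simp: indicator_def)
    then have "(\<integral>\<^sup>+y. (\<integral>\<^sup>+z. indicator {u..t} (fst y) * indicator {fst y<..t} (fst z) * H y z \<partial>\<Lambda>) \<partial>\<Lambda>)
       = (\<integral>\<^sup>+y. indicator {u..t} (fst y) * (\<integral>\<^sup>+z. indicator {fst y..t} (fst z) * H y z \<partial>\<Lambda>) \<partial>\<Lambda>)"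
      by (intro nn_integral_cong)
    then show ?thesis
      by (simp add: distrib_left nn_integral_cmult[symmetric] mult_ac)
  qed
  \<comment> \<open>If \<open>y\<close> is the earliest, the induction hypothesis on the window
    \<open>{fst y..t}\<close> reassembles the other coordinates. The same integral \<open>?R\<close>
    appears once more, which raises the count by one.\<close>
  also have "(\<integral>\<^sup>+y. indicator {u..t} (fst y) * (?c * (\<integral>\<^sup>+z. indicator {fst y..t} (fst z) * H y z \<partial>\<Lambda>)) \<partial>\<Lambda>) = ?R"
    unfolding Suc H_def by simp
  also have "?c * ?R + ?R = of_nat (Suc (Suc m)) * ?R"
    by (simp add: distrib_right add.commute)
  finally show ?case .
qed

end

section \<open>Poisson points\<close>

locale marked_poisson = mark_space \<sigma> for \<sigma> :: "'b measure" +
  fixes \<alpha> :: real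
  assumes \<alpha>_pos: "\<alpha> > 0"
begin

definition Q :: "(real \<times> 'b) measure" where
  "Q = density lborel (exponential_density \<alpha>) \<Otimes>\<^sub>M \<sigma>"

lemma sets_Q[measurable_cong]: "sets Q = sets (borel \<Otimes>\<^sub>M \<sigma>)"
  unfolding Q_def by (intro sets_pair_measure_cong) auto

lemma prob_space_Q: "prob_space Q"
proof -
  interpret e: prob_space "density lborel (exponential_density \<alpha>)"
    using \<alpha>_pos by (rule prob_space_exponential_density)
  interpret pair_prob_space "density lborel (exponential_density \<alpha>)" \<sigma> ..
  show ?thesis unfolding Q_def by (rule P.prob_space_axioms)
qed

sublocale Q: prob_space Q by (rule prob_space_Q)
sublocale seq: sequence_space Q
  by (simp add: sequence_space_def product_prob_space_def product_prob_space_axioms_def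
     product_sigma_finite_def prob_space_Q Q.sigma_finite_measure_axioms)

abbreviation "S \<equiv> \<Pi>\<^sub>M i\<in>UNIV::nat set. Q"

text \<open>Multiplied by \<open>t ^ m\<close> this is the gamma density of the arrival time that
  follows \<open>m\<close> points. The power is left out because it is the mass of the
  \<open>m\<close>-fold convolution over \<open>{0..t}\<close>.\<close>

abbreviation "gamma_weight m t \<equiv> ennreal (\<alpha> ^ Suc m / fact m * exp (- \<alpha> * t))"

text \<open>\<open>arrival \<omega> 0\<close> is the time origin, so the arrival with index
  \<open>i\<close> in the theorem is \<open>arrival \<omega> (Suc i)\<close>; this explains the
  shift in \<open>point\<close>.\<close>

definition arrival :: "(nat \<Rightarrow> real \<times> 'b) \<Rightarrow> nat \<Rightarrow> real" where
  "arrival \<omega> n = (\<Sum>j<n. fst (\<omega> j))"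

definition point :: "(nat \<Rightarrow> real \<times> 'b) \<Rightarrow> nat \<Rightarrow> real \<times> 'b" where
  "point \<omega> i = (arrival \<omega> (Suc i), snd (\<omega> i))"

lemma measurable_arrival[measurable]: "(\<lambda>\<omega>. arrival \<omega> n) \<in> borel_measurable S"
  unfolding arrival_def by measurable

lemma measurable_point[measurable]: "(\<lambda>\<omega>. point \<omega> n) \<in> S \<rightarrow>\<^sub>M borel \<Otimes>\<^sub>M \<sigma>"
  unfolding point_def by measurable

lemma measurable_shift[measurable]: "(\<lambda>\<omega> i. \<omega> (n + i)) \<in> S \<rightarrow>\<^sub>M S"
  by (rule measurable_PiM_single') (auto simp: space_PiM PiE_def extensional_def)

lemma measurable_shift_Suc[measurable]: "(\<lambda>\<omega> i. \<omega> (Suc i)) \<in> S \<rightarrow>\<^sub>M S"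
  using measurable_shift[of 1] by simp

lemma arrival_case_nat: "arrival (case_nat q \<omega>) (Suc n) = fst q + arrival \<omega> n"
  unfolding arrival_def by (subst sum.lessThan_Suc_shift) simp

lemma nn_integral_first_step:
  assumes [measurable]: "f \<in> borel_measurable S"
  shows "(\<integral>\<^sup>+\<omega>. f \<omega> \<partial>S) = (\<integral>\<^sup>+q. \<integral>\<^sup>+\<omega>. f (case_nat q \<omega>) \<partial>S \<partial>Q)"
proof -
  have "(\<integral>\<^sup>+\<omega>. f \<omega> \<partial>S) = (\<integral>\<^sup>+\<omega>. f \<omega> \<partial>distr (Q \<Otimes>\<^sub>M S) S (\<lambda>(s, \<omega>). case_nat s \<omega>))"
    by (simp add: seq.PiM_iter)
  also have "\<dots> = (\<integral>\<^sup>+y. f (case_nat (fst y) (snd y)) \<partial>(Q \<Otimes>\<^sub>M S))"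
    by (subst nn_integral_distr) (auto simp: split_beta')
  also have "\<dots> = (\<integral>\<^sup>+q. \<integral>\<^sup>+\<omega>. f (case_nat q \<omega>) \<partial>S \<partial>Q)"
    by (subst seq.P.nn_integral_fst[symmetric]) auto
  finally show ?thesis .
qed

lemma nn_integral_Q:
  assumes [measurable]: "integrand g"
  shows "(\<integral>\<^sup>+q. g (u + fst q, snd q) \<partial>Q) =
    (\<integral>\<^sup>+z. indicator {u..} (fst z) * ennreal (\<alpha> * exp (- \<alpha> * (fst z - u))) * g z \<partial>\<Lambda>)"
proof -
  interpret e: prob_space "density lborel (exponential_density \<alpha>)"
    using \<alpha>_pos by (rule prob_space_exponential_density)
  have "(\<integral>\<^sup>+q. g (u + fst q, snd q) \<partial>Q) =
      (\<integral>\<^sup>+e. \<integral>\<^sup>+x. g (u + e, x) \<partial>\<sigma> \<partial>density lborel (exponential_density \<alpha>))"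
    unfolding Q_def by (subst nn_integral_fst[symmetric]) auto
  also have "\<dots> = (\<integral>\<^sup>+e. exponential_density \<alpha> e * (\<integral>\<^sup>+x. g (u + e, x) \<partial>\<sigma>) \<partial>lborel)"
    by (subst nn_integral_density) auto
  also have "\<dots> = (\<integral>\<^sup>+t. exponential_density \<alpha> (t - u) * (\<integral>\<^sup>+x. g (t, x) \<partial>\<sigma>) \<partial>lborel)"
    using nn_integral_real_affine[of "\<lambda>t. exponential_density \<alpha> (t - u) * (\<integral>\<^sup>+x. g (t, x) \<partial>\<sigma>)" 1 u]
    by simp
  also have "\<dots> = (\<integral>\<^sup>+t. \<integral>\<^sup>+x. exponential_density \<alpha> (t - u) * g (t, x) \<partial>\<sigma> \<partial>lborel)"
    by (intro nn_integral_cong nn_integral_cmult[symmetric]) auto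
  also have "\<dots> = (\<integral>\<^sup>+z. exponential_density \<alpha> (fst z - u) * g z \<partial>\<Lambda>)"
    by (subst nn_integral_fst[symmetric]) auto
  also have "\<dots> = (\<integral>\<^sup>+z. indicator {u..} (fst z) * ennreal (\<alpha> * exp (- \<alpha> * (fst z - u))) * g z \<partial>\<Lambda>)"
    by (intro nn_integral_cong) (auto simp: exponential_density_def indicator_def mult.commute algebra_simps)
  finally show ?thesis .
qed

text \<open>The intermediate time \<open>s\<close> cancels from the exponents: given the final time
  \<open>t\<close>, the earlier arrival has a uniform weight. This is the source of the uniform
  distribution of the points before \<open>t\<close>.\<close>

lemma gamma_density_step:
  "ennreal (\<alpha> * exp (- \<alpha> * (s - u))) * gamma_weight m (t - s) =
   ennreal (\<alpha> ^ Suc (Suc m) / fact m * exp (- \<alpha> * (t - u)))"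
proof -
  have e: "exp (- \<alpha> * (t - u)) = exp (- \<alpha> * (s - u)) * exp (- \<alpha> * (t - s))"
    unfolding exp_add[symmetric] by (rule arg_cong[where f=exp]) (simp add: algebra_simps)
  have "\<alpha> ^ Suc (Suc m) / fact m * exp (- \<alpha> * (t - u)) =
              (\<alpha> * exp (- \<alpha> * (s - u))) * (\<alpha> ^ Suc m / fact m * exp (- \<alpha> * (t - s)))"
    unfolding e by simp
  moreover have "ennreal (\<alpha> * exp (- \<alpha> * (s - u))) * gamma_weight m (t - s) = ennreal ((\<alpha> * exp (- \<alpha> * (s - u))) * (\<alpha> ^ Suc m / fact m * exp (- \<alpha> * (t - s))))"
    by (rule ennreal_mult[symmetric]) (use \<alpha>_pos in simp_all)
  ultimately show ?thesis by (simp only:)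
qed

text \<open>The arrival time after the first \<open>m\<close> points has a gamma density, and given that time the
  \<open>m\<close> points before it are independent and uniform up to their order. Hence the sum over them
  is distributed according to a normalised \<open>m\<close>-fold convolution.\<close>

lemma nn_integral_first_points:
  assumes k[measurable]: "integrand k"
    and F[measurable]: "(\<lambda>(t, r, x, w). F t r x w) \<in> borel_measurable (borel \<Otimes>\<^sub>M borel \<Otimes>\<^sub>M \<sigma> \<Otimes>\<^sub>M S)"
  shows "(\<integral>\<^sup>+\<omega>. F (u + arrival \<omega> (Suc m)) (r + (\<Sum>i<m. k (u + arrival \<omega> (Suc i), snd (\<omega> i))))
      (snd (\<omega> m)) (\<lambda>i. \<omega> (Suc m + i)) \<partial>S) =
    (\<integral>\<^sup>+t. indicator {u..} t * (gamma_weight m (t - u) *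
       W k m {u..t} (\<lambda>r. \<integral>\<^sup>+x. \<integral>\<^sup>+w. F t r x w \<partial>S \<partial>\<sigma>) r) \<partial>lborel)"
proof -
  have F'[measurable (raw)]: "(\<lambda>y. F (a y) (b y) (c y) (d y)) \<in> borel_measurable M"
    if "a \<in> borel_measurable M" "b \<in> borel_measurable M" "c \<in> M \<rightarrow>\<^sub>M \<sigma>" "d \<in> M \<rightarrow>\<^sub>M S"
    for a b c d and M :: "'c measure"
    using measurable_compose[of "\<lambda>y. (a y, b y, c y, d y)" M, OF _ F] that by simp
  define \<Psi> where "\<Psi> t r = (\<integral>\<^sup>+x. \<integral>\<^sup>+w. F t r x w \<partial>S \<partial>\<sigma>)" for t r
  have [measurable]: "(\<lambda>(t, r). \<Psi> t r) \<in> borel_measurable (borel \<Otimes>\<^sub>M borel)"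
    unfolding \<Psi>_def by measurable
  have shift: "(\<Sum>i<Suc m. k (u + arrival (case_nat q w) (Suc i), snd (case_nat q w i))) =
     k (u + fst q, snd q) + (\<Sum>i<m. k (u + fst q + arrival w (Suc i), snd (w i)))" for m q w u
    by (subst sum.lessThan_Suc_shift) (simp add: arrival_case_nat add.assoc arrival_def[of _ 0])
  have "(\<integral>\<^sup>+\<omega>. F (u + arrival \<omega> (Suc m)) (r + (\<Sum>i<m. k (u + arrival \<omega> (Suc i), snd (\<omega> i))))
      (snd (\<omega> m)) (\<lambda>i. \<omega> (Suc m + i)) \<partial>S) =
    (\<integral>\<^sup>+t. indicator {u..} t * (gamma_weight m (t - u) *
       W k m {u..t} (\<Psi> t) r) \<partial>lborel)"
  \<comment> \<open>Each step removes the first point, so the starting time \<open>u\<close> and the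
    sum \<open>r\<close> collected so far have to vary.\<close>
  proof (induction m arbitrary: u r)
    case 0
    have "(\<integral>\<^sup>+\<omega>. F (u + arrival \<omega> (Suc 0)) (r + (\<Sum>i<0. k (u + arrival \<omega> (Suc i), snd (\<omega> i))))
        (snd (\<omega> 0)) (\<lambda>i. \<omega> (Suc 0 + i)) \<partial>S) = (\<integral>\<^sup>+q. \<integral>\<^sup>+w. F (u + fst q) r (snd q) w \<partial>S \<partial>Q)"
      by (subst nn_integral_first_step) (auto simp: arrival_def)
    also have "\<dots> = (\<integral>\<^sup>+z. indicator {u..} (fst z) * ennreal (\<alpha> * exp (- \<alpha> * (fst z - u))) *
        (\<integral>\<^sup>+w. F (fst z) r (snd z) w \<partial>S) \<partial>\<Lambda>)"
      using nn_integral_Q[of "\<lambda>z. \<integral>\<^sup>+w. F (fst z) r (snd z) w \<partial>S" u] by simp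
    also have "\<dots> = (\<integral>\<^sup>+t. \<integral>\<^sup>+x. indicator {u..} t * ennreal (\<alpha> * exp (- \<alpha> * (t - u))) *
        (\<integral>\<^sup>+w. F t r x w \<partial>S) \<partial>\<sigma> \<partial>lborel)"
      by (subst nn_integral_fst[symmetric]) auto
    also have "\<dots> = (\<integral>\<^sup>+t. indicator {u..} t * (ennreal (\<alpha> * exp (- \<alpha> * (t - u))) * \<Psi> t r) \<partial>lborel)"
      unfolding \<Psi>_def by (intro nn_integral_cong) (simp add: nn_integral_cmult mult.assoc)
    finally show ?case by simp
  next
    case (Suc m)
    define H where "H z t = W k m {fst z..t} (\<Psi> t) (r + k z)" for z t
    have [measurable]: "(\<lambda>(z, t). H z t) \<in> borel_measurable (\<Lambda> \<Otimes>\<^sub>M lborel)"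
      unfolding H_def split_beta' by (rule measurable_conv_integral') (auto simp: split_beta')
    have [measurable]: "(\<lambda>y. H (f y) (h y)) \<in> borel_measurable M"
      if "f \<in> M \<rightarrow>\<^sub>M \<Lambda>" "h \<in> borel_measurable M" for f h and M :: "'z measure"
      using that measurable_compose[of "\<lambda>x. (f x, h x)" M "\<Lambda> \<Otimes>\<^sub>M lborel" "\<lambda>(z, t). H z t"] by simp
    from this[of fst "(borel \<Otimes>\<^sub>M \<sigma>) \<Otimes>\<^sub>M lborel" snd]
    have [measurable]: "(\<lambda>x. H (fst x) (snd x)) \<in> borel_measurable ((borel \<Otimes>\<^sub>M \<sigma>) \<Otimes>\<^sub>M lborel)"
      by simp
    interpret LB: pair_sigma_finite \<Lambda> lborel ..
    define g where "g z = (\<integral>\<^sup>+t. indicator {fst z..} t * (gamma_weight m (t - fst z) * H z t) \<partial>lborel)" for z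
    have [measurable]: "integrand g"
      unfolding g_def by measurable
    have "(\<integral>\<^sup>+\<omega>. F (u + arrival \<omega> (Suc (Suc m))) (r + (\<Sum>i<Suc m. k (u + arrival \<omega> (Suc i), snd (\<omega> i))))
        (snd (\<omega> (Suc m))) (\<lambda>i. \<omega> (Suc (Suc m) + i)) \<partial>S) =
      (\<integral>\<^sup>+q. \<integral>\<^sup>+w. F (u + fst q + arrival w (Suc m)) (r + k (u + fst q, snd q) +
         (\<Sum>i<m. k (u + fst q + arrival w (Suc i), snd (w i)))) (snd (w m)) (\<lambda>i. w (Suc m + i)) \<partial>S \<partial>Q)"
      apply (subst nn_integral_first_step)
       apply (rule F')
          apply (measurable; fail)
         apply (measurable; fail)
        apply (measurable; fail)
       apply (rule measurable_shift)
      apply (intro nn_integral_cong)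
      unfolding shift
      apply (simp only: arrival_case_nat add.assoc nat.case add_Suc)
      done
    also have "\<dots> = (\<integral>\<^sup>+q. (\<integral>\<^sup>+t. indicator {u + fst q..} t * (gamma_weight m (t - (u + fst q)) *
        H (u + fst q, snd q) t) \<partial>lborel) \<partial>Q)"
      by (intro nn_integral_cong, subst Suc.IH) (simp only: H_def fst_conv snd_conv)
    also have "\<dots> = (\<integral>\<^sup>+q. g (u + fst q, snd q) \<partial>Q)"
      unfolding g_def by simp
    also have "\<dots> = (\<integral>\<^sup>+z. indicator {u..} (fst z) * ennreal (\<alpha> * exp (- \<alpha> * (fst z - u))) *
       (\<integral>\<^sup>+t. indicator {fst z..} t * (gamma_weight m (t - fst z) * H z t) \<partial>lborel) \<partial>\<Lambda>)"
      unfolding g_def[symmetric] by (rule nn_integral_Q) measurable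
    also have "\<dots> = (\<integral>\<^sup>+z. (\<integral>\<^sup>+t. indicator {u..} t * ennreal (\<alpha> ^ Suc (Suc m) / fact m * exp (- \<alpha> * (t - u))) *
         (indicator {u..t} (fst z) * H z t) \<partial>lborel) \<partial>\<Lambda>)"
    proof (rule nn_integral_cong)
      fix z :: "real \<times> 'b" assume z: "z \<in> space \<Lambda>"
      have [measurable]: "H z \<in> borel_measurable borel"
        using measurable_Pair2[OF \<open>(\<lambda>(z, t). H z t) \<in> borel_measurable (\<Lambda> \<Otimes>\<^sub>M lborel)\<close> z] by simp
      have "indicator {u..} (fst z) * ennreal (\<alpha> * exp (- \<alpha> * (fst z - u))) *
          (\<integral>\<^sup>+t. indicator {fst z..} t * (gamma_weight m (t - fst z) * H z t) \<partial>lborel) =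
        (\<integral>\<^sup>+t. indicator {u..} (fst z) * ennreal (\<alpha> * exp (- \<alpha> * (fst z - u))) *
          (indicator {fst z..} t * (gamma_weight m (t - fst z) * H z t)) \<partial>lborel)"
        by (rule nn_integral_cmult[symmetric]) measurable
      also have "\<dots> = (\<integral>\<^sup>+t. indicator {u..} t * ennreal (\<alpha> ^ Suc (Suc m) / fact m * exp (- \<alpha> * (t - u))) *
         (indicator {u..t} (fst z) * H z t) \<partial>lborel)"
      proof (rule nn_integral_cong)
        fix t :: real
        have eq: "ennreal (\<alpha> * exp (- \<alpha> * (fst z - u))) * gamma_weight m (t - fst z) =
            ennreal (\<alpha> ^ Suc (Suc m) / fact m * exp (- \<alpha> * (t - u)))"
          by (rule gamma_density_step)
        have "indicator {u..} (fst z) * a * (indicator {fst z..} t * (c * h)) =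
            indicator {u..} t * (a * c) * (indicator {u..t} (fst z) * h)" for a c h :: ennreal
          by (auto simp: indicator_def mult.assoc)
        from this[of "ennreal (\<alpha> * exp (- \<alpha> * (fst z - u)))" "gamma_weight m (t - fst z)" "H z t"]
        show "indicator {u..} (fst z) * ennreal (\<alpha> * exp (- \<alpha> * (fst z - u))) *
            (indicator {fst z..} t * (gamma_weight m (t - fst z) * H z t)) =
          indicator {u..} t * ennreal (\<alpha> ^ Suc (Suc m) / fact m * exp (- \<alpha> * (t - u))) *
            (indicator {u..t} (fst z) * H z t)"
          unfolding eq .
      qed
      finally show "indicator {u..} (fst z) * ennreal (\<alpha> * exp (- \<alpha> * (fst z - u))) *
          (\<integral>\<^sup>+t. indicator {fst z..} t * (gamma_weight m (t - fst z) * H z t) \<partial>lborel) =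
        (\<integral>\<^sup>+t. indicator {u..} t * ennreal (\<alpha> ^ Suc (Suc m) / fact m * exp (- \<alpha> * (t - u))) *
         (indicator {u..t} (fst z) * H z t) \<partial>lborel)" .
    qed
    also have "\<dots> = (\<integral>\<^sup>+t. (\<integral>\<^sup>+z. indicator {u..} t * ennreal (\<alpha> ^ Suc (Suc m) / fact m * exp (- \<alpha> * (t - u))) *
         (indicator {u..t} (fst z) * H z t) \<partial>\<Lambda>) \<partial>lborel)"
      by (rule LB.Fubini'[symmetric]) measurable
    also have "\<dots> = (\<integral>\<^sup>+t. indicator {u..} t * (gamma_weight (Suc m) (t - u) * W k (Suc m) {u..t} (\<Psi> t) r) \<partial>lborel)"
    proof (rule nn_integral_cong)
      fix t :: real
      have "(\<integral>\<^sup>+z. indicator {u..} t * ennreal (\<alpha> ^ Suc (Suc m) / fact m * exp (- \<alpha> * (t - u))) *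
         (indicator {u..t} (fst z) * H z t) \<partial>\<Lambda>) =
         indicator {u..} t * ennreal (\<alpha> ^ Suc (Suc m) / fact m * exp (- \<alpha> * (t - u))) *
         (\<integral>\<^sup>+z. indicator {u..t} (fst z) * H z t \<partial>\<Lambda>)"
        by (intro nn_integral_cmult) measurable
      \<comment> \<open>Here the order of the points is forgotten: passing from
        \<open>fact m\<close> to \<open>fact (Suc m)\<close> releases the factor
        \<open>Suc m\<close> required by \<open>conv_integral_split_min\<close>.\<close>
      also have cc: "ennreal (\<alpha> ^ Suc (Suc m) / fact m * exp (- \<alpha> * (t - u))) =
         gamma_weight (Suc m) (t - u) * of_nat (Suc m)"
      proof -
        have "\<alpha> ^ Suc (Suc m) / fact m * exp (- \<alpha> * (t - u)) =
            (\<alpha> ^ Suc (Suc m) / fact (Suc m) * exp (- \<alpha> * (t - u))) * real (Suc m)"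
          by (simp add: divide_simps del: of_nat_Suc)
        then show ?thesis
          using \<alpha>_pos unfolding ennreal_of_nat_eq_real_of_nat
          by (simp only:) (rule ennreal_mult; simp)
      qed
      also have "indicator {u..} t * (gamma_weight (Suc m) (t - u) * of_nat (Suc m)) *
          (\<integral>\<^sup>+z. indicator {u..t} (fst z) * H z t \<partial>\<Lambda>) = indicator {u..} t * (gamma_weight (Suc m) (t - u) *
          W k (Suc m) {u..t} (\<Psi> t) r)"
        by (subst conv_integral_split_min) (auto simp: H_def mult.assoc)
      finally show "(\<integral>\<^sup>+z. indicator {u..} t * ennreal (\<alpha> ^ Suc (Suc m) / fact m * exp (- \<alpha> * (t - u))) *
         (indicator {u..t} (fst z) * H z t) \<partial>\<Lambda>) = indicator {u..} t * (gamma_weight (Suc m) (t - u) *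
          W k (Suc m) {u..t} (\<Psi> t) r)"
        unfolding cc .
    qed
    finally show ?case .
  qed
  then show ?thesis unfolding \<Psi>_def .
qed

text \<open>The gamma densities of all arrival times add up to the constant \<alpha>, by the
  exponential series. The points therefore have intensity \<alpha> times \<open>\<Lambda>\<close> on
  nonnegative times.\<close>

theorem campbell:
  assumes [measurable]: "integrand f"
  shows "(\<Sum>m. \<integral>\<^sup>+\<omega>. f (point \<omega> m) \<partial>S) = \<alpha> * (\<integral>\<^sup>+z. indicator {0..} (fst z) * f z \<partial>\<Lambda>)"
proof -
  define c where "c m t = indicator {0..} t * ennreal (\<alpha> ^ Suc m / fact m * exp (- \<alpha> * t) * t ^ m)" for m t
  have [measurable]: "c m \<in> borel_measurable borel" for m unfolding c_def by measurable
  have 1: "(\<integral>\<^sup>+\<omega>. f (point \<omega> m) \<partial>S) = (\<integral>\<^sup>+z. c m (fst z) * f z \<partial>\<Lambda>)" for m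
  proof -
    \<comment> \<open>With the zero integrand the convolution contributes only its mass
      \<open>t ^ m\<close>.\<close>
    have "(\<integral>\<^sup>+\<omega>. f (point \<omega> m) \<partial>S) = (\<integral>\<^sup>+t. indicator {0..} t * (ennreal (\<alpha> ^ Suc m / fact m * exp (- \<alpha> * t)) *
       W (\<lambda>_. 0) m {0..t} (\<lambda>r. \<integral>\<^sup>+x. \<integral>\<^sup>+w. f (t, x) \<partial>S \<partial>\<sigma>) 0) \<partial>lborel)"
      using nn_integral_first_points[of "\<lambda>_. 0" "\<lambda>t r x w. f (t, x)" 0 m 0]
      by (simp add: point_def)
    also have "\<dots> = (\<integral>\<^sup>+t. c m t * (\<integral>\<^sup>+x. f (t, x) \<partial>\<sigma>) \<partial>lborel)"
      using \<alpha>_pos unfolding conv_integral_const[OF atLeastAtMost_borel]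
      by (intro nn_integral_cong) (auto simp: c_def indicator_def seq.P.emeasure_space_1 ennreal_power mult.assoc[symmetric]
         simp flip: ennreal_mult)
    also have "\<dots> = (\<integral>\<^sup>+z. c m (fst z) * f z \<partial>\<Lambda>)"
      by (subst nn_integral_fst[symmetric]) (auto simp: nn_integral_cmult)
    finally show ?thesis .
  qed
  have 2: "(\<Sum>m. c m t) = indicator {0..} t * ennreal \<alpha>" for t
  proof (cases "t \<ge> 0")
    case True
    have "(\<lambda>m. (\<alpha> * t) ^ m /\<^sub>R fact m) sums exp (\<alpha> * t)" by (rule exp_converges)
    then have "(\<lambda>m. \<alpha> * exp (- \<alpha> * t) * ((\<alpha> * t) ^ m /\<^sub>R fact m)) sums (\<alpha> * exp (- \<alpha> * t) * exp (\<alpha> * t))"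
      by (rule sums_mult)
    then have "(\<lambda>m. \<alpha> ^ Suc m / fact m * exp (- \<alpha> * t) * t ^ m) sums \<alpha>"
      by (simp add: exp_minus field_simps power_mult_distrib)
    then have "(\<lambda>m. ennreal (\<alpha> ^ Suc m / fact m * exp (- \<alpha> * t) * t ^ m)) sums ennreal \<alpha>"
      using True \<alpha>_pos by (subst sums_ennreal) auto
    then show ?thesis using True by (simp add: c_def sums_iff)
  qed (simp add: c_def)
  have "(\<Sum>m. \<integral>\<^sup>+\<omega>. f (point \<omega> m) \<partial>S) = (\<integral>\<^sup>+z. (\<Sum>m. c m (fst z)) * f z \<partial>\<Lambda>)"
    unfolding 1 by (subst nn_integral_suminf[symmetric]) auto
  also have "\<dots> = ennreal \<alpha> * (\<integral>\<^sup>+z. indicator {0..} (fst z) * f z \<partial>\<Lambda>)"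
    unfolding 2 by (subst nn_integral_cmult[symmetric]) (auto intro!: nn_integral_cong simp: mult_ac)
  finally show ?thesis .
qed

end

section \<open>A maximal inequality\<close>

text \<open>Freezing the sums once they leave \<open>(-e, e)\<close> makes every factor that the martingale property is
  applied to bounded.\<close>

primrec stopped_sum :: "real \<Rightarrow> (nat \<Rightarrow> 'a \<Rightarrow> real) \<Rightarrow> nat \<Rightarrow> 'a \<Rightarrow> real" where
  "stopped_sum e X 0 \<omega> = 0"
| "stopped_sum e X (Suc n) \<omega> =
    stopped_sum e X n \<omega> + (if \<bar>stopped_sum e X n \<omega>\<bar> < e then X n \<omega> else 0)"

lemma measurable_stopped_sum[measurable]:
  assumes [measurable]: "\<And>n. X n \<in> borel_measurable M"
  shows "stopped_sum e X n \<in> borel_measurable M"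
proof (induction n)
  case 0
  have "stopped_sum e X 0 = (\<lambda>_. 0)" by auto
  then show ?case by simp
next
  case (Suc n)
  note [measurable] = Suc
  have "stopped_sum e X (Suc n) = (\<lambda>\<omega>. stopped_sum e X n \<omega> + (if \<bar>stopped_sum e X n \<omega>\<bar> < e then X n \<omega> else 0))"
    by auto
  then show ?case by simp
qed

text \<open>A frozen sum still inside (-e, e) has never been frozen. Contrapositively, once a
  partial sum has left the interval, every later frozen sum lies outside.\<close>

lemma stopped_sum_eq:
  assumes "\<bar>stopped_sum e X n \<omega>\<bar> < e"
  shows "stopped_sum e X n \<omega> = (\<Sum>i<n. X i \<omega>) \<and> (\<forall>k\<le>n. \<bar>\<Sum>i<k. X i \<omega>\<bar> < e)"
  using assms
proof (induction n)
  case (Suc n)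
  then have "\<bar>stopped_sum e X n \<omega>\<bar> < e" by (auto split: if_splits)
  with Suc show ?case by (auto simp: le_Suc_eq)
qed simp

context prob_space
begin

lemma maximal_inequality:
  fixes X :: "nat \<Rightarrow> 'a \<Rightarrow> real"
  assumes X[measurable]: "\<And>n. X n \<in> borel_measurable M"
    and sq: "\<And>n. integrable M (\<lambda>\<omega>. (X n \<omega>)\<^sup>2)"
    and orth: "\<And>n. expectation (\<lambda>\<omega>. X n \<omega> * (if \<bar>stopped_sum e X n \<omega>\<bar> < e then stopped_sum e X n \<omega> else 0)) = 0"
    and sm: "summable (\<lambda>n. expectation (\<lambda>\<omega>. (X n \<omega>)\<^sup>2))"
    and e: "e > 0"
  shows "prob {\<omega>\<in>space M. \<exists>n. e \<le> \<bar>\<Sum>i<n. X i \<omega>\<bar>} \<le> (\<Sum>n. expectation (\<lambda>\<omega>. (X n \<omega>)\<^sup>2)) / e\<^sup>2"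
proof -
  let ?Y = "stopped_sum e X"
  define Z where "Z n \<omega> = (if \<bar>?Y n \<omega>\<bar> < e then ?Y n \<omega> else 0)" for n \<omega>
  have [measurable]: "Z n \<in> borel_measurable M" for n unfolding Z_def by measurable
  have intXZ: "integrable M (\<lambda>\<omega>. X n \<omega> * Z n \<omega>)" for n
  proof (rule Bochner_Integration.integrable_bound)
    show "integrable M (\<lambda>\<omega>. e * (1 + (X n \<omega>)\<^sup>2))" using sq by auto
    have "\<bar>x\<bar> * \<bar>z\<bar> \<le> e * (1 + x\<^sup>2)" if "\<bar>z\<bar> \<le> e" for x z :: real
    proof -
      have "0 \<le> (\<bar>x\<bar> - 1)\<^sup>2" by simp
      then have "\<bar>x\<bar> \<le> 1 + x\<^sup>2" by (simp add: power2_diff)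
      then have "\<bar>x\<bar> * \<bar>z\<bar> \<le> (1 + x\<^sup>2) * e" using that e by (intro mult_mono) auto
      then show ?thesis by (simp add: mult.commute)
    qed
    then show "AE \<omega> in M. norm (X n \<omega> * Z n \<omega>) \<le> norm (e * (1 + (X n \<omega>)\<^sup>2))"
      using e by (auto simp: Z_def abs_mult)
  qed measurable
  have Y: "integrable M (\<lambda>\<omega>. (?Y n \<omega>)\<^sup>2) \<and>
      expectation (\<lambda>\<omega>. (?Y n \<omega>)\<^sup>2) \<le> (\<Sum>i<n. expectation (\<lambda>\<omega>. (X i \<omega>)\<^sup>2))" for n
  proof (induction n)
    case (Suc n)
    define V where "V \<omega> = (if \<bar>?Y n \<omega>\<bar> < e then (X n \<omega>)\<^sup>2 else 0)" for \<omega>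
    have [measurable]: "V \<in> borel_measurable M" unfolding V_def by measurable
    have V: "integrable M V"
      by (rule Bochner_Integration.integrable_bound[OF sq[of n]]) (auto simp: V_def)
    have eq: "(?Y (Suc n) \<omega>)\<^sup>2 = (?Y n \<omega>)\<^sup>2 + V \<omega> + 2 * (X n \<omega> * Z n \<omega>)" for \<omega>
      by (simp add: V_def Z_def power2_sum)
    have "expectation (\<lambda>\<omega>. (?Y (Suc n) \<omega>)\<^sup>2) = expectation (\<lambda>\<omega>. (?Y n \<omega>)\<^sup>2) + expectation V +
        2 * expectation (\<lambda>\<omega>. X n \<omega> * Z n \<omega>)"
      unfolding eq using Suc V intXZ by simp
    also have "expectation (\<lambda>\<omega>. X n \<omega> * Z n \<omega>) = 0" using orth unfolding Z_def .
    also have "expectation V \<le> expectation (\<lambda>\<omega>. (X n \<omega>)\<^sup>2)"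
      by (rule integral_mono[OF V sq]) (auto simp: V_def)
    finally show ?case unfolding eq using Suc V intXZ by (auto simp: algebra_simps)
  qed simp
  define A where "A n = {\<omega>\<in>space M. \<exists>k\<le>n. e \<le> \<bar>\<Sum>i<k. X i \<omega>\<bar>}" for n
  have [measurable]: "A n \<in> events" for n unfolding A_def by measurable
  have "prob (A n) \<le> (\<Sum>n. expectation (\<lambda>\<omega>. (X n \<omega>)\<^sup>2)) / e\<^sup>2" for n
  proof -
    have "A n \<subseteq> {\<omega>\<in>space M. e\<^sup>2 \<le> (?Y n \<omega>)\<^sup>2}"
    proof
      fix \<omega> assume w: "\<omega> \<in> A n"
      then obtain k where "k \<le> n" "\<not> \<bar>\<Sum>i<k. X i \<omega>\<bar> < e" by (auto simp: A_def not_less)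
      then have "\<not> \<bar>?Y n \<omega>\<bar> < e"
        using stopped_sum_eq[of e X n \<omega>] by blast
      then have "\<bar>e\<bar> \<le> \<bar>?Y n \<omega>\<bar>" using e by simp
      then show "\<omega> \<in> {\<omega>\<in>space M. e\<^sup>2 \<le> (?Y n \<omega>)\<^sup>2}"
        using w by (simp only: abs_le_square_iff) (simp add: A_def)
    qed
    then have "prob (A n) \<le> prob {\<omega>\<in>space M. e\<^sup>2 \<le> (?Y n \<omega>)\<^sup>2}"
      by (intro finite_measure_mono) auto
    also have "\<dots> \<le> expectation (\<lambda>\<omega>. (?Y n \<omega>)\<^sup>2) / e\<^sup>2"
      using Y[of n] e by (intro integral_Markov_inequality_measure[where A="space M"]) auto
    also have "\<dots> \<le> (\<Sum>i<n. expectation (\<lambda>\<omega>. (X i \<omega>)\<^sup>2)) / e\<^sup>2"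
      using Y[of n] by (intro divide_right_mono) auto
    also have "\<dots> \<le> (\<Sum>n. expectation (\<lambda>\<omega>. (X n \<omega>)\<^sup>2)) / e\<^sup>2"
      using sm by (intro divide_right_mono sum_le_suminf) auto
    finally show ?thesis .
  qed
  \<comment> \<open>The bound does not depend on \<open>n\<close>, so it passes to the increasing
    union.\<close>
  moreover have "(\<lambda>n. prob (A n)) \<longlonglongrightarrow> prob (\<Union>n. A n)"
    by (rule finite_Lim_measure_incseq) (auto simp: A_def incseq_def intro: order_trans)
  moreover have "(\<Union>n. A n) = {\<omega>\<in>space M. \<exists>n. e \<le> \<bar>\<Sum>i<n. X i \<omega>\<bar>}" by (auto simp: A_def)
  ultimately show ?thesis by (auto intro: LIMSEQ_le_const2)
qed

text \<open>The maximal inequality for the sequence started at \<open>m\<close> is governed by a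
  tail of a convergent series. So for each \<open>e\<close>, almost surely some starting index keeps
  all its partial sums below \<open>e\<close>, which is the Cauchy criterion.\<close>

lemma AE_summable_of_orthogonal:
  fixes X :: "nat \<Rightarrow> 'a \<Rightarrow> real"
  assumes X[measurable]: "\<And>n. X n \<in> borel_measurable M"
    and sq: "\<And>n. integrable M (\<lambda>\<omega>. (X n \<omega>)\<^sup>2)"
    and orth: "\<And>e m n. e > 0 \<Longrightarrow> expectation (\<lambda>\<omega>. X (m + n) \<omega> *
      (if \<bar>stopped_sum e (\<lambda>i. X (m + i)) n \<omega>\<bar> < e then stopped_sum e (\<lambda>i. X (m + i)) n \<omega> else 0)) = 0"
    and sm: "summable (\<lambda>n. expectation (\<lambda>\<omega>. (X n \<omega>)\<^sup>2))"
  shows "AE \<omega> in M. summable (\<lambda>n. X n \<omega>)"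
proof -
  let ?v = "\<lambda>n. expectation (\<lambda>\<omega>. (X n \<omega>)\<^sup>2)"
  have *: "AE \<omega> in M. \<exists>m. \<forall>n. \<bar>\<Sum>i<n. X (m + i) \<omega>\<bar> < e" if e: "e > 0" for e
  proof -
    define B where "B m = {\<omega>\<in>space M. \<exists>n. e \<le> \<bar>\<Sum>i<n. X (m + i) \<omega>\<bar>}" for m
    have [measurable]: "B m \<in> events" for m unfolding B_def by measurable
    have "prob (B m) \<le> (\<Sum>n. ?v (m + n)) / e\<^sup>2" for m
      unfolding B_def
    proof (rule maximal_inequality[of "\<lambda>i. X (m + i)"])
      show "summable (\<lambda>n. ?v (m + n))"
        using summable_ignore_initial_segment[OF sm, of m] by (simp add: add.commute)
      show "X (m + n) \<in> borel_measurable M" for n by (rule X)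
      show "integrable M (\<lambda>\<omega>. (X (m + n) \<omega>)\<^sup>2)" for n by (rule sq)
    qed (rule orth[OF e], rule e)
    moreover have "prob (\<Inter>m. B m) \<le> prob (B m)" for m
      by (intro finite_measure_mono) auto
    ultimately have le: "prob (\<Inter>m. B m) \<le> (\<Sum>n. ?v (n + m)) / e\<^sup>2" for m
      unfolding add.commute[of _ m] by (rule order_trans[rotated])
    have "(\<lambda>m. (\<Sum>n. ?v (n + m)) / e\<^sup>2) \<longlonglongrightarrow> 0 / e\<^sup>2"
      using suminf_exist_split2[OF sm] e by (intro tendsto_intros) auto
    then have "prob (\<Inter>m. B m) \<le> 0"
      using le by (intro LIMSEQ_le_const) auto
    then have "prob (\<Inter>m. B m) = 0" by (simp add: measure_le_0_iff)
    then have "AE \<omega> in M. \<omega> \<notin> (\<Inter>m. B m)"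
      by (subst (asm) prob_eq_0) auto
    then show ?thesis
      using AE_space by eventually_elim (auto simp: B_def not_le)
  qed
  have "AE \<omega> in M. \<forall>j::nat. \<exists>m. \<forall>n. \<bar>\<Sum>i<n. X (m + i) \<omega>\<bar> < inverse (real (Suc j))"
    unfolding AE_all_countable using * by simp
  then show ?thesis
  proof eventually_elim
    case (elim \<omega>)
    show ?case
      unfolding summable_Cauchy
    proof (intro allI impI)
      fix e :: real assume "e > 0"
      \<comment> \<open>Half of \<open>e\<close>, since a block from \<open>a\<close> to
        \<open>b\<close> is the difference of two sums that start at \<open>m\<close>.\<close>
      then obtain j where j: "inverse (real (Suc j)) < e/2" using reals_Archimedean[of "e/2"] by auto
      obtain m where m: "\<And>n. \<bar>\<Sum>i<n. X (m + i) \<omega>\<bar> < inverse (real (Suc j))" using elim by blast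
      show "\<exists>N. \<forall>m\<ge>N. \<forall>n. norm (sum (\<lambda>n. X n \<omega>) {m..<n}) < e"
      proof (intro exI[of _ m] allI impI)
        fix a b assume a: "m \<le> a"
        show "norm (sum (\<lambda>n. X n \<omega>) {a..<b}) < e"
        proof (cases "a \<le> b")
          case True
          have s: "(\<Sum>i<n. X (m + i) \<omega>) = sum (\<lambda>n. X n \<omega>) {m..<m + n}" for n
            by (rule sum.reindex_bij_witness[of _ "\<lambda>i. i - m" "\<lambda>i. m + i"]) auto
          have "sum (\<lambda>n. X n \<omega>) {a..<b} = (\<Sum>i<b-m. X (m + i) \<omega>) - (\<Sum>i<a-m. X (m + i) \<omega>)"
            unfolding s using a True sum.atLeastLessThan_concat[of m a b "\<lambda>n. X n \<omega>"] by simp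
          then show ?thesis using m[of "b - m"] m[of "a - m"] j unfolding real_norm_def by linarith
        qed (use \<open>e > 0\<close> in simp)
      qed
    qed
  qed
qed

end

section \<open>The compensator\<close>

context marked_poisson
begin

text \<open>Cut the sequence at \<open>n\<close>: the coordinate \<open>n\<close> is the first one
  of an independent copy, while \<open>g\<close> sees only the coordinates before the cut.\<close>

lemma nn_integral_coordinate:
  assumes g[measurable]: "(\<lambda>(\<omega>, q). g \<omega> q) \<in> borel_measurable (S \<Otimes>\<^sub>M Q)"
    and dep: "\<And>\<omega> \<omega>' q. (\<And>i. i < n \<Longrightarrow> \<omega> i = \<omega>' i) \<Longrightarrow> g \<omega> q = g \<omega>' q"
  shows "(\<integral>\<^sup>+\<omega>. g \<omega> (\<omega> n) \<partial>S) = (\<integral>\<^sup>+\<omega>. \<integral>\<^sup>+q. g \<omega> q \<partial>Q \<partial>S)"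
proof -
  have gm: "(\<lambda>y. g (a y) (b y)) \<in> borel_measurable M"
    if "a \<in> M \<rightarrow>\<^sub>M S" "b \<in> M \<rightarrow>\<^sub>M Q" for a b and M :: "'c measure"
    using measurable_compose[OF measurable_Pair[OF that] g] by simp
  have m1: "(\<lambda>\<omega>. g \<omega> (\<omega> n)) \<in> borel_measurable S"
    and m2: "(\<lambda>y. g (fst y) (snd y 0)) \<in> borel_measurable (S \<Otimes>\<^sub>M S)"
    by (rule gm; measurable)+
  have m3: "g \<omega> \<in> borel_measurable Q" if "\<omega> \<in> space S" for \<omega>
    using measurable_Pair2[OF g that] by simp
  have [simp]: "comb_seq n \<omega> \<omega>' n = \<omega>' 0" for \<omega> \<omega>' :: "nat \<Rightarrow> real \<times> 'b" using comb_seq_add[of n \<omega> \<omega>' 0] by simp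
  have [simp]: "g (comb_seq n \<omega> \<omega>') q = g \<omega> q" for \<omega> \<omega>' q
    by (rule dep) (simp add: comb_seq_less)
  have "(\<integral>\<^sup>+\<omega>. g \<omega> (\<omega> n) \<partial>S) = (\<integral>\<^sup>+\<omega>. g \<omega> (\<omega> n) \<partial>distr (S \<Otimes>\<^sub>M S) S (\<lambda>(\<omega>, \<omega>'). comb_seq n \<omega> \<omega>'))"
    by (simp only: seq.PiM_comb_seq)
  also have "\<dots> = (\<integral>\<^sup>+y. g (fst y) (snd y 0) \<partial>(S \<Otimes>\<^sub>M S))"
    by (subst nn_integral_distr[OF measurable_comb_seq], simp only: measurable_distr_eq1 m1)
      (simp add: split_beta')
  also have "\<dots> = (\<integral>\<^sup>+\<omega>. \<integral>\<^sup>+\<omega>'. g \<omega> (\<omega>' 0) \<partial>S \<partial>S)"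
    by (subst seq.P.nn_integral_fst[OF m2, symmetric]) (simp only: fst_conv snd_conv)
  also have "\<dots> = (\<integral>\<^sup>+\<omega>. \<integral>\<^sup>+q. g \<omega> q \<partial>distr S Q (\<lambda>\<omega>. \<omega> 0) \<partial>S)"
    by (rule nn_integral_cong, subst nn_integral_distr) (simp_all add: m3)
  also have "distr S Q (\<lambda>\<omega>. \<omega> 0) = Q" using seq.PiM_component[of 0] by simp
  finally show ?thesis .
qed

text \<open>The martingale difference property: if the mean over coordinate \<open>n\<close>
  vanishes for every past, the whole mean vanishes. Only the composed function has to be integrable,
  which is what Fubini's theorem requires after the cut at \<open>n\<close>.\<close>

lemma integral_coordinate_eq_0:
  fixes g :: "_ \<Rightarrow> _ \<Rightarrow> real"
  assumes g[measurable]: "(\<lambda>(\<omega>, q). g \<omega> q) \<in> borel_measurable (S \<Otimes>\<^sub>M Q)"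
    and dep: "\<And>\<omega> \<omega>' q. (\<And>i. i < n \<Longrightarrow> \<omega> i = \<omega>' i) \<Longrightarrow> g \<omega> q = g \<omega>' q"
    and int: "integrable S (\<lambda>\<omega>. g \<omega> (\<omega> n))"
    and z: "\<And>\<omega>. \<omega> \<in> space S \<Longrightarrow> (\<integral>q. g \<omega> q \<partial>Q) = 0"
  shows "(\<integral>\<omega>. g \<omega> (\<omega> n) \<partial>S) = 0"
proof -
  interpret SS: pair_sigma_finite S S ..
  have gm: "(\<lambda>y. g (a y) (b y)) \<in> borel_measurable M"
    if "a \<in> M \<rightarrow>\<^sub>M S" "b \<in> M \<rightarrow>\<^sub>M Q" for a b and M :: "'c measure"
    using measurable_compose[OF measurable_Pair[OF that] g] by simp
  have m1: "(\<lambda>\<omega>. g \<omega> (\<omega> n)) \<in> borel_measurable S"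
    and m2: "(\<lambda>y. g (fst y) (snd y 0)) \<in> borel_measurable (S \<Otimes>\<^sub>M S)"
    by (rule gm; measurable)+
  have m3: "g \<omega> \<in> borel_measurable Q" if "\<omega> \<in> space S" for \<omega>
    using measurable_Pair2[OF g that] by simp
  have [simp]: "comb_seq n \<omega> \<omega>' n = \<omega>' 0" for \<omega> \<omega>' :: "nat \<Rightarrow> real \<times> 'b" using comb_seq_add[of n \<omega> \<omega>' 0] by simp
  have [simp]: "g (comb_seq n \<omega> \<omega>') q = g \<omega> q" for \<omega> \<omega>' q
    by (rule dep) (simp add: comb_seq_less)
  let ?D = "distr (S \<Otimes>\<^sub>M S) S (\<lambda>(\<omega>, \<omega>'). comb_seq n \<omega> \<omega>')"
  have "integrable ?D (\<lambda>\<omega>. g \<omega> (\<omega> n))" using int by (simp only: seq.PiM_comb_seq)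
  then have int': "integrable (S \<Otimes>\<^sub>M S) (\<lambda>y. g (fst y) (snd y 0))"
    by (subst (asm) integrable_distr_eq[OF measurable_comb_seq m1]) (simp add: split_beta')
  have "(\<integral>\<omega>. g \<omega> (\<omega> n) \<partial>S) = (\<integral>\<omega>. g \<omega> (\<omega> n) \<partial>?D)"
    by (simp only: seq.PiM_comb_seq)
  also have "\<dots> = (\<integral>y. g (fst y) (snd y 0) \<partial>(S \<Otimes>\<^sub>M S))"
    by (subst integral_distr[OF measurable_comb_seq m1]) (simp add: split_beta')
  also have "\<dots> = (\<integral>\<omega>. \<integral>\<omega>'. g \<omega> (\<omega>' 0) \<partial>S \<partial>S)"
    using SS.integral_fst'[OF int'] by simp
  also have "\<dots> = (\<integral>\<omega>. \<integral>q. g \<omega> q \<partial>distr S Q (\<lambda>\<omega>. \<omega> 0) \<partial>S)"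
    by (rule Bochner_Integration.integral_cong[OF refl], subst integral_distr) (simp_all add: m3)
  also have "distr S Q (\<lambda>\<omega>. \<omega> 0) = Q" using seq.PiM_component[of 0] by simp
  also have "(\<integral>\<omega>. \<integral>q. g \<omega> q \<partial>Q \<partial>S) = (\<integral>\<omega>. 0 \<partial>S)"
    by (intro Bochner_Integration.integral_cong refl z)
  finally show ?thesis by simp
qed

lemma nn_integral_Q_fst:
  assumes [measurable]: "h \<in> borel_measurable borel"
  shows "(\<integral>\<^sup>+q. h (fst q) \<partial>Q) = (\<integral>\<^sup>+e. ennreal (exponential_density \<alpha> e) * h e \<partial>lborel)"
proof -
  have "(\<integral>\<^sup>+q. h (fst q) \<partial>Q) = (\<integral>\<^sup>+e. \<integral>\<^sup>+x. h e \<partial>\<sigma> \<partial>density lborel (exponential_density \<alpha>))"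
    unfolding Q_def by (subst nn_integral_fst[symmetric]) auto
  also have "\<dots> = (\<integral>\<^sup>+e. ennreal (exponential_density \<alpha> e) * h e \<partial>lborel)"
    by (subst nn_integral_density) (auto simp: emeasure_space_1)
  finally show ?thesis .
qed

lemma AE_Q_nonneg: "AE q in Q. 0 \<le> fst q"
proof -
  have "(\<integral>\<^sup>+q. indicator {..<0} (fst q) \<partial>Q) = 0"
    by (subst nn_integral_Q_fst) (auto simp: nn_integral_0_iff_AE exponential_density_def indicator_def)
  then have "AE q in Q. indicator {..<0} (fst q) = (0::ennreal)"
    by (subst (asm) nn_integral_0_iff_AE) auto
  then show ?thesis by eventually_elim (auto simp: indicator_def split: if_splits)
qed

lemma nn_integral_Q_tail:
  assumes "0 \<le> s"
  shows "(\<integral>\<^sup>+q. indicator {s..} (fst q) \<partial>Q) = ennreal (exp (- \<alpha> * s))"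
proof -
  have "(\<integral>\<^sup>+q. indicator {s..} (fst q) \<partial>Q) = (\<integral>\<^sup>+e. ennreal (\<alpha> * exp (- \<alpha> * e)) * indicator {s..} e \<partial>lborel)"
    using assms by (subst nn_integral_Q_fst)
     (auto intro!: nn_integral_cong simp: exponential_density_def indicator_def mult.commute)
  also have "\<dots> = ennreal (0 - (- exp (- \<alpha> * s)))"
  proof (rule nn_integral_FTC_atLeast)
    show "((\<lambda>x. - exp (- \<alpha> * x)) \<longlongrightarrow> 0) at_top"
      using \<alpha>_pos by real_asymp
  qed (use \<alpha>_pos in \<open>auto intro!: derivative_eq_intros\<close>)
  finally show ?thesis by simp
qed

text \<open>The weight \<alpha> \<open>exp (- \<alpha> * (s - u))\<close> of a next point at time
  \<open>s\<close> is \<alpha> times the probability that the waiting time is at least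
  \<open>s - u\<close>. Exchanging the integrals turns the mean value at the next point into the
  mean intensity integral accumulated up to it.\<close>

lemma nn_integral_compensator:
  assumes [measurable]: "integrand g"
  shows "(\<integral>\<^sup>+q. g (u + fst q, snd q) \<partial>Q) =
    (\<integral>\<^sup>+q. \<integral>\<^sup>+z. ennreal \<alpha> * indicator {u<..u + fst q} (fst z) * g z \<partial>\<Lambda> \<partial>Q)"
proof -
  interpret QL: pair_sigma_finite Q \<Lambda> ..
  have "(\<integral>\<^sup>+q. \<integral>\<^sup>+z. ennreal \<alpha> * indicator {u<..u + fst q} (fst z) * g z \<partial>\<Lambda> \<partial>Q) =
      (\<integral>\<^sup>+z. \<integral>\<^sup>+q. ennreal \<alpha> * indicator {u<..u + fst q} (fst z) * g z \<partial>Q \<partial>\<Lambda>)"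
    by (rule QL.Fubini'[symmetric]) measurable
  also have "\<dots> = (\<integral>\<^sup>+z. indicator {u<..} (fst z) * ennreal (\<alpha> * exp (- \<alpha> * (fst z - u))) * g z \<partial>\<Lambda>)"
  proof (rule nn_integral_cong)
    fix z :: "real \<times> 'b"
    have "(\<integral>\<^sup>+q. ennreal \<alpha> * indicator {u<..u + fst q} (fst z) * g z \<partial>Q) =
       (\<integral>\<^sup>+q. (ennreal \<alpha> * indicator {u<..} (fst z) * g z) * indicator {fst z - u..} (fst q) \<partial>Q)"
      by (intro nn_integral_cong) (auto simp: indicator_def)
    also have "\<dots> = (ennreal \<alpha> * indicator {u<..} (fst z) * g z) * (\<integral>\<^sup>+q. indicator {fst z - u..} (fst q) \<partial>Q)"
      by (rule nn_integral_cmult) measurable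
    also have "\<dots> = indicator {u<..} (fst z) * ennreal (\<alpha> * exp (- \<alpha> * (fst z - u))) * g z"
    proof (cases "u < fst z")
      case True
      then have "(\<integral>\<^sup>+q. indicator {fst z - u..} (fst q) \<partial>Q) = ennreal (exp (- \<alpha> * (fst z - u)))"
        by (intro nn_integral_Q_tail) simp
      then show ?thesis
        using \<alpha>_pos by (simp only: ennreal_mult[OF less_imp_le[OF \<alpha>_pos] exp_ge_zero]) (simp add: mult_ac)
    qed simp
    finally show "(\<integral>\<^sup>+q. ennreal \<alpha> * indicator {u<..u + fst q} (fst z) * g z \<partial>Q) =
      indicator {u<..} (fst z) * ennreal (\<alpha> * exp (- \<alpha> * (fst z - u))) * g z" .
  qed
  also have "\<dots> = (\<integral>\<^sup>+z. indicator {u..} (fst z) * ennreal (\<alpha> * exp (- \<alpha> * (fst z - u))) * g z \<partial>\<Lambda>)"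
    using AE_fst_neq[of u] by (intro nn_integral_cong_AE) (auto simp: indicator_def elim!: eventually_mono)
  also have "\<dots> = (\<integral>\<^sup>+q. g (u + fst q, snd q) \<partial>Q)"
    by (rule nn_integral_Q[symmetric]) measurable
  finally show ?thesis by simp
qed

text \<open>The compensator of a nonnegative integrand, with values in \<open>ennreal\<close> so
  that it is defined without integrability.\<close>

definition cumulative :: "(real \<times> 'b \<Rightarrow> ennreal) \<Rightarrow> real \<Rightarrow> real \<Rightarrow> ennreal" where
  "cumulative g u t = (\<integral>\<^sup>+z. ennreal \<alpha> * indicator {u<..t} (fst z) * g z \<partial>\<Lambda>)"

lemma measurable_cumulative[measurable]:
  assumes [measurable]: "integrand g" "a \<in> borel_measurable M" "b \<in> borel_measurable M"
  shows "(\<lambda>x. cumulative g (a x) (b x)) \<in> borel_measurable M"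
  unfolding cumulative_def by measurable

lemma nn_integral_interval: "(\<integral>\<^sup>+z. indicator {u<..t} (fst z) \<partial>\<Lambda>) = ennreal (t - u)"
proof -
  have "(\<integral>\<^sup>+z. indicator {u<..t} (fst z) \<partial>\<Lambda>) = (\<integral>\<^sup>+s. \<integral>\<^sup>+x. indicator {u<..t} s \<partial>\<sigma> \<partial>lborel)"
    by (subst nn_integral_fst[symmetric]) auto
  also have "\<dots> = ennreal (t - u)"
    by (cases "u \<le> t") (simp_all add: emeasure_space_1 ennreal_neg)
  finally show ?thesis .
qed

lemma cumulative_le:
  assumes "\<And>z. g z \<le> ennreal c" "0 \<le> c"
  shows "cumulative g u t \<le> ennreal (\<alpha> * c * max 0 (t - u))"
proof -
  have "cumulative g u t \<le> (\<integral>\<^sup>+z. ennreal (\<alpha> * c) * indicator {u<..t} (fst z) \<partial>\<Lambda>)"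
    unfolding cumulative_def
    using assms \<alpha>_pos by (intro nn_integral_mono) (auto simp: indicator_def ennreal_mult intro!: mult_left_mono)
  also have "\<dots> = ennreal (\<alpha> * c) * ennreal (t - u)"
    by (subst nn_integral_cmult) (auto simp: nn_integral_interval)
  also have "\<dots> = ennreal (\<alpha> * c * max 0 (t - u))"
    using assms \<alpha>_pos by (cases "t \<ge> u") (auto simp: ennreal_mult' ennreal_neg max_def)
  finally show ?thesis .
qed

text \<open>The square is a double integral over pairs of times. By symmetry it is at most twice the
  part where the second time does not exceed the first; pairs with equal times are counted twice,
  hence an inequality.\<close>

lemma cumulative_square_le:
  assumes [measurable]: "integrand g"
  shows "(cumulative g u t)\<^sup>2 \<le> 2 * cumulative (\<lambda>z. g z * cumulative g u (fst z)) u t"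
proof -
  interpret LL: pair_sigma_finite \<Lambda> \<Lambda> ..
  let ?G = "\<lambda>y z. ennreal \<alpha> * indicator {u<..t} (fst y) * g y * (ennreal \<alpha> * indicator {u<..fst y} (fst z) * g z)"
  have "(cumulative g u t)\<^sup>2 = (\<integral>\<^sup>+y. ennreal \<alpha> * indicator {u<..t} (fst y) * g y * cumulative g u t \<partial>\<Lambda>)"
    by (subst nn_integral_multc) (auto simp: cumulative_def power2_eq_square)
  also have "\<dots> = (\<integral>\<^sup>+y. \<integral>\<^sup>+z. ennreal \<alpha> * indicator {u<..t} (fst y) * g y * (ennreal \<alpha> * indicator {u<..t} (fst z) * g z) \<partial>\<Lambda> \<partial>\<Lambda>)"
    unfolding cumulative_def by (intro nn_integral_cong nn_integral_cmult[symmetric]) measurable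
  also have "\<dots> \<le> (\<integral>\<^sup>+y. \<integral>\<^sup>+z. ?G y z + ?G z y \<partial>\<Lambda> \<partial>\<Lambda>)"
    by (intro nn_integral_mono) (auto simp: indicator_def mult_ac)
  also have "\<dots> = (\<integral>\<^sup>+y. (\<integral>\<^sup>+z. ?G y z \<partial>\<Lambda>) + (\<integral>\<^sup>+z. ?G z y \<partial>\<Lambda>) \<partial>\<Lambda>)"
    by (intro nn_integral_cong nn_integral_add; measurable)
  also have "\<dots> = (\<integral>\<^sup>+y. \<integral>\<^sup>+z. ?G y z \<partial>\<Lambda> \<partial>\<Lambda>) + (\<integral>\<^sup>+y. \<integral>\<^sup>+z. ?G z y \<partial>\<Lambda> \<partial>\<Lambda>)"
    by (intro nn_integral_add; measurable)
  also have "(\<integral>\<^sup>+y. \<integral>\<^sup>+z. ?G z y \<partial>\<Lambda> \<partial>\<Lambda>) = (\<integral>\<^sup>+y. \<integral>\<^sup>+z. ?G y z \<partial>\<Lambda> \<partial>\<Lambda>)"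
    by (rule LL.Fubini') measurable
  also have "(\<integral>\<^sup>+y. \<integral>\<^sup>+z. ?G y z \<partial>\<Lambda> \<partial>\<Lambda>) = cumulative (\<lambda>z. g z * cumulative g u (fst z)) u t"
    unfolding cumulative_def
    by (intro nn_integral_cong, subst nn_integral_cmult) (auto simp: mult.assoc)
  finally show ?thesis by (simp add: mult_2)
qed

text \<open>Let A and B be the second moments of the compensator and of the value at the next point.
  The triangle bound and \<open>nn_integral_compensator\<close> give A at most twice the mean of
  value times compensator. With \<open>4 * (x * y) \<le> 4 * x\<^sup>2 + y\<^sup>2\<close> it
  follows that \<open>2 * A \<le> 4 * B + A\<close>. Cancelling A requires that it be finite, which
  the bound \<open>c\<close> and the second moment of the exponential law ensure.\<close>

lemma nn_integral_cumulative_square_le: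
  assumes [measurable]: "integrand g"
    and c: "\<And>z. g z \<le> ennreal c" "0 \<le> c"
  shows "(\<integral>\<^sup>+q. (cumulative g u (u + fst q))\<^sup>2 \<partial>Q) \<le> 4 * (\<integral>\<^sup>+q. (g (u + fst q, snd q))\<^sup>2 \<partial>Q)"
    and "(\<integral>\<^sup>+q. (cumulative g u (u + fst q))\<^sup>2 \<partial>Q) < \<infinity>"
proof -
  let ?A = "\<integral>\<^sup>+q. (cumulative g u (u + fst q))\<^sup>2 \<partial>Q"
  let ?B = "\<integral>\<^sup>+q. (g (u + fst q, snd q))\<^sup>2 \<partial>Q"
  have "?A \<le> (\<integral>\<^sup>+q. ennreal ((\<alpha> * c)\<^sup>2) * ennreal ((fst q)\<^sup>2) \<partial>Q)"
  proof (rule nn_integral_mono)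
    fix q :: "real \<times> 'b"
    have "(cumulative g u (u + fst q))\<^sup>2 \<le> (ennreal (\<alpha> * c * max 0 (u + fst q - u)))\<^sup>2"
      by (intro power_mono cumulative_le c) simp
    also have "\<dots> \<le> ennreal ((\<alpha> * c)\<^sup>2 * (fst q)\<^sup>2)"
      using c \<alpha>_pos by (auto simp: ennreal_power max_def power_mult_distrib intro!: ennreal_leI)
    finally show "(cumulative g u (u + fst q))\<^sup>2 \<le> ennreal ((\<alpha> * c)\<^sup>2) * ennreal ((fst q)\<^sup>2)"
      by (simp add: ennreal_mult)
  qed
  also have "\<dots> = ennreal ((\<alpha> * c)\<^sup>2) * (\<integral>\<^sup>+q. ennreal ((fst q)\<^sup>2) \<partial>Q)"
    by (intro nn_integral_cmult) measurable
  also have "(\<integral>\<^sup>+q. ennreal ((fst q)\<^sup>2) \<partial>Q) = (\<integral>\<^sup>+e. ennreal (erlang_density 0 \<alpha> e * e ^ 2) \<partial>lborel)"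
    by (subst nn_integral_Q_fst) (auto simp: ennreal_mult[symmetric] \<alpha>_pos less_imp_le intro!: nn_integral_cong)
  also have "\<dots> = ennreal (fact (0 + 2) / (fact 0 * \<alpha> ^ 2))"
    by (rule nn_integral_erlang_ith_moment[OF \<alpha>_pos])
  also have "ennreal ((\<alpha> * c)\<^sup>2) * \<dots> < \<infinity>" by (simp add: ennreal_mult_less_top)
  finally show fin: "?A < \<infinity>" .
  have young: "4 * (x * y) \<le> 4 * x\<^sup>2 + y\<^sup>2" for x y :: ennreal
  proof (cases "x = \<infinity> \<or> y = \<infinity>")
    case True then show ?thesis by (auto simp: power2_eq_square ennreal_mult_top ennreal_top_mult)
  next
    case False
    then obtain a b where ab: "x = ennreal a" "a \<ge> 0" "y = ennreal b" "b \<ge> 0"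
      by (metis ennreal_cases infinity_ennreal_def)
    have "0 \<le> (2 * a - b)\<^sup>2" by simp
    then have "ennreal (4 * (a * b)) \<le> ennreal (4 * a\<^sup>2 + b\<^sup>2)"
      by (intro ennreal_leI) (simp add: power2_diff)
    then show ?thesis
      unfolding ab(1,3) using ab(2,4) by (simp add: ennreal_mult ennreal_plus ennreal_power)
  qed
  have "?A \<le> (\<integral>\<^sup>+q. 2 * cumulative (\<lambda>z. g z * cumulative g u (fst z)) u (u + fst q) \<partial>Q)"
    by (intro nn_integral_mono cumulative_square_le) measurable
  also have "\<dots> = 2 * (\<integral>\<^sup>+q. cumulative (\<lambda>z. g z * cumulative g u (fst z)) u (u + fst q) \<partial>Q)"
    by (intro nn_integral_cmult) measurable
  also have "(\<integral>\<^sup>+q. cumulative (\<lambda>z. g z * cumulative g u (fst z)) u (u + fst q) \<partial>Q) =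
      (\<integral>\<^sup>+q. g (u + fst q, snd q) * cumulative g u (u + fst q) \<partial>Q)"
    unfolding cumulative_def[of "\<lambda>z. g z * cumulative g u (fst z)"]
    by (subst nn_integral_compensator[symmetric]) auto
  finally have "?A + ?A \<le> 2 * (2 * (\<integral>\<^sup>+q. g (u + fst q, snd q) * cumulative g u (u + fst q) \<partial>Q))"
    unfolding mult_2[of ?A, symmetric] by (rule mult_left_mono) simp
  also have "2 * (2 * (\<integral>\<^sup>+q. g (u + fst q, snd q) * cumulative g u (u + fst q) \<partial>Q)) =
      (\<integral>\<^sup>+q. 4 * (g (u + fst q, snd q) * cumulative g u (u + fst q)) \<partial>Q)"
    by (subst nn_integral_cmult) (simp_all add: mult.assoc[symmetric])
  also have "\<dots> \<le> (\<integral>\<^sup>+q. 4 * (g (u + fst q, snd q))\<^sup>2 + (cumulative g u (u + fst q))\<^sup>2 \<partial>Q)"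
    by (intro nn_integral_mono young)
  also have "\<dots> = (\<integral>\<^sup>+q. 4 * (g (u + fst q, snd q))\<^sup>2 \<partial>Q) + ?A"
    by (intro nn_integral_add) measurable
  also have "(\<integral>\<^sup>+q. 4 * (g (u + fst q, snd q))\<^sup>2 \<partial>Q) = 4 * ?B"
    by (intro nn_integral_cmult) measurable
  finally have "?A + ?A \<le> ?A + 4 * ?B" by (simp add: add.commute)
  then show "?A \<le> 4 * ?B"
    using fin unfolding ennreal_add_left_cancel_le by auto
qed

end

section \<open>Divergence of the arrival times and the signed compensator\<close>

context marked_poisson
begin

text \<open>By \<open>campbell\<close> the mean number of arrivals up to time \<open>c\<close> is
  finite, so almost surely only finitely many occur before each \<open>c\<close>; and the waiting
  times are almost surely nonnegative.\<close>

lemma AE_arrival_at_top: "AE \<omega> in S. incseq (arrival \<omega>) \<and> filterlim (arrival \<omega>) at_top sequentially"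
proof -
  have nn: "AE \<omega> in S. \<forall>i. 0 \<le> fst (\<omega> i)"
    unfolding AE_all_countable using seq.AE_component[OF _ AE_Q_nonneg] by simp
  have "AE \<omega> in S. (\<Sum>m. indicator {..real c} (arrival \<omega> (Suc m))) \<noteq> (\<infinity>::ennreal)" for c :: nat
  proof (rule nn_integral_noteq_infinite)
    have "(\<integral>\<^sup>+\<omega>. (\<Sum>m. indicator {..real c} (arrival \<omega> (Suc m))) \<partial>S) =
        (\<Sum>m. \<integral>\<^sup>+\<omega>. indicator {..real c} (fst (point \<omega> m)) \<partial>S)"
      by (subst nn_integral_suminf) (auto simp: point_def)
    also have "\<dots> = ennreal \<alpha> * (\<integral>\<^sup>+z. indicator {0..} (fst z) * indicator {..real c} (fst z) \<partial>\<Lambda>)"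
      by (rule campbell) measurable
    also have "(\<integral>\<^sup>+z. indicator {0..} (fst z) * indicator {..real c} (fst z) \<partial>\<Lambda>) =
        (\<integral>\<^sup>+s. \<integral>\<^sup>+x. indicator {0..real c} s \<partial>\<sigma> \<partial>lborel)"
      by (subst nn_integral_fst[symmetric]) (auto simp: indicator_def intro!: nn_integral_cong)
    also have "\<dots> = ennreal c" by (simp add: emeasure_space_1)
    finally show "(\<integral>\<^sup>+\<omega>. (\<Sum>m. indicator {..real c} (arrival \<omega> (Suc m))) \<partial>S) \<noteq> \<infinity>"
      by (simp add: ennreal_mult_eq_top_iff)
  qed measurable
  then have "AE \<omega> in S. \<forall>c::nat. (\<Sum>m. indicator {..real c} (arrival \<omega> (Suc m))) \<noteq> (\<infinity>::ennreal)"
    unfolding AE_all_countable by simp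
  with nn show ?thesis
  proof eventually_elim
    case (elim \<omega>)
    have inc: "incseq (arrival \<omega>)"
      using elim(1) by (intro incseq_SucI) (simp add: arrival_def)
    have "\<exists>m. real c < arrival \<omega> m" for c :: nat
    proof (rule ccontr)
      assume "\<not> ?thesis"
      then have "(\<lambda>m. indicator {..real c} (arrival \<omega> (Suc m)) :: ennreal) = (\<lambda>_. 1)"
        by (auto simp: not_less)
      moreover have "(\<Sum>m::nat. 1 :: ennreal) = \<infinity>"
        by (simp add: suminf_eq_SUP ennreal_SUP_of_nat_eq_top)
      ultimately show False using elim(2) by metis
    qed
    then have "filterlim (arrival \<omega>) at_top sequentially"
      unfolding filterlim_at_top eventually_sequentially
      using inc[unfolded incseq_def] reals_Archimedean2 by (meson less_imp_le order_trans)
    with inc show ?case by simp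
  qed
qed

text \<open>The compensator of a signed integrand. The window is open on the left so that
  consecutive windows are disjoint and their drifts add up.\<close>

definition drift :: "(real \<times> 'b \<Rightarrow> real) \<Rightarrow> real \<Rightarrow> real \<Rightarrow> real" where
  "drift f u t = \<alpha> * (\<integral>z. indicator {u<..t} (fst z) * f z \<partial>\<Lambda>)"

text \<open>The martingale difference between time \<open>u\<close> and the next arrival.\<close>

definition increment :: "(real \<times> 'b \<Rightarrow> real) \<Rightarrow> real \<Rightarrow> real \<times> 'b \<Rightarrow> real" where
  "increment f u q = f (u + fst q, snd q) - drift f u (u + fst q)"

lemma measurable_drift[measurable]:
  assumes [measurable]: "integrand f" "a \<in> borel_measurable M" "b \<in> borel_measurable M"
  shows "(\<lambda>x. drift f (a x) (b x)) \<in> borel_measurable M"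
  unfolding drift_def by measurable

lemma measurable_increment[measurable]:
  assumes [measurable]: "integrand f" "a \<in> borel_measurable M" "b \<in> M \<rightarrow>\<^sub>M borel \<Otimes>\<^sub>M \<sigma>"
  shows "(\<lambda>x. increment f (a x) (b x)) \<in> borel_measurable M"
  unfolding increment_def by measurable

context
  fixes f :: "real \<times> 'b \<Rightarrow> real" and c :: real
  assumes f[measurable]: "integrand f"
    and bound: "\<And>z. \<bar>f z\<bar> \<le> c"
begin

lemma bound_nonneg: "0 \<le> c"
  using order_trans[OF abs_ge_zero bound] by blast

lemma integrable_interval: "integrable \<Lambda> (\<lambda>z. indicator {u<..t} (fst z) * f z)"
proof (rule integrableI_bounded)
  have "(\<integral>\<^sup>+z. ennreal (norm (indicator {u<..t} (fst z) * f z)) \<partial>\<Lambda>) \<le> (\<integral>\<^sup>+z. ennreal c * indicator {u<..t} (fst z) \<partial>\<Lambda>)"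
    using bound by (intro nn_integral_mono) (auto simp: indicator_def intro!: ennreal_leI)
  also have "\<dots> = ennreal c * ennreal (t - u)"
    by (subst nn_integral_cmult) (auto simp: nn_integral_interval)
  also have "\<dots> < \<infinity>" by (simp add: ennreal_mult_less_top)
  finally show "(\<integral>\<^sup>+z. ennreal (norm (indicator {u<..t} (fst z) * f z)) \<partial>\<Lambda>) < \<infinity>" .
qed measurable

lemma drift_add:
  assumes "u \<le> t" "t \<le> v"
  shows "drift f u t + drift f t v = drift f u v"
proof -
  have "(indicator {u<..v} (fst z) :: real) * f z = indicator {u<..t} (fst z) * f z + indicator {t<..v} (fst z) * f z" for z
    using assms by (auto simp: indicator_def)
  then show ?thesis
    unfolding drift_def by (simp add: integrable_interval distrib_left)
qed

lemma abs_drift_le_cumulative: "ennreal \<bar>drift f u t\<bar> \<le> cumulative (\<lambda>z. ennreal \<bar>f z\<bar>) u t"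
proof -
  have "ennreal \<bar>drift f u t\<bar> = ennreal \<alpha> * ennreal (norm (\<integral>z. indicator {u<..t} (fst z) * f z \<partial>\<Lambda>))"
    using \<alpha>_pos by (simp add: drift_def abs_mult ennreal_mult)
  also have "\<dots> \<le> ennreal \<alpha> * (\<integral>\<^sup>+z. ennreal (norm (indicator {u<..t} (fst z) * f z)) \<partial>\<Lambda>)"
    by (intro mult_left_mono integral_norm_bound_ennreal integrable_interval) simp
  also have "\<dots> = cumulative (\<lambda>z. ennreal \<bar>f z\<bar>) u t"
    unfolding cumulative_def
    by (subst nn_integral_cmult[symmetric]) (auto intro!: nn_integral_cong simp: indicator_def)
  finally show ?thesis .
qed

lemma drift_eq_cumulative:
  assumes "\<And>z. 0 \<le> f z"
  shows "ennreal (drift f u t) = cumulative (\<lambda>z. ennreal (f z)) u t"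
proof -
  have "ennreal (drift f u t) = ennreal \<alpha> * (\<integral>\<^sup>+z. ennreal (indicator {u<..t} (fst z) * f z) \<partial>\<Lambda>)"
    using \<alpha>_pos assms unfolding drift_def
    by (subst nn_integral_eq_integral[OF integrable_interval]) (auto simp: ennreal_mult')
  also have "\<dots> = cumulative (\<lambda>z. ennreal (f z)) u t"
    unfolding cumulative_def
    by (subst nn_integral_cmult[symmetric]) (auto intro!: nn_integral_cong simp: indicator_def)
  finally show ?thesis .
qed

lemma integrable_f_Q: "integrable Q (\<lambda>q. f (u + fst q, snd q))"
  by (rule Q.integrable_const_bound[of _ c]) (auto simp: bound)

lemma nn_integral_drift_square: "(\<integral>\<^sup>+q. ennreal ((drift f u (u + fst q))\<^sup>2) \<partial>Q) \<le>
    4 * (\<integral>\<^sup>+q. ennreal ((f (u + fst q, snd q))\<^sup>2) \<partial>Q)"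
proof -
  have "(\<integral>\<^sup>+q. ennreal ((drift f u (u + fst q))\<^sup>2) \<partial>Q) \<le> (\<integral>\<^sup>+q. (cumulative (\<lambda>z. ennreal \<bar>f z\<bar>) u (u + fst q))\<^sup>2 \<partial>Q)"
  proof (rule nn_integral_mono)
    fix q :: "real \<times> 'b"
    have "ennreal ((drift f u (u + fst q))\<^sup>2) = (ennreal \<bar>drift f u (u + fst q)\<bar>)\<^sup>2"
      by (simp add: ennreal_power)
    also have "\<dots> \<le> (cumulative (\<lambda>z. ennreal \<bar>f z\<bar>) u (u + fst q))\<^sup>2"
      by (intro power_mono abs_drift_le_cumulative) simp
    finally show "ennreal ((drift f u (u + fst q))\<^sup>2) \<le> (cumulative (\<lambda>z. ennreal \<bar>f z\<bar>) u (u + fst q))\<^sup>2" .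
  qed
  also have "\<dots> \<le> 4 * (\<integral>\<^sup>+q. (ennreal \<bar>f (u + fst q, snd q)\<bar>)\<^sup>2 \<partial>Q)"
    using bound bound_nonneg by (intro nn_integral_cumulative_square_le(1)[of _ c]) (auto intro: ennreal_leI)
  finally show ?thesis by (simp add: ennreal_power)
qed

text \<open>The square of a difference is at most twice the sum of the squares, and the square of
  the drift costs a factor 4: 10 = 2 + 2 * 4.\<close>

lemma nn_integral_increment_square: "(\<integral>\<^sup>+q. ennreal ((increment f u q)\<^sup>2) \<partial>Q) \<le>
    10 * (\<integral>\<^sup>+q. ennreal ((f (u + fst q, snd q))\<^sup>2) \<partial>Q)"
proof -
  let ?B = "\<integral>\<^sup>+q. ennreal ((f (u + fst q, snd q))\<^sup>2) \<partial>Q"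
  have sq: "(a - b)\<^sup>2 \<le> 2 * a\<^sup>2 + 2 * b\<^sup>2" for a b :: real
    using zero_le_power2[of "a + b"] by (simp add: power2_sum power2_diff)
  have "(\<integral>\<^sup>+q. ennreal ((increment f u q)\<^sup>2) \<partial>Q) \<le>
     (\<integral>\<^sup>+q. 2 * ennreal ((f (u + fst q, snd q))\<^sup>2) + 2 * ennreal ((drift f u (u + fst q))\<^sup>2) \<partial>Q)"
  proof (rule nn_integral_mono)
    fix q :: "real \<times> 'b"
    have "ennreal ((increment f u q)\<^sup>2) \<le> ennreal (2 * (f (u + fst q, snd q))\<^sup>2 + 2 * (drift f u (u + fst q))\<^sup>2)"
      unfolding increment_def by (intro ennreal_leI sq)
    then show "ennreal ((increment f u q)\<^sup>2) \<le>
        2 * ennreal ((f (u + fst q, snd q))\<^sup>2) + 2 * ennreal ((drift f u (u + fst q))\<^sup>2)"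
      by (simp add: ennreal_mult ennreal_plus)
  qed
  also have "\<dots> = 2 * ?B + 2 * (\<integral>\<^sup>+q. ennreal ((drift f u (u + fst q))\<^sup>2) \<partial>Q)"
    by (subst nn_integral_add) (auto simp: nn_integral_cmult)
  also have "\<dots> \<le> 2 * ?B + 2 * (4 * ?B)"
    by (intro add_left_mono mult_left_mono nn_integral_drift_square) simp
  also have "\<dots> = 10 * ?B" by (simp add: mult.assoc[symmetric] distrib_right[symmetric])
  finally show ?thesis .
qed

lemma nn_integral_f_square_finite: "(\<integral>\<^sup>+q. ennreal ((f (u + fst q, snd q))\<^sup>2) \<partial>Q) < \<infinity>"
proof -
  have "(\<integral>\<^sup>+q. ennreal ((f (u + fst q, snd q))\<^sup>2) \<partial>Q) \<le> (\<integral>\<^sup>+q. ennreal (c\<^sup>2) \<partial>Q)"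
    using bound bound_nonneg by (intro nn_integral_mono ennreal_leI) (auto simp: abs_le_square_iff[symmetric])
  also have "\<dots> < \<infinity>" by (simp add: Q.emeasure_space_1)
  finally show ?thesis .
qed

lemma integrable_drift_Q: "integrable Q (\<lambda>q. drift f u (u + fst q))"
proof (rule Q.square_integrable_imp_integrable)
  have "(\<integral>\<^sup>+q. ennreal ((drift f u (u + fst q))\<^sup>2) \<partial>Q) < \<infinity>"
    using nn_integral_f_square_finite[of u]
    by (intro le_less_trans[OF nn_integral_drift_square]) (simp add: ennreal_mult_less_top)
  then show "integrable Q (\<lambda>q. (drift f u (u + fst q))\<^sup>2)"
    by (intro integrableI_bounded) auto
qed measurable

end

lemma integral_increment_nonneg:
  assumes f[measurable]: "integrand f" and bound: "\<And>z. 0 \<le> f z" "\<And>z. f z \<le> c"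
  shows "(\<integral>q. f (u + fst q, snd q) \<partial>Q) = (\<integral>q. drift f u (u + fst q) \<partial>Q)"
proof -
  have b: "\<bar>f z\<bar> \<le> c" for z using bound[of z] by simp
  have "(\<integral>\<^sup>+q. ennreal (f (u + fst q, snd q)) \<partial>Q) = (\<integral>\<^sup>+q. ennreal (drift f u (u + fst q)) \<partial>Q)"
    unfolding drift_eq_cumulative[OF f b bound(1)] cumulative_def
    by (rule nn_integral_compensator) measurable
  moreover have "drift f u t \<ge> 0" for t
    unfolding drift_def using bound \<alpha>_pos by simp
  ultimately show ?thesis
    using bound by (simp add: integral_eq_nn_integral)
qed

text \<open>The compensator formula is stated for nonnegative integrands, so it is applied to the
  positive and the negative part; boundedness makes every difference of integrals
  legitimate.\<close>

lemma integral_increment: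
  assumes f[measurable]: "integrand f" and bound: "\<And>z. \<bar>f z\<bar> \<le> c"
  shows "(\<integral>q. increment f u q \<partial>Q) = 0"
proof -
  note i = integrable_f_Q[OF f bound] integrable_drift_Q[OF f bound]
  let ?p = "\<lambda>z. max 0 (f z)" and ?n = "\<lambda>z. max 0 (- f z)"
  have c: "0 \<le> c" by (rule bound_nonneg[OF f bound])
  have b: "\<bar>?p z\<bar> \<le> c" "\<bar>?n z\<bar> \<le> c" "?p z \<le> c" "?n z \<le> c" for z using bound[of z] c by auto
  have m: "integrand ?p" "integrand ?n" by measurable
  have pn: "f z = ?p z - ?n z" for z by auto
  have d: "drift f u t = drift ?p u t - drift ?n u t" for t
  proof -
    have "(\<integral>z. indicator {u<..t} (fst z) * f z \<partial>\<Lambda>) =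
        (\<integral>z. indicator {u<..t} (fst z) * ?p z - indicator {u<..t} (fst z) * ?n z \<partial>\<Lambda>)"
      by (intro Bochner_Integration.integral_cong) (auto simp: max_def)
    also have "\<dots> = (\<integral>z. indicator {u<..t} (fst z) * ?p z \<partial>\<Lambda>) - (\<integral>z. indicator {u<..t} (fst z) * ?n z \<partial>\<Lambda>)"
      by (rule Bochner_Integration.integral_diff[OF integrable_interval[OF m(1) b(1)] integrable_interval[OF m(2) b(2)]])
    finally show ?thesis unfolding drift_def by (simp only: right_diff_distrib)
  qed
  have "(\<integral>q. f (u + fst q, snd q) \<partial>Q) = (\<integral>q. ?p (u + fst q, snd q) \<partial>Q) - (\<integral>q. ?n (u + fst q, snd q) \<partial>Q)"
    by (subst Bochner_Integration.integral_diff[symmetric])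
      (use integrable_f_Q[OF m(1) b(1)] integrable_f_Q[OF m(2) b(2)] pn in auto)
  also have "\<dots> = (\<integral>q. drift ?p u (u + fst q) \<partial>Q) - (\<integral>q. drift ?n u (u + fst q) \<partial>Q)"
    using integral_increment_nonneg[OF m(1) _ b(3)] integral_increment_nonneg[OF m(2) _ b(4)] by simp
  also have "\<dots> = (\<integral>q. drift f u (u + fst q) \<partial>Q)"
    unfolding d using integrable_drift_Q[OF m(1) b(1)] integrable_drift_Q[OF m(2) b(2)] by simp
  finally show "(\<integral>q. increment f u q \<partial>Q) = 0"
    unfolding increment_def using i by simp
qed

section \<open>Compensated sums observed at the arrival times\<close>

context
  fixes f :: "real \<times> 'b \<Rightarrow> real" and c :: real
  assumes f[measurable]: "integrand f"
    and bound: "\<And>z. \<bar>f z\<bar> \<le> c"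
    and sq_finite: "(\<integral>\<^sup>+z. indicator {0..} (fst z) * ennreal ((f z)\<^sup>2) \<partial>\<Lambda>) < \<infinity>"
begin

abbreviation (input) "X n \<omega> \<equiv> increment f (arrival \<omega> n) (\<omega> n)"

abbreviation (input) "energy \<equiv> \<integral>\<^sup>+z. indicator {0..} (fst z) * ennreal ((f z)\<^sup>2) \<partial>\<Lambda>"

lemma arrival_cong: "(\<And>i. i < n \<Longrightarrow> \<omega> i = \<omega>' i) \<Longrightarrow> m \<le> n \<Longrightarrow> arrival \<omega> m = arrival \<omega>' m"
  unfolding arrival_def by (intro sum.cong) auto

lemma stopped_sum_cong:
  assumes "\<And>i. i < m + n \<Longrightarrow> \<omega> i = \<omega>' i"
  shows "stopped_sum e (\<lambda>i. X (m + i)) n \<omega> = stopped_sum e (\<lambda>i. X (m + i)) n \<omega>'"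
  using assms
proof (induction n)
  case (Suc n)
  have "arrival \<omega> (m + n) = arrival \<omega>' (m + n)"
    by (rule arrival_cong[of "m + Suc n"]) (use Suc.prems in auto)
  moreover have "\<omega> (m + n) = \<omega>' (m + n)" using Suc.prems by simp
  moreover have "stopped_sum e (\<lambda>i. X (m + i)) n \<omega> = stopped_sum e (\<lambda>i. X (m + i)) n \<omega>'"
    using Suc by simp
  ultimately show ?case by (simp only: stopped_sum.simps)
qed simp

text \<open>Integrate out coordinate \<open>n\<close> with the past fixed, use the one-step bound,
  and put the coordinate back.\<close>

lemma nn_integral_X_square: "(\<integral>\<^sup>+\<omega>. ennreal ((X n \<omega>)\<^sup>2) \<partial>S) \<le> 10 * (\<integral>\<^sup>+\<omega>. ennreal ((f (point \<omega> n))\<^sup>2) \<partial>S)"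
proof -
  have "(\<integral>\<^sup>+\<omega>. ennreal ((X n \<omega>)\<^sup>2) \<partial>S) =
      (\<integral>\<^sup>+\<omega>. \<integral>\<^sup>+q. ennreal ((increment f (arrival \<omega> n) q)\<^sup>2) \<partial>Q \<partial>S)"
  proof (rule nn_integral_coordinate)
    fix \<omega> \<omega>' :: "nat \<Rightarrow> real \<times> 'b" and q assume "\<And>i. i < n \<Longrightarrow> \<omega> i = \<omega>' i"
    then have "arrival \<omega> n = arrival \<omega>' n" by (rule arrival_cong[OF _ order_refl])
    then show "ennreal ((increment f (arrival \<omega> n) q)\<^sup>2) = ennreal ((increment f (arrival \<omega>' n) q)\<^sup>2)" by simp
  qed measurable
  also have "\<dots> \<le> (\<integral>\<^sup>+\<omega>. 10 * (\<integral>\<^sup>+q. ennreal ((f (arrival \<omega> n + fst q, snd q))\<^sup>2) \<partial>Q) \<partial>S)"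
    by (intro nn_integral_mono nn_integral_increment_square[OF f bound])
  also have "\<dots> = 10 * (\<integral>\<^sup>+\<omega>. \<integral>\<^sup>+q. ennreal ((f (arrival \<omega> n + fst q, snd q))\<^sup>2) \<partial>Q \<partial>S)"
    by (intro nn_integral_cmult) measurable
  also have "(\<integral>\<^sup>+\<omega>. \<integral>\<^sup>+q. ennreal ((f (arrival \<omega> n + fst q, snd q))\<^sup>2) \<partial>Q \<partial>S) =
      (\<integral>\<^sup>+\<omega>. ennreal ((f (arrival \<omega> n + fst (\<omega> n), snd (\<omega> n)))\<^sup>2) \<partial>S)"
  proof (rule nn_integral_coordinate[symmetric])
    fix \<omega> \<omega>' :: "nat \<Rightarrow> real \<times> 'b" and q :: "real \<times> 'b" assume "\<And>i. i < n \<Longrightarrow> \<omega> i = \<omega>' i"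
    then have "arrival \<omega> n = arrival \<omega>' n" by (rule arrival_cong[OF _ order_refl])
    then show "ennreal ((f (arrival \<omega> n + fst q, snd q))\<^sup>2) = ennreal ((f (arrival \<omega>' n + fst q, snd q))\<^sup>2)" by simp
  qed measurable
  finally show ?thesis by (simp add: point_def arrival_def)
qed

lemma suminf_nn_integral_X_square:
  "(\<Sum>n. \<integral>\<^sup>+\<omega>. ennreal ((X n \<omega>)\<^sup>2) \<partial>S) \<le>
    ennreal (10 * \<alpha>) * energy"
proof -
  have "(\<Sum>n. \<integral>\<^sup>+\<omega>. ennreal ((X n \<omega>)\<^sup>2) \<partial>S) \<le> (\<Sum>n. 10 * (\<integral>\<^sup>+\<omega>. ennreal ((f (point \<omega> n))\<^sup>2) \<partial>S))"
    by (intro suminf_le nn_integral_X_square) auto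
  also have "\<dots> = 10 * (\<Sum>n. (\<integral>\<^sup>+\<omega>. ennreal ((f (point \<omega> n))\<^sup>2) \<partial>S))"
    by simp
  also have "(\<Sum>n. (\<integral>\<^sup>+\<omega>. ennreal ((f (point \<omega> n))\<^sup>2) \<partial>S)) =
      \<alpha> * energy"
    by (rule campbell) measurable
  finally show ?thesis using \<alpha>_pos by (simp add: ennreal_mult mult.assoc)
qed

lemma square_integrable_X: "integrable S (\<lambda>\<omega>. (X n \<omega>)\<^sup>2)"
proof (rule integrableI_bounded)
  have "(\<integral>\<^sup>+\<omega>. ennreal ((X n \<omega>)\<^sup>2) \<partial>S) \<le> (\<Sum>n. \<integral>\<^sup>+\<omega>. ennreal ((X n \<omega>)\<^sup>2) \<partial>S)"
    using sum_le_suminf[of "\<lambda>n. \<integral>\<^sup>+\<omega>. ennreal ((X n \<omega>)\<^sup>2) \<partial>S" "{n}"] by simp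
  also note suminf_nn_integral_X_square
  also have "ennreal (10 * \<alpha>) * energy < \<infinity>"
    using sq_finite by (simp add: ennreal_mult_less_top)
  finally show "(\<integral>\<^sup>+\<omega>. ennreal (norm ((X n \<omega>)\<^sup>2)) \<partial>S) < \<infinity>" by simp
qed measurable

lemma expectation_X_square:
  shows "summable (\<lambda>n. \<integral>\<omega>. (X n \<omega>)\<^sup>2 \<partial>S)"
    and "ennreal (\<Sum>n. \<integral>\<omega>. (X n \<omega>)\<^sup>2 \<partial>S) \<le>
      ennreal (10 * \<alpha>) * energy"
proof -
  have eq: "(\<integral>\<^sup>+\<omega>. ennreal ((X n \<omega>)\<^sup>2) \<partial>S) = ennreal (\<integral>\<omega>. (X n \<omega>)\<^sup>2 \<partial>S)" for n
    by (rule nn_integral_eq_integral[OF square_integrable_X]) simp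
  have le: "(\<Sum>n. ennreal (\<integral>\<omega>. (X n \<omega>)\<^sup>2 \<partial>S)) \<le>
      ennreal (10 * \<alpha>) * energy"
    using suminf_nn_integral_X_square unfolding eq .
  also have "\<dots> < \<infinity>" using sq_finite by (simp add: ennreal_mult_less_top)
  finally show sm: "summable (\<lambda>n. \<integral>\<omega>. (X n \<omega>)\<^sup>2 \<partial>S)"
    by (intro summable_suminf_not_top) auto
  show "ennreal (\<Sum>n. \<integral>\<omega>. (X n \<omega>)\<^sup>2 \<partial>S) \<le>
      ennreal (10 * \<alpha>) * energy"
    by (rule order_trans[OF eq_refl le], rule suminf_ennreal2[OF _ sm, symmetric]) simp
qed

text \<open>The second factor is bounded and predictable, and the increment has mean zero given the
  past by \<open>integral_increment\<close>.\<close>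

lemma X_orthogonal:
  assumes e: "e > 0"
  shows "(\<integral>\<omega>. X (m + n) \<omega> *
      (if \<bar>stopped_sum e (\<lambda>i. X (m + i)) n \<omega>\<bar> < e then stopped_sum e (\<lambda>i. X (m + i)) n \<omega> else 0) \<partial>S) = 0"
proof -
  define Z where "Z \<omega> = (if \<bar>stopped_sum e (\<lambda>i. X (m + i)) n \<omega>\<bar> < e then stopped_sum e (\<lambda>i. X (m + i)) n \<omega> else 0)" for \<omega>
  have [measurable]: "Z \<in> borel_measurable S" unfolding Z_def by measurable
  have Zb: "\<bar>Z \<omega>\<bar> \<le> e" for \<omega> using e by (auto simp: Z_def)
  have iX: "integrable S (X (m + n))"
    by (rule seq.P.square_integrable_imp_integrable[OF _ square_integrable_X]) measurable
  have "(\<integral>\<omega>. increment f (arrival \<omega> (m + n)) (\<omega> (m + n)) * Z \<omega> \<partial>S) = 0"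
  proof (rule integral_coordinate_eq_0[where n="m + n" and g="\<lambda>\<omega> q. increment f (arrival \<omega> (m + n)) q * Z \<omega>"])
    fix \<omega> \<omega>' :: "nat \<Rightarrow> real \<times> 'b" and q assume *: "\<And>i. i < m + n \<Longrightarrow> \<omega> i = \<omega>' i"
    have a: "arrival \<omega> (m + n) = arrival \<omega>' (m + n)" by (rule arrival_cong[OF * order_refl])
    have b: "stopped_sum e (\<lambda>i. X (m + i)) n \<omega> = stopped_sum e (\<lambda>i. X (m + i)) n \<omega>'"
      by (rule stopped_sum_cong[OF *])
    show "increment f (arrival \<omega> (m + n)) q * Z \<omega> = increment f (arrival \<omega>' (m + n)) q * Z \<omega>'"
      by (simp only: Z_def a b)
  next
    show "integrable S (\<lambda>\<omega>. X (m + n) \<omega> * Z \<omega>)"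
    proof (rule Bochner_Integration.integrable_bound)
      show "integrable S (\<lambda>\<omega>. e * X (m + n) \<omega>)" using iX by simp
      show "AE \<omega> in S. norm (X (m + n) \<omega> * Z \<omega>) \<le> norm (e * X (m + n) \<omega>)"
        using Zb e by (auto simp: abs_mult mult.commute[of e] intro!: mult_left_mono)
    qed measurable
  next
    fix \<omega> assume "\<omega> \<in> space S"
    show "(\<integral>q. increment f (arrival \<omega> (m + n)) q * Z \<omega> \<partial>Q) = 0"
      using integral_increment[OF f bound] by simp
  qed measurable
  then show ?thesis unfolding Z_def .
qed

lemma AE_summable_X: "AE \<omega> in S. summable (\<lambda>n. X n \<omega>)"
  by (rule seq.P.AE_summable_of_orthogonal[OF _ square_integrable_X X_orthogonal expectation_X_square(1)])
    measurable

lemma sum_X_maximal: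
  assumes e: "e > 0"
  shows "ennreal (e\<^sup>2) * emeasure S {\<omega>\<in>space S. \<exists>n. e \<le> \<bar>\<Sum>i<n. X i \<omega>\<bar>} \<le>
    ennreal (10 * \<alpha>) * energy"
proof -
  have "seq.P.prob {\<omega>\<in>space S. \<exists>n. e \<le> \<bar>\<Sum>i<n. X i \<omega>\<bar>} \<le> (\<Sum>n. \<integral>\<omega>. (X n \<omega>)\<^sup>2 \<partial>S) / e\<^sup>2"
    by (rule seq.P.maximal_inequality[OF _ square_integrable_X X_orthogonal[OF e, of 0, unfolded add_0]
        expectation_X_square(1) e]) measurable
  then have "e\<^sup>2 * seq.P.prob {\<omega>\<in>space S. \<exists>n. e \<le> \<bar>\<Sum>i<n. X i \<omega>\<bar>} \<le> (\<Sum>n. \<integral>\<omega>. (X n \<omega>)\<^sup>2 \<partial>S)"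
    using e by (simp add: field_simps)
  then have "ennreal (e\<^sup>2 * seq.P.prob {\<omega>\<in>space S. \<exists>n. e \<le> \<bar>\<Sum>i<n. X i \<omega>\<bar>}) \<le>
     ennreal (10 * \<alpha>) * energy"
    by (intro order_trans[OF ennreal_leI expectation_X_square(2)])
  then show ?thesis
    by (simp add: ennreal_mult seq.P.emeasure_eq_measure)
qed

lemma drift_telescope:
  assumes "incseq (arrival \<omega>)"
  shows "(\<Sum>i<n. f (point \<omega> i)) = (\<Sum>i<n. X i \<omega>) + drift f 0 (arrival \<omega> n)"
proof (induction n)
  case 0
  then show ?case by (simp add: arrival_def drift_def)
next
  case (Suc n)
  have le: "arrival \<omega> n \<le> arrival \<omega> (Suc n)" "0 \<le> arrival \<omega> n"
    using incseqD[OF assms, of n "Suc n"] incseqD[OF assms, of 0 n] by (auto simp: arrival_def)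
  have s: "arrival \<omega> n + fst (\<omega> n) = arrival \<omega> (Suc n)" by (simp add: arrival_def)
  show ?case
    using Suc drift_add[OF f bound le(2,1)] by (simp add: increment_def s point_def)
qed

text \<open>The arrival times tend to infinity, so the drift converges to \<open>D\<close> along
  them and the series is the martingale limit plus \<open>D\<close>. If that limit has modulus at
  least \<open>e\<close>, some partial sum exceeds \<open>e / 2\<close>; using the maximal
  inequality at \<open>e / 2\<close> multiplies the constant 10 by 4.\<close>

lemma bounded_series:
  assumes D: "(drift f 0 \<longlongrightarrow> D) at_top"
  shows "AE \<omega> in S. summable (\<lambda>i. f (point \<omega> i))"
    and "e > 0 \<Longrightarrow> ennreal (e\<^sup>2) * emeasure S {\<omega>\<in>space S. e \<le> \<bar>(\<Sum>i. f (point \<omega> i)) - D\<bar>} \<le>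
    ennreal (40 * \<alpha>) * energy"
proof -
  have *: "AE \<omega> in S. summable (\<lambda>i. X i \<omega>) \<and> (\<lambda>i. f (point \<omega> i)) sums ((\<Sum>i. X i \<omega>) + D)"
    using AE_summable_X AE_arrival_at_top
  proof eventually_elim
    case (elim \<omega>)
    have "(\<lambda>n. (\<Sum>i<n. X i \<omega>) + drift f 0 (arrival \<omega> n)) \<longlonglongrightarrow> (\<Sum>i. X i \<omega>) + D"
      using elim by (intro tendsto_add summable_LIMSEQ filterlim_compose[OF D]) auto
    then show ?case
      unfolding sums_def using drift_telescope elim by simp
  qed
  then show "AE \<omega> in S. summable (\<lambda>i. f (point \<omega> i))"
    by eventually_elim (auto simp: sums_iff)
  assume e: "e > 0"
  have "emeasure S {\<omega>\<in>space S. e \<le> \<bar>(\<Sum>i. f (point \<omega> i)) - D\<bar>} \<le>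
      emeasure S {\<omega>\<in>space S. \<exists>n. e / 2 \<le> \<bar>\<Sum>i<n. X i \<omega>\<bar>}"
  proof (rule emeasure_mono_AE)
    show "AE \<omega> in S. \<omega> \<in> {\<omega>\<in>space S. e \<le> \<bar>(\<Sum>i. f (point \<omega> i)) - D\<bar>} \<longrightarrow>
        \<omega> \<in> {\<omega>\<in>space S. \<exists>n. e / 2 \<le> \<bar>\<Sum>i<n. X i \<omega>\<bar>}"
      using *
    proof eventually_elim
      case (elim \<omega>)
      show ?case
      proof
        assume w: "\<omega> \<in> {\<omega>\<in>space S. e \<le> \<bar>(\<Sum>i. f (point \<omega> i)) - D\<bar>}"
        then have "e \<le> \<bar>\<Sum>i. X i \<omega>\<bar>" using elim by (simp add: sums_iff)
        then have "e / 2 < \<bar>\<Sum>i. X i \<omega>\<bar>" using e by simp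
        moreover have "(\<lambda>n. \<bar>\<Sum>i<n. X i \<omega>\<bar>) \<longlonglongrightarrow> \<bar>\<Sum>i. X i \<omega>\<bar>"
          using elim by (intro tendsto_rabs summable_LIMSEQ) simp
        ultimately have "\<forall>\<^sub>F n in sequentially. e / 2 < \<bar>\<Sum>i<n. X i \<omega>\<bar>"
          by (rule order_tendstoD(1)[rotated])
        then obtain n where "e / 2 < \<bar>\<Sum>i<n. X i \<omega>\<bar>" by (auto simp: eventually_sequentially)
        then show "\<omega> \<in> {\<omega>\<in>space S. \<exists>n. e / 2 \<le> \<bar>\<Sum>i<n. X i \<omega>\<bar>}" using w by (auto intro: less_imp_le)
      qed
    qed
  qed measurable
  then have "ennreal (e\<^sup>2) * emeasure S {\<omega>\<in>space S. e \<le> \<bar>(\<Sum>i. f (point \<omega> i)) - D\<bar>} \<le>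
      4 * (ennreal ((e/2)\<^sup>2) * emeasure S {\<omega>\<in>space S. \<exists>n. e / 2 \<le> \<bar>\<Sum>i<n. X i \<omega>\<bar>})"
    by (simp add: mult.assoc[symmetric] power_divide mult_left_mono flip: ennreal_numeral ennreal_mult)
  also have "\<dots> \<le> 4 * (ennreal (10 * \<alpha>) * energy)"
    using e by (intro mult_left_mono sum_X_maximal) auto
  also have "\<dots> = ennreal (40 * \<alpha>) * energy"
    using \<alpha>_pos by (simp add: ennreal_mult mult.assoc[symmetric])
  finally show "ennreal (e\<^sup>2) * emeasure S {\<omega>\<in>space S. e \<le> \<bar>(\<Sum>i. f (point \<omega> i)) - D\<bar>} \<le>
    ennreal (40 * \<alpha>) * energy" .
qed

end

text \<open>The mean of the sum of the terms cut at 1 is finite by \<open>campbell\<close>. Hence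
  almost surely only finitely many terms reach 1, and the series converges absolutely. If the cut
  sum is below \<open>min e 1\<close>, no term was cut and the series is below \<open>e\<close>;
  Markov's inequality for the cut sum does the rest.\<close>

lemma truncated_series:
  assumes [measurable]: "integrand g"
    and fin: "(\<integral>\<^sup>+z. indicator {0..} (fst z) * ennreal (min \<bar>g z\<bar> 1) \<partial>\<Lambda>) < \<infinity>"
  shows "AE \<omega> in S. summable (\<lambda>i. g (point \<omega> i))"
    and "e > 0 \<Longrightarrow> ennreal (min e 1) * emeasure S {\<omega>\<in>space S. e \<le> \<bar>\<Sum>i. g (point \<omega> i)\<bar>} \<le>
      ennreal \<alpha> * (\<integral>\<^sup>+z. indicator {0..} (fst z) * ennreal (min \<bar>g z\<bar> 1) \<partial>\<Lambda>)"
proof -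
  let ?m = "\<lambda>z. min \<bar>g z\<bar> 1"
  let ?V = "\<integral>\<^sup>+z. indicator {0..} (fst z) * ennreal (?m z) \<partial>\<Lambda>"
  have E: "(\<integral>\<^sup>+\<omega>. (\<Sum>i. ennreal (?m (point \<omega> i))) \<partial>S) = ennreal \<alpha> * ?V"
    by (subst nn_integral_suminf, measurable) (rule campbell, measurable)
  have "AE \<omega> in S. (\<Sum>i. ennreal (?m (point \<omega> i))) \<noteq> \<infinity>"
    by (rule nn_integral_noteq_infinite) (use fin E in \<open>auto simp: ennreal_mult_eq_top_iff\<close>)
  then have sm: "AE \<omega> in S. summable (\<lambda>i. ?m (point \<omega> i))"
    by eventually_elim (auto intro!: summable_suminf_not_top)
  have sa: "summable (\<lambda>i. \<bar>g (point \<omega> i)\<bar>)" if "summable (\<lambda>i. ?m (point \<omega> i))" for \<omega>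
  proof -
    have "\<forall>\<^sub>F i in sequentially. ?m (point \<omega> i) < 1"
      using summable_LIMSEQ_zero[OF that] by (rule order_tendstoD) simp
    then have "\<forall>\<^sub>F i in sequentially. ?m (point \<omega> i) = \<bar>g (point \<omega> i)\<bar>"
      by eventually_elim auto
    then show ?thesis using that by (subst (asm) summable_cong) auto
  qed
  from sm show "AE \<omega> in S. summable (\<lambda>i. g (point \<omega> i))"
    by eventually_elim (rule summable_rabs_cancel[OF sa])
  assume e: "e > 0"
  have "emeasure S {\<omega>\<in>space S. e \<le> \<bar>\<Sum>i. g (point \<omega> i)\<bar>} \<le>
     emeasure S {\<omega>\<in>space S. ennreal (min e 1) \<le> (\<Sum>i. ennreal (?m (point \<omega> i)))}"
  proof (rule emeasure_mono_AE)
    show "AE \<omega> in S. \<omega> \<in> {\<omega>\<in>space S. e \<le> \<bar>\<Sum>i. g (point \<omega> i)\<bar>} \<longrightarrow>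
       \<omega> \<in> {\<omega>\<in>space S. ennreal (min e 1) \<le> (\<Sum>i. ennreal (?m (point \<omega> i)))}"
      using sm
    proof eventually_elim
      case (elim \<omega>)
      have s2: "(\<Sum>i. ennreal (?m (point \<omega> i))) = ennreal (\<Sum>i. ?m (point \<omega> i))"
        by (rule suminf_ennreal2) (use elim in auto)
      have "\<bar>\<Sum>i. g (point \<omega> i)\<bar> < e" if lt: "(\<Sum>i. ?m (point \<omega> i)) < min e 1"
      proof -
        have "?m (point \<omega> i) \<le> (\<Sum>i. ?m (point \<omega> i))" for i
          using sum_le_suminf[OF elim, of "{i}"] by simp
        then have "?m (point \<omega> i) < 1" for i using lt by (metis le_less_trans min_less_iff_conj)
        then have "?m (point \<omega> i) = \<bar>g (point \<omega> i)\<bar>" for i by (metis min_def less_irrefl)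
        then have "(\<Sum>i. ?m (point \<omega> i)) = (\<Sum>i. \<bar>g (point \<omega> i)\<bar>)" by simp
        then show ?thesis using lt summable_rabs[OF sa[OF elim]] by simp
      qed
      then have "ennreal (min e 1) \<le> (\<Sum>i. ennreal (?m (point \<omega> i)))" if "e \<le> \<bar>\<Sum>i. g (point \<omega> i)\<bar>"
        unfolding s2 using that by (intro ennreal_leI) (meson not_less)
      then show ?case by (simp only: mem_Collect_eq) blast
    qed
  qed measurable
  then have "ennreal (min e 1) * emeasure S {\<omega>\<in>space S. e \<le> \<bar>\<Sum>i. g (point \<omega> i)\<bar>} \<le>
     ennreal (min e 1) * emeasure S {\<omega>\<in>space S. ennreal (min e 1) \<le> (\<Sum>i. ennreal (?m (point \<omega> i)))}"
    by (rule mult_left_mono) simp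
  also have "\<dots> = (\<integral>\<^sup>+\<omega>. ennreal (min e 1) * indicator {\<omega>\<in>space S. ennreal (min e 1) \<le> (\<Sum>i. ennreal (?m (point \<omega> i)))} \<omega> \<partial>S)"
    by (subst nn_integral_cmult_indicator) auto
  also have "\<dots> \<le> (\<integral>\<^sup>+\<omega>. (\<Sum>i. ennreal (?m (point \<omega> i))) \<partial>S)"
    by (intro nn_integral_mono) (auto simp: indicator_def)
  finally show "ennreal (min e 1) * emeasure S {\<omega>\<in>space S. e \<le> \<bar>\<Sum>i. g (point \<omega> i)\<bar>} \<le> ennreal \<alpha> * ?V"
    unfolding E .
qed

end

section \<open>Convergence in probability\<close>

lemma tendsto_0_ennrealI:
  fixes X :: "'c \<Rightarrow> ennreal"
  assumes "\<And>e::real. e > 0 \<Longrightarrow> \<forall>\<^sub>F n in F. X n \<le> ennreal e"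
  shows "(X \<longlongrightarrow> 0) F"
proof (rule order_tendstoI)
  fix a :: ennreal assume "0 < a"
  then obtain b where b: "0 < b" "b < a" using dense by blast
  then have "b = ennreal (enn2real b)" by (metis ennreal_enn2real_if less_top top.not_eq_extremum order_less_imp_not_less top_greatest leD)
  moreover from this b have "0 < enn2real b" by (metis enn2real_nonneg ennreal_0 less_irrefl less_le)
  ultimately show "\<forall>\<^sub>F n in F. X n < a"
    using assms[of "enn2real b"] b(2) by (auto elim!: eventually_mono intro: le_less_trans)
qed simp

lemma tendsto_0_ennrealD:
  fixes X :: "'c \<Rightarrow> ennreal"
  assumes "(X \<longlongrightarrow> 0) F" "e > 0"
  shows "\<forall>\<^sub>F n in F. X n \<le> ennreal e"
  using order_tendstoD(2)[OF assms(1), of "ennreal e"] assms(2) by (auto elim!: eventually_mono intro: less_imp_le)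

lemma ennreal_mult_left_cancel_le:
  assumes "0 < c" "ennreal c * x \<le> ennreal c * y"
  shows "x \<le> y"
  using assms by (subst (asm) ennreal_mult_le_mult_iff) auto

definition truncate :: "('c \<Rightarrow> real) \<Rightarrow> 'c \<Rightarrow> real" where
  "truncate k z = (if \<bar>k z\<bar> \<le> 1 then k z else 0)"

lemma measurable_truncate[measurable]:
  assumes [measurable]: "k \<in> borel_measurable M"
  shows "truncate k \<in> borel_measurable M"
  unfolding truncate_def[abs_def] by measurable

context marked_poisson
begin

text \<open>The number \<open>a\<close> is the limit of the drift and therefore contains the factor
  \<alpha>. Integrands vanish at negative times, so the integrals need no time window.\<close>

definition admissible :: "(real \<times> 'b \<Rightarrow> real) \<Rightarrow> real \<Rightarrow> bool" where
  "admissible k a \<longleftrightarrow> k \<in> borel_measurable (borel \<Otimes>\<^sub>M \<sigma>) \<and> (\<forall>z. fst z < 0 \<longrightarrow> k z = 0) \<and>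
    (\<integral>\<^sup>+z. ennreal (min ((k z)\<^sup>2) 1) \<partial>\<Lambda>) < \<infinity> \<and> (drift (truncate k) 0 \<longlongrightarrow> a) at_top"

text \<open>The truncated part is bounded and square integrable, so its compensated sums converge;
  the large part is covered by \<open>truncated_series\<close>. Both integrals are dominated by that
  of \<open>min ((k z)\<^sup>2) 1\<close>.\<close>

lemma admissible_series:
  assumes k: "admissible k a"
  shows "AE \<omega> in S. summable (\<lambda>i. truncate k (point \<omega> i)) \<and> summable (\<lambda>i. (k (point \<omega> i) - truncate k (point \<omega> i)))"
proof -
  have [measurable]: "integrand k"
    and fin: "(\<integral>\<^sup>+z. ennreal (min ((k z)\<^sup>2) 1) \<partial>\<Lambda>) < \<infinity>"
    and D: "(drift (truncate k) 0 \<longlongrightarrow> a) at_top"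
    using k by (auto simp: admissible_def)
  have tb: "\<bar>truncate k z\<bar> \<le> 1" for z by (simp add: truncate_def)
  have "(\<integral>\<^sup>+z. indicator {0..} (fst z) * ennreal ((truncate k z)\<^sup>2) \<partial>\<Lambda>) \<le> (\<integral>\<^sup>+z. ennreal (min ((k z)\<^sup>2) 1) \<partial>\<Lambda>)"
    by (intro nn_integral_mono)
      (auto simp: indicator_def truncate_def abs_square_le_1 intro!: ennreal_leI)
  with fin have f1: "(\<integral>\<^sup>+z. indicator {0..} (fst z) * ennreal ((truncate k z)\<^sup>2) \<partial>\<Lambda>) < \<infinity>" by (rule le_less_trans[rotated])
  have "min \<bar>k z - truncate k z\<bar> 1 \<le> min ((k z)\<^sup>2) 1" for z
    using abs_square_le_1[of "k z"] by (auto simp: min_def truncate_def)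
  then have "(\<integral>\<^sup>+z. indicator {0..} (fst z) * ennreal (min \<bar>k z - truncate k z\<bar> 1) \<partial>\<Lambda>) \<le> (\<integral>\<^sup>+z. ennreal (min ((k z)\<^sup>2) 1) \<partial>\<Lambda>)"
    by (intro nn_integral_mono) (simp add: indicator_def ennreal_leI)
  with fin have f2: "(\<integral>\<^sup>+z. indicator {0..} (fst z) * ennreal (min \<bar>k z - truncate k z\<bar> 1) \<partial>\<Lambda>) < \<infinity>" by (rule le_less_trans[rotated])
  have "AE \<omega> in S. summable (\<lambda>i. truncate k (point \<omega> i))"
    by (rule bounded_series(1)[OF _ tb f1 D]) measurable
  moreover have "AE \<omega> in S. summable (\<lambda>i. (k (point \<omega> i) - truncate k (point \<omega> i)))"
    by (rule truncated_series(1)[OF _ f2]) measurable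
  ultimately show ?thesis by eventually_elim simp
qed

lemma admissible_summable:
  assumes k: "admissible k a"
  shows "AE \<omega> in S. summable (\<lambda>i. k (point \<omega> i))"
  using admissible_series[OF k]
proof eventually_elim
  case (elim \<omega>)
  then show ?case using summable_add[of "\<lambda>i. truncate k (point \<omega> i)" "\<lambda>i. k (point \<omega> i) - truncate k (point \<omega> i)"] by simp
qed

text \<open>Values of \<open>h\<close> at \<open>\<plusminus>1\<close> are the only obstruction to the continuity of the truncation.\<close>

lemma truncation_error_bound:
  fixes x y d :: real
  assumes d: "0 < d" "d < 1"
  defines "tr \<equiv> \<lambda>x. if \<bar>x\<bar> \<le> 1 then x else 0"
  defines "R \<equiv> 5 / d\<^sup>2 * min ((x - y)\<^sup>2) 1 + of_bool (\<bar>\<bar>y\<bar> - 1\<bar> < d) + d * of_bool (1 < \<bar>y\<bar>)"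
  shows "(tr x - tr y)\<^sup>2 \<le> R" "min \<bar>(x - tr x) - (y - tr y)\<bar> 1 \<le> R"
proof -
  let ?q = "min ((x - y)\<^sup>2) 1"
  have d2: "d\<^sup>2 < 1" "d\<^sup>2 > 0" using d by (simp_all add: abs_square_less_1)
  have q0: "0 \<le> ?q" by simp
  have c5: "5 \<le> 5 / d\<^sup>2"
    using d d2 by (auto simp: field_simps power2_eq_square mult_le_one)
  have qd: "1 \<le> 5 / d\<^sup>2 * ?q" if "d \<le> \<bar>x - y\<bar>"
  proof -
    have "d\<^sup>2 \<le> (x - y)\<^sup>2" using that d by (simp add: abs_le_square_iff[symmetric])
    then have "d\<^sup>2 \<le> ?q" using d2 by simp
    then have "d\<^sup>2 \<le> 5 * ?q" using q0 by linarith
    then show ?thesis using d2 by (simp add: field_simps del: min_less_iff_conj)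
  qed
  \<comment> \<open>Exactly one of the two values is truncated: either they are at least
    \<open>d\<close> apart, or \<open>y\<close> is within \<open>d\<close> of a truncation
    level.\<close>
  have mixed: "1 \<le> R" if "\<bar>x\<bar> \<le> 1 \<and> 1 < \<bar>y\<bar> \<or> \<bar>y\<bar> \<le> 1 \<and> 1 < \<bar>x\<bar>"
  proof (cases "d \<le> \<bar>x - y\<bar>")
    case True
    then have "1 \<le> 5 / d\<^sup>2 * ?q" by (rule qd)
    moreover have "0 \<le> of_bool (\<bar>\<bar>y\<bar> - 1\<bar> < d) + d * of_bool (1 < \<bar>y\<bar>)" using d by simp
    ultimately show ?thesis unfolding R_def by linarith
  next
    case False
    then have "\<bar>\<bar>y\<bar> - 1\<bar> < d" using that by arith
    then show ?thesis using q0 d d2 unfolding R_def by (auto simp: of_bool_def)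
  qed
  have R0: "5 / d\<^sup>2 * ?q \<le> R" "0 \<le> R" using q0 d d2 unfolding R_def by (auto simp: of_bool_def)
  show "(tr x - tr y)\<^sup>2 \<le> R"
  proof -
    consider "\<bar>x\<bar> \<le> 1" "\<bar>y\<bar> \<le> 1" | "\<bar>x\<bar> > 1" "\<bar>y\<bar> > 1" | "\<bar>x\<bar> \<le> 1 \<and> 1 < \<bar>y\<bar> \<or> \<bar>y\<bar> \<le> 1 \<and> 1 < \<bar>x\<bar>" by arith
    then show ?thesis
    proof cases
      case 1
      then have "\<bar>x - y\<bar> \<le> 2" by arith
      then have "(x - y)\<^sup>2 \<le> 2\<^sup>2" using abs_le_square_iff[of "x - y" 2] by simp
      \<comment> \<open>The square is at most 4, so cutting it at 1 loses at most a factor 4; the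
        constant 5 absorbs this.\<close>
      then have "(x - y)\<^sup>2 \<le> 5 * ?q" by (auto simp: min_def)
      also have "\<dots> \<le> 5 / d\<^sup>2 * ?q" using c5 q0 by (intro mult_right_mono)
      finally show ?thesis using 1 R0 by (simp add: tr_def)
    next
      case 3
      then have "(tr x - tr y)\<^sup>2 \<le> 1" by (auto simp: tr_def abs_square_le_1)
      then show ?thesis using mixed[OF 3] by simp
    qed (use R0 in \<open>simp add: tr_def\<close>)
  qed
  show "min \<bar>(x - tr x) - (y - tr y)\<bar> 1 \<le> R"
  proof -
    consider "\<bar>x\<bar> \<le> 1" "\<bar>y\<bar> \<le> 1" | "\<bar>x\<bar> > 1" "\<bar>y\<bar> > 1" | "\<bar>x\<bar> \<le> 1 \<and> 1 < \<bar>y\<bar> \<or> \<bar>y\<bar> \<le> 1 \<and> 1 < \<bar>x\<bar>" by arith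
    then show ?thesis
    proof cases
      case 1 then show ?thesis using R0 by (simp add: tr_def)
    next
      case 2
      show ?thesis
      proof (cases "d \<le> \<bar>x - y\<bar>")
        case True
        then show ?thesis using qd R0 by (auto simp: min_def)
      next
        case False
        \<comment> \<open>Neither value is truncated to a nonzero number, so their difference enters
          linearly; it is below \<open>d\<close> and is charged to the last term of
          \<open>R\<close>.\<close>
        then have "\<bar>x - y\<bar> \<le> d * of_bool (1 < \<bar>y\<bar>)" using 2 by simp
        also have "\<dots> \<le> R" using q0 d2 unfolding R_def by simp
        finally show ?thesis using 2 by (simp add: tr_def)
      qed
    next
      case 3
      then show ?thesis using mixed by simp
    qed
  qed
qed

section \<open>Small and large jumps in the difference of two series\<close>

context
  fixes hs :: "nat \<Rightarrow> real \<times> 'b \<Rightarrow> real" and h :: "real \<times> 'b \<Rightarrow> real" and as :: "nat \<Rightarrow> real" and a :: real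
  assumes hs: "\<And>n. admissible (hs n) (as n)" and h: "admissible h a"
    and meas_hs[measurable]: "\<And>n. hs n \<in> borel_measurable (borel \<Otimes>\<^sub>M \<sigma>)"
    and meas_h[measurable]: "integrand h"
    and as: "as \<longlonglongrightarrow> a"
    and diff: "(\<lambda>n. \<integral>\<^sup>+z. ennreal (min ((hs n z - h z)\<^sup>2) 1) \<partial>\<Lambda>) \<longlonglongrightarrow> 0"
    and h_neq: "AE z in \<Lambda>. \<bar>h z\<bar> \<noteq> 1"
begin

text \<open>Dominated convergence along \<open>d j \<le> 1/2\<close>: the limit set, where
  \<bar>h\<bar> equals 1, is null. Where \<bar>h\<bar> is at most 1/2 the integrand vanishes;
  elsewhere it is at most 2 while the squared value cut at 1 is at least 1/4, hence the factor
  8.\<close>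

lemma near_one_small:
  assumes "e > 0"
  shows "\<exists>d. 0 < d \<and> d < 1 \<and> (\<integral>\<^sup>+z. ennreal (of_bool (\<bar>\<bar>h z\<bar> - 1\<bar> < d) + d * of_bool (1 < \<bar>h z\<bar>)) \<partial>\<Lambda>) \<le> ennreal e"
proof -
  define d where "d j = inverse (real (j + 2))" for j
  define F where "F j z = ennreal (of_bool (\<bar>\<bar>h z\<bar> - 1\<bar> < d j) + d j * of_bool (1 < \<bar>h z\<bar>))" for j z
  have [measurable]: "integrand (F j)" for j
    unfolding F_def by measurable
  have d: "0 < d j" "d j \<le> 1/2" for j by (auto simp: d_def field_simps)
  have dlim: "d \<longlonglongrightarrow> 0"
    unfolding d_def using LIMSEQ_ignore_initial_segment[OF LIMSEQ_inverse_real_of_nat, of 1] by (simp add: add.commute)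
  have "(\<lambda>j. \<integral>\<^sup>+z. F j z \<partial>\<Lambda>) \<longlonglongrightarrow> (\<integral>\<^sup>+z. 0 \<partial>\<Lambda>)"
  proof (rule nn_integral_dominated_convergence[where u=F and u'="\<lambda>_. 0" and w="\<lambda>z. 8 * ennreal (min ((h z)\<^sup>2) 1)"])
    show "AE z in \<Lambda>. F j z \<le> 8 * ennreal (min ((h z)\<^sup>2) 1)" for j
    proof (rule AE_I2)
      fix z
      have "of_bool (\<bar>\<bar>h z\<bar> - 1\<bar> < d j) + d j * of_bool (1 < \<bar>h z\<bar>) \<le> 8 * min ((h z)\<^sup>2) 1"
      proof (cases "\<bar>h z\<bar> \<le> 1/2")
        case True
        then show ?thesis using d[of j] by (auto simp: of_bool_def)
      next
        case False
        then have "(1/2)\<^sup>2 \<le> (h z)\<^sup>2" by (intro iffD1[OF abs_le_square_iff]) simp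
        then have "2 \<le> 8 * min ((h z)\<^sup>2) 1" by (simp add: power2_eq_square min_def)
        then show ?thesis using d[of j] by (auto simp: of_bool_def)
      qed
      then show "F j z \<le> 8 * ennreal (min ((h z)\<^sup>2) 1)"
        unfolding F_def by (subst ennreal_numeral[symmetric], subst ennreal_mult[symmetric]) (auto intro!: ennreal_leI)
    qed
    show "(\<integral>\<^sup>+z. 8 * ennreal (min ((h z)\<^sup>2) 1) \<partial>\<Lambda>) < \<infinity>"
      using h by (subst nn_integral_cmult) (auto simp: admissible_def ennreal_mult_less_top)
    show "AE z in \<Lambda>. (\<lambda>j. F j z) \<longlonglongrightarrow> 0"
      using h_neq
    proof eventually_elim
      case (elim z)
      have "\<forall>\<^sub>F j in sequentially. d j < \<bar>\<bar>h z\<bar> - 1\<bar>"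
        using elim by (intro order_tendstoD(2)[OF dlim]) auto
      then have "\<forall>\<^sub>F j in sequentially. F j z = ennreal (d j * of_bool (1 < \<bar>h z\<bar>))"
        by eventually_elim (auto simp: F_def)
      moreover have "(\<lambda>j. ennreal (d j * of_bool (1 < \<bar>h z\<bar>))) \<longlonglongrightarrow> ennreal (0 * of_bool (1 < \<bar>h z\<bar>))"
        by (intro tendsto_intros dlim)
      ultimately show ?case by (subst tendsto_cong) auto
    qed
  qed (simp_all add: F_def)
  then have "(\<lambda>j. \<integral>\<^sup>+z. F j z \<partial>\<Lambda>) \<longlonglongrightarrow> 0" by simp
  from tendsto_0_ennrealD[OF this assms] obtain j where "(\<integral>\<^sup>+z. F j z \<partial>\<Lambda>) \<le> ennreal e"
    by (auto simp: eventually_sequentially)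
  then show ?thesis unfolding F_def using d[of j] by (intro exI[of _ "d j"]) auto
qed

text \<open>First \<open>d\<close> is fixed so that the terms free of \<open>n\<close> are small;
  then the constant \<open>5 / d\<^sup>2\<close> is fixed, and the remaining term tends to 0 by
  assumption.\<close>

lemma truncation_error_tendsto:
  assumes [measurable]: "\<And>n. g n \<in> borel_measurable (borel \<Otimes>\<^sub>M \<sigma>)"
    and le: "\<And>d n z. 0 < d \<Longrightarrow> d < 1 \<Longrightarrow> g n z \<le> 5 / d\<^sup>2 * min ((hs n z - h z)\<^sup>2) 1 +
      of_bool (\<bar>\<bar>h z\<bar> - 1\<bar> < d) + d * of_bool (1 < \<bar>h z\<bar>)"
  shows "(\<lambda>n. \<integral>\<^sup>+z. indicator {0..} (fst z) * ennreal (g n z) \<partial>\<Lambda>) \<longlonglongrightarrow> 0"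
proof (rule tendsto_0_ennrealI)
  fix e :: real assume e: "e > 0"
  obtain d where d: "0 < d" "d < 1"
    "(\<integral>\<^sup>+z. ennreal (of_bool (\<bar>\<bar>h z\<bar> - 1\<bar> < d) + d * of_bool (1 < \<bar>h z\<bar>)) \<partial>\<Lambda>) \<le> ennreal (e/2)"
    using near_one_small[of "e/2"] e by auto
  have "(\<lambda>n. ennreal (5 / d\<^sup>2) * (\<integral>\<^sup>+z. ennreal (min ((hs n z - h z)\<^sup>2) 1) \<partial>\<Lambda>)) \<longlonglongrightarrow> ennreal (5 / d\<^sup>2) * 0"
    by (intro ennreal_tendsto_cmult diff) simp
  then have "\<forall>\<^sub>F n in sequentially. ennreal (5 / d\<^sup>2) * (\<integral>\<^sup>+z. ennreal (min ((hs n z - h z)\<^sup>2) 1) \<partial>\<Lambda>) \<le> ennreal (e/2)"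
    using e by (intro tendsto_0_ennrealD) auto
  then show "\<forall>\<^sub>F n in sequentially. (\<integral>\<^sup>+z. indicator {0..} (fst z) * ennreal (g n z) \<partial>\<Lambda>) \<le> ennreal e"
  proof eventually_elim
    case (elim n)
    have "(\<integral>\<^sup>+z. indicator {0..} (fst z) * ennreal (g n z) \<partial>\<Lambda>) \<le>
      (\<integral>\<^sup>+z. ennreal (5 / d\<^sup>2) * ennreal (min ((hs n z - h z)\<^sup>2) 1) +
        ennreal (of_bool (\<bar>\<bar>h z\<bar> - 1\<bar> < d) + d * of_bool (1 < \<bar>h z\<bar>)) \<partial>\<Lambda>)"
    proof (rule nn_integral_mono)
      fix z
      have "indicator {0..} (fst z) * ennreal (g n z) \<le> ennreal (g n z)" by (simp add: indicator_def)
      also have "\<dots> \<le> ennreal (5 / d\<^sup>2 * min ((hs n z - h z)\<^sup>2) 1 + (of_bool (\<bar>\<bar>h z\<bar> - 1\<bar> < d) + d * of_bool (1 < \<bar>h z\<bar>)))"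
        using le[OF d(1,2), of n z] by (intro ennreal_leI) (simp add: add.assoc)
      also have "\<dots> = ennreal (5 / d\<^sup>2 * min ((hs n z - h z)\<^sup>2) 1) + ennreal (of_bool (\<bar>\<bar>h z\<bar> - 1\<bar> < d) + d * of_bool (1 < \<bar>h z\<bar>))"
        by (rule ennreal_plus) (use d in auto)
      also have "ennreal (5 / d\<^sup>2 * min ((hs n z - h z)\<^sup>2) 1) = ennreal (5 / d\<^sup>2) * ennreal (min ((hs n z - h z)\<^sup>2) 1)"
        by (rule ennreal_mult) auto
      finally show "indicator {0..} (fst z) * ennreal (g n z) \<le> ennreal (5 / d\<^sup>2) * ennreal (min ((hs n z - h z)\<^sup>2) 1) +
        ennreal (of_bool (\<bar>\<bar>h z\<bar> - 1\<bar> < d) + d * of_bool (1 < \<bar>h z\<bar>))" .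
    qed
    also have "\<dots> = ennreal (5 / d\<^sup>2) * (\<integral>\<^sup>+z. ennreal (min ((hs n z - h z)\<^sup>2) 1) \<partial>\<Lambda>) +
       (\<integral>\<^sup>+z. ennreal (of_bool (\<bar>\<bar>h z\<bar> - 1\<bar> < d) + d * of_bool (1 < \<bar>h z\<bar>)) \<partial>\<Lambda>)"
      by (subst nn_integral_add) (simp_all add: nn_integral_cmult)
    also have "\<dots> \<le> ennreal (e/2) + ennreal (e/2)" using elim d(3) by (rule add_mono)
    also have "\<dots> = ennreal e" using e by (simp flip: ennreal_plus)
    finally show ?case .
  qed
qed

lemma drift_diff:
  assumes [measurable]: "integrand f" "integrand g"
    and "\<And>z. \<bar>f z\<bar> \<le> c" "\<And>z. \<bar>g z\<bar> \<le> c"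
  shows "drift (\<lambda>z. f z - g z) u t = drift f u t - drift g u t"
proof -
  have "integrable \<Lambda> (\<lambda>z. indicator {u<..t} (fst z) * f z)" "integrable \<Lambda> (\<lambda>z. indicator {u<..t} (fst z) * g z)"
    using assms by (auto intro!: integrable_interval[of _ c])
  then show ?thesis
    unfolding drift_def by (simp add: right_diff_distrib)
qed

text \<open>\<open>\<theta>\<close> compares the truncated parts and \<open>\<eta>\<close> the large
  parts; they go to \<open>bounded_series\<close> and \<open>truncated_series\<close>
  respectively.\<close>

abbreviation (input) "\<theta> n z \<equiv> truncate (hs n) z - truncate h z"
abbreviation (input) "\<eta> n z \<equiv> (hs n z - truncate (hs n) z) - (h z - truncate h z)"

lemma AE_series_diff:
  "AE \<omega> in S. summable (\<lambda>i. \<theta> n (point \<omega> i)) \<and> summable (\<lambda>i. \<eta> n (point \<omega> i)) \<and>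
     (\<Sum>i. hs n (point \<omega> i)) - (\<Sum>i. h (point \<omega> i)) = (\<Sum>i. \<theta> n (point \<omega> i)) + (\<Sum>i. \<eta> n (point \<omega> i))"
  using admissible_series[OF hs[of n]] admissible_series[OF h]
proof eventually_elim
  case (elim \<omega>)
  note s = elim[THEN conjunct1] elim[THEN conjunct2]
  have 1: "(\<Sum>i. hs n (point \<omega> i)) = (\<Sum>i. truncate (hs n) (point \<omega> i)) + (\<Sum>i. hs n (point \<omega> i) - truncate (hs n) (point \<omega> i))"
    using suminf_add[OF s(1) s(3)] by simp
  have 2: "(\<Sum>i. h (point \<omega> i)) = (\<Sum>i. truncate h (point \<omega> i)) + (\<Sum>i. h (point \<omega> i) - truncate h (point \<omega> i))"
    using suminf_add[OF s(2) s(4)] by simp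
  show ?case
    unfolding 1 2 using summable_diff[OF s(1,2)] summable_diff[OF s(3,4)] suminf_diff[OF s(1,2)] suminf_diff[OF s(3,4)]
    by simp
qed

text \<open>The difference consists of the centred small-jump series, the difference
  \<open>as n - a\<close> of the centrings, and the large-jump series. Each may use a third of
  \<open>e\<close>.\<close>

lemma series_converges_in_probability:
  assumes e: "e > 0"
  shows "(\<lambda>n. emeasure S {\<omega>\<in>space S. e \<le> \<bar>(\<Sum>i. hs n (point \<omega> i)) - (\<Sum>i. h (point \<omega> i))\<bar>}) \<longlonglongrightarrow> 0"
proof -
  let ?t = "\<lambda>n. \<integral>\<^sup>+z. indicator {0..} (fst z) * ennreal ((\<theta> n z)\<^sup>2) \<partial>\<Lambda>"
  let ?r = "\<lambda>n. \<integral>\<^sup>+z. indicator {0..} (fst z) * ennreal (min \<bar>\<eta> n z\<bar> 1) \<partial>\<Lambda>"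
  have t0: "?t \<longlonglongrightarrow> 0"
    by (rule truncation_error_tendsto) (measurable, unfold truncate_def, rule truncation_error_bound(1))
  have r0: "?r \<longlonglongrightarrow> 0"
    by (rule truncation_error_tendsto) (measurable, unfold truncate_def, rule truncation_error_bound(2))
  have tb: "\<bar>truncate k z\<bar> \<le> 1" for k :: "real \<times> 'b \<Rightarrow> real" and z by (simp add: truncate_def)
  have thb: "\<bar>\<theta> n z\<bar> \<le> 2" for n z using tb[of "hs n" z] tb[of h z] by linarith
  define e3 where "e3 = e / 3"
  have e3: "e3 > 0" using e by (simp add: e3_def)
  let ?A = "\<lambda>n. {\<omega>\<in>space S. e3 \<le> \<bar>(\<Sum>i. \<theta> n (point \<omega> i)) - (as n - a)\<bar>}"
  let ?B = "\<lambda>n. {\<omega>\<in>space S. e3 \<le> \<bar>\<Sum>i. \<eta> n (point \<omega> i)\<bar>}"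
  let ?C = "\<lambda>n. {\<omega>\<in>space S. e \<le> \<bar>(\<Sum>i. hs n (point \<omega> i)) - (\<Sum>i. h (point \<omega> i))\<bar>}"
  show ?thesis
  proof (rule tendsto_0_ennrealI)
    fix e' :: real assume e': "e' > 0"
    have "\<forall>\<^sub>F n in sequentially. \<bar>as n - a\<bar> < e3"
      using tendstoD[OF as e3] by (simp add: dist_real_def)
    \<comment> \<open>This threshold and the next are chosen so that the constants of the two
      probability bounds cancel and leave \<open>e'/2\<close>.\<close>
    moreover have "\<forall>\<^sub>F n in sequentially. ?t n \<le> ennreal (e3\<^sup>2 * (e'/2) / (40 * \<alpha>))"
      using e3 e' \<alpha>_pos by (intro tendsto_0_ennrealD t0) simp
    moreover have "\<forall>\<^sub>F n in sequentially. ?r n \<le> ennreal (min e3 1 * (e'/2) / \<alpha>)"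
      using e3 e' \<alpha>_pos by (intro tendsto_0_ennrealD r0) simp
    ultimately show "\<forall>\<^sub>F n in sequentially. emeasure S (?C n) \<le> ennreal e'"
    proof eventually_elim
      case (elim n)
      have ft: "?t n < \<infinity>" and fr: "?r n < \<infinity>" using elim by (auto intro: le_less_trans)
      have D: "(drift (\<theta> n) 0 \<longlongrightarrow> as n - a) at_top"
        using hs[of n] h unfolding drift_diff[OF measurable_truncate[OF meas_hs] measurable_truncate[OF meas_h] tb tb]
        by (auto simp: admissible_def intro: tendsto_diff)
      have A: "emeasure S (?A n) \<le> ennreal (e'/2)"
      proof -
        have "ennreal (e3\<^sup>2) * emeasure S (?A n) \<le> ennreal (40 * \<alpha>) * ?t n"
          by (rule bounded_series(2)[OF _ thb ft D e3]) measurable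
        also have "\<dots> \<le> ennreal (40 * \<alpha>) * ennreal (e3\<^sup>2 * (e'/2) / (40 * \<alpha>))"
          using elim by (intro mult_left_mono) auto
        also have "\<dots> = ennreal (e3\<^sup>2) * ennreal (e'/2)"
          using \<alpha>_pos e' e3 by (subst ennreal_mult[symmetric], simp, simp, subst ennreal_mult[symmetric], simp, simp) (simp add: field_simps)
        finally show ?thesis by (rule ennreal_mult_left_cancel_le[rotated]) (use e3 in simp)
      qed
      have B: "emeasure S (?B n) \<le> ennreal (e'/2)"
      proof -
        have "ennreal (min e3 1) * emeasure S (?B n) \<le> ennreal \<alpha> * ?r n"
          by (rule truncated_series(2)[OF _ fr e3]) measurable
        also have "\<dots> \<le> ennreal \<alpha> * ennreal (min e3 1 * (e'/2) / \<alpha>)"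
          using elim by (intro mult_left_mono) auto
        also have "\<dots> = ennreal (min e3 1) * ennreal (e'/2)"
          using \<alpha>_pos e' e3 by (subst ennreal_mult[symmetric], simp, simp, subst ennreal_mult[symmetric], simp, simp) (simp add: field_simps)
        finally show ?thesis by (rule ennreal_mult_left_cancel_le[rotated]) (use e3 in simp)
      qed
      have "emeasure S (?C n) \<le> emeasure S (?A n \<union> ?B n)"
      proof (rule emeasure_mono_AE)
        show "AE \<omega> in S. \<omega> \<in> ?C n \<longrightarrow> \<omega> \<in> ?A n \<union> ?B n"
          using AE_series_diff[of n]
        proof eventually_elim
          case (elim \<omega>)
          have "e3 \<le> \<bar>x - d\<bar> \<or> e3 \<le> \<bar>y\<bar>" if "e \<le> \<bar>x + y\<bar>" "\<bar>d\<bar> < e3" for x y d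
            using that unfolding e3_def by linarith
          then show ?case using elim \<open>\<bar>as n - a\<bar> < e3\<close> by auto
        qed
      qed measurable
      also have "\<dots> \<le> emeasure S (?A n) + emeasure S (?B n)"
        by (rule emeasure_subadditive) measurable
      also have "\<dots> \<le> ennreal (e'/2) + ennreal (e'/2)" by (rule add_mono[OF A B])
      also have "\<dots> = ennreal e'" using e' by (simp flip: ennreal_plus)
      finally show ?case .
    qed
  qed
qed

text \<open>Markov's inequality; the mean at one point is at most the mean of the sum over all
  points, which \<open>campbell\<close> evaluates.\<close>

lemma point_converges_in_probability:
  assumes e: "e > 0"
  shows "(\<lambda>n. emeasure S {\<omega>\<in>space S. e \<le> \<bar>hs n (point \<omega> i) - h (point \<omega> i)\<bar>}) \<longlonglongrightarrow> 0"
proof (rule tendsto_0_ennrealI)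
  fix e' :: real assume e': "e' > 0"
  let ?q = "\<lambda>n. \<integral>\<^sup>+z. ennreal (min ((hs n z - h z)\<^sup>2) 1) \<partial>\<Lambda>"
  let ?m = "min (e\<^sup>2) 1"
  have m0: "?m > 0" using e by simp
  have "\<forall>\<^sub>F n in sequentially. ?q n \<le> ennreal (?m * e' / \<alpha>)"
    using m0 e' \<alpha>_pos by (intro tendsto_0_ennrealD diff) simp
  then show "\<forall>\<^sub>F n in sequentially. emeasure S {\<omega>\<in>space S. e \<le> \<bar>hs n (point \<omega> i) - h (point \<omega> i)\<bar>} \<le> ennreal e'"
  proof eventually_elim
    case (elim n)
    let ?E = "{\<omega>\<in>space S. e \<le> \<bar>hs n (point \<omega> i) - h (point \<omega> i)\<bar>}"
    let ?f = "\<lambda>z. ennreal (min ((hs n z - h z)\<^sup>2) 1)"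
    have "ennreal ?m * emeasure S ?E = (\<integral>\<^sup>+\<omega>. ennreal ?m * indicator ?E \<omega> \<partial>S)"
      by (subst nn_integral_cmult_indicator) auto
    also have "\<dots> \<le> (\<integral>\<^sup>+\<omega>. ?f (point \<omega> i) \<partial>S)"
    proof (rule nn_integral_mono)
      fix \<omega>
      have "?m \<le> min ((hs n (point \<omega> i) - h (point \<omega> i))\<^sup>2) 1" if "e \<le> \<bar>hs n (point \<omega> i) - h (point \<omega> i)\<bar>"
        using that e abs_le_square_iff[of e "hs n (point \<omega> i) - h (point \<omega> i)"] by auto
      then show "ennreal ?m * indicator ?E \<omega> \<le> ?f (point \<omega> i)"
        by (cases "\<omega> \<in> ?E") (simp_all add: ennreal_leI del: min_le_iff_disj min.bounded_iff)
    qed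
    also have "\<dots> \<le> (\<Sum>i. \<integral>\<^sup>+\<omega>. ?f (point \<omega> i) \<partial>S)"
      using sum_le_suminf[of "\<lambda>i. \<integral>\<^sup>+\<omega>. ?f (point \<omega> i) \<partial>S" "{i}"] by simp
    also have "\<dots> = ennreal \<alpha> * (\<integral>\<^sup>+z. indicator {0..} (fst z) * ?f z \<partial>\<Lambda>)"
      by (rule campbell) measurable
    also have "\<dots> \<le> ennreal \<alpha> * ?q n"
      by (intro mult_left_mono nn_integral_mono) (auto simp: indicator_def)
    also have "\<dots> \<le> ennreal \<alpha> * ennreal (?m * e' / \<alpha>)"
      using elim by (intro mult_left_mono) auto
    also have "\<dots> = ennreal ?m * ennreal e'"
      using \<alpha>_pos e' m0 by (subst ennreal_mult[symmetric], simp, simp, subst ennreal_mult[symmetric], simp, simp) (simp add: field_simps)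
    finally show ?case by (rule ennreal_mult_left_cancel_le[OF m0])
  qed
qed

text \<open>Points are removed one at a time, each removal spending half of the current
  \<open>e\<close>.\<close>

lemma tail_converges_in_probability:
  assumes e: "e > 0"
  shows "(\<lambda>n. emeasure S {\<omega>\<in>space S. e \<le> \<bar>(\<Sum>i. hs n (point \<omega> (p + i))) - (\<Sum>i. h (point \<omega> (p + i)))\<bar>}) \<longlonglongrightarrow> 0"
  using e
proof (induction p arbitrary: e)
  case 0
  then show ?case using series_converges_in_probability by simp
next
  case (Suc p)
  let ?A = "\<lambda>n. {\<omega>\<in>space S. e / 2 \<le> \<bar>(\<Sum>i. hs n (point \<omega> (p + i))) - (\<Sum>i. h (point \<omega> (p + i)))\<bar>}"
  let ?B = "\<lambda>n. {\<omega>\<in>space S. e / 2 \<le> \<bar>hs n (point \<omega> p) - h (point \<omega> p)\<bar>}"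
  let ?C = "\<lambda>n. {\<omega>\<in>space S. e \<le> \<bar>(\<Sum>i. hs n (point \<omega> (Suc p + i))) - (\<Sum>i. h (point \<omega> (Suc p + i)))\<bar>}"
  have "(\<lambda>n. emeasure S (?A n) + emeasure S (?B n)) \<longlonglongrightarrow> 0 + 0"
    using Suc.prems by (intro tendsto_add Suc.IH point_converges_in_probability) auto
  then have lim: "(\<lambda>n. emeasure S (?A n) + emeasure S (?B n)) \<longlonglongrightarrow> 0" by simp
  have le: "emeasure S (?C n) \<le> emeasure S (?A n) + emeasure S (?B n)" for n
  proof -
    have "emeasure S (?C n) \<le> emeasure S (?A n \<union> ?B n)"
    proof (rule emeasure_mono_AE)
      show "AE \<omega> in S. \<omega> \<in> ?C n \<longrightarrow> \<omega> \<in> ?A n \<union> ?B n"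
        using admissible_summable[OF hs[of n]] admissible_summable[OF h]
      proof eventually_elim
        case (elim \<omega>)
        have split: "(\<Sum>i. k (point \<omega> (p + i))) = k (point \<omega> p) + (\<Sum>i. k (point \<omega> (Suc p + i)))"
          if "summable (\<lambda>i. k (point \<omega> i))" for k :: "real \<times> 'b \<Rightarrow> real"
          using suminf_split_head[OF summable_ignore_initial_segment[OF that, of p]] by (simp add: add.commute)
        have "e / 2 \<le> \<bar>(x + u) - (y + v)\<bar> \<or> e / 2 \<le> \<bar>x - y\<bar>" if "e \<le> \<bar>u - v\<bar>" for x y u v :: real
          using that by linarith
        from this[of "\<Sum>i. hs n (point \<omega> (Suc p + i))" "\<Sum>i. h (point \<omega> (Suc p + i))"
            "hs n (point \<omega> p)" "h (point \<omega> p)"]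
        show ?case
          by (simp only: mem_Collect_eq Un_iff split[of "hs n", OF elim(1)] split[of h, OF elim(2)]) blast
      qed
    qed measurable
    also have "\<dots> \<le> emeasure S (?A n) + emeasure S (?B n)"
      by (rule emeasure_subadditive) measurable
    finally show ?thesis .
  qed
  show ?case
    by (rule tendsto_sandwich[OF always_eventually always_eventually tendsto_const lim])
      (simp, rule allI, rule le)
qed

end
end

section \<open>Convergence of the laws\<close>

context mark_space
begin

lemma conv_integral_add:
  assumes [measurable]: "integrand k" "J \<in> sets borel"
    "G \<in> borel_measurable borel" "G' \<in> borel_measurable borel"
  shows "W k m J (\<lambda>s. G s + G' s) r = W k m J G r + W k m J G' r"
proof (induction m arbitrary: r)
  case (Suc m)
  have [measurable]: "(\<lambda>z. W k m J g (r + k z)) \<in> borel_measurable \<Lambda>"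
    if [measurable]: "g \<in> borel_measurable borel" for g
    by (rule measurable_conv_integral') auto
  show ?case
    unfolding conv_integral.simps Suc distrib_left
    by (rule nn_integral_add; measurable)
qed simp

text \<open>A larger window cannot decrease the value for the complement of \<open>B\<close>, and
  the values for \<open>B\<close> and its complement add up to a power of the horizon. So the value
  for \<open>B\<close> grows by no more than the total mass does.\<close>

lemma conv_integral_indicator_le:
  assumes [measurable]: "integrand k" "B \<in> sets borel"
    and t: "0 \<le> t" "t \<le> t'"
  shows "W k m {0..t'} (indicator B) r \<le> W k m {0..t} (indicator B) r + ennreal (t' ^ m - t ^ m)"
proof -
  have tot: "W k m {0..s} (indicator B) r + W k m {0..s} (indicator (- B)) r = ennreal (s ^ m)" if "0 \<le> s" for s
  proof -
    have "W k m {0..s} (indicator B) r + W k m {0..s} (indicator (- B)) r = W k m {0..s} (\<lambda>s. indicator B s + indicator (- B) s) r"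
      by (rule conv_integral_add[symmetric]) measurable
    also have "(\<lambda>s. indicator B s + indicator (- B) s :: ennreal) = (\<lambda>_. 1)"
      by (auto simp: indicator_def)
    finally show ?thesis using that by (simp add: conv_integral_const ennreal_power)
  qed
  let ?a = "W k m {0..t} (indicator B) r" and ?b = "W k m {0..t} (indicator (- B)) r"
  let ?a' = "W k m {0..t'} (indicator B) r" and ?b' = "W k m {0..t'} (indicator (- B)) r"
  have "?b \<le> ?b'" using t by (intro conv_integral_mono) auto
  then have "?a' + ?b \<le> ?a' + ?b'" by (rule add_left_mono)
  also have "\<dots> = ennreal (t ^ m + (t' ^ m - t ^ m))" using tot[of t'] t by simp
  also have "\<dots> = ennreal (t ^ m) + ennreal (t' ^ m - t ^ m)"
    using t by (intro ennreal_plus) (auto intro: power_mono)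
  also have "\<dots> = ?b + (?a + ennreal (t' ^ m - t ^ m))"
    using tot[OF t(1)] by (simp add: ac_simps)
  finally have "?b + ?a' \<le> ?b + (?a + ennreal (t' ^ m - t ^ m))" by (simp add: add.commute)
  moreover have "?b \<noteq> \<infinity>"
    using tot[OF t(1)] by (metis ennreal_add_eq_top ennreal_neq_top infinity_ennreal_def)
  ultimately show ?thesis unfolding ennreal_add_left_cancel_le by simp
qed

text \<open>Monotonicity in the time horizon turns the pointwise estimate at finitely many horizons into
  one that is uniform over compact sets of horizons.\<close>

lemma conv_integral_uniform:
  fixes ks :: "nat \<Rightarrow> real \<times> 'b \<Rightarrow> real"
  assumes ks: "\<And>n. ks n \<in> borel_measurable (borel \<Otimes>\<^sub>M \<sigma>)" and k: "integrand k"
    and tv: "\<And>t e. t > 0 \<Longrightarrow> e > 0 \<Longrightarrow> \<forall>\<^sub>F n in sequentially. \<forall>B\<in>sets borel.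
       W (ks n) m {0..t} (indicator B) 0 \<le> W k m {0..t} (indicator B) 0 + ennreal e"
    and tr: "\<And>t e. t > 0 \<Longrightarrow> e > 0 \<Longrightarrow> \<exists>d>0. \<forall>r B. \<bar>r\<bar> < d \<longrightarrow> B \<in> sets borel \<longrightarrow>
       W k m {0..t} (indicator {x. x + r \<in> B}) 0 \<le> W k m {0..t} (indicator B) 0 + ennreal e"
    and e: "e > 0" and L: "L > 0"
  shows "\<exists>d>0. \<forall>\<^sub>F n in sequentially. \<forall>t r r' A. 0 \<le> t \<longrightarrow> t \<le> L \<longrightarrow> \<bar>r - r'\<bar> < d \<longrightarrow> A \<in> sets borel \<longrightarrow>
    W (ks n) m {0..t} (\<lambda>s. indicator A (s + r)) 0 \<le> W k m {0..t} (\<lambda>s. indicator A (s + r')) 0 + ennreal e"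
proof -
  define e3 where "e3 = e / 3"
  have e3: "e3 > 0" using e by (simp add: e3_def)
  have "uniformly_continuous_on {0..L + 1} (\<lambda>x::real. x ^ m)"
    by (intro compact_uniformly_continuous continuous_intros) auto
  then obtain \<delta> where \<delta>: "\<delta> > 0" "\<And>x y. x \<in> {0..L+1} \<Longrightarrow> y \<in> {0..L+1} \<Longrightarrow> dist y x < \<delta> \<Longrightarrow> dist (y ^ m) (x ^ m) < e3"
    unfolding uniformly_continuous_on_def using e3 by metis
  \<comment> \<open>A mesh below \<open>\<delta>\<close> and at most 1, so that rounding a horizon
    up to the grid stays within \<open>{0..L + 1}\<close>.\<close>
  define s where "s = min \<delta> 1 / 2"
  have s: "0 < s" "s < \<delta>" "s \<le> 1" using \<delta>(1) by (auto simp: s_def min_def)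
  \<comment> \<open>The grid starts at index 1 because the assumptions are available for positive
    horizons.\<close>
  define J where "J = {1..nat \<lfloor>L / s\<rfloor> + 1}"
  have fJ: "finite J" and J0: "\<And>j. j \<in> J \<Longrightarrow> real j * s > 0" using s by (auto simp: J_def)
  have grid: "\<exists>j\<in>J. t \<le> real j * s \<and> (real j * s) ^ m - t ^ m \<le> e3" if t: "0 \<le> t" "t \<le> L" for t
  proof -
    define j where "j = nat \<lfloor>t / s\<rfloor> + 1"
    have "\<lfloor>t / s\<rfloor> \<le> \<lfloor>L / s\<rfloor>" using t s by (intro floor_mono divide_right_mono) auto
    then have jJ: "j \<in> J" unfolding j_def J_def by (auto intro: nat_mono)
    have "0 \<le> \<lfloor>t / s\<rfloor>" using t s by simp
    then have "real j = of_int \<lfloor>t / s\<rfloor> + 1" unfolding j_def by (simp add: of_nat_nat)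
    then have "t / s \<le> real j" "real j \<le> t / s + 1" by linarith+
    then have le: "t \<le> real j * s" "real j * s \<le> t + s" using s by (auto simp: field_simps)
    moreover have "dist ((real j * s) ^ m) (t ^ m) < e3"
      using le s t by (intro \<delta>(2)) (auto simp: dist_real_def)
    ultimately show ?thesis using jJ by (intro bexI[of _ j]) (auto simp: dist_real_def)
  qed
  have "\<forall>j\<in>J. \<exists>d>0. \<forall>r B. \<bar>r\<bar> < d \<longrightarrow> B \<in> sets borel \<longrightarrow>
       W k m {0..real j * s} (indicator {x. x + r \<in> B}) 0 \<le> W k m {0..real j * s} (indicator B) 0 + ennreal e3"
    using tr[OF J0 e3] by blast
  then obtain d where d: "\<And>j. j \<in> J \<Longrightarrow> d j > 0"
    "\<And>j r B. j \<in> J \<Longrightarrow> \<bar>r\<bar> < d j \<Longrightarrow> B \<in> sets borel \<Longrightarrow>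
       W k m {0..real j * s} (indicator {x. x + r \<in> B}) 0 \<le> W k m {0..real j * s} (indicator B) 0 + ennreal e3"
    by metis
  define d0 where "d0 = Min (d ` J)"
  have Jne: "J \<noteq> {}" by (auto simp: J_def)
  have d0: "d0 > 0" "\<And>j. j \<in> J \<Longrightarrow> d0 \<le> d j" using fJ Jne d(1) by (auto simp: d0_def)
  have ev: "\<forall>\<^sub>F n in sequentially. \<forall>j\<in>J. \<forall>B\<in>sets borel.
       W (ks n) m {0..real j * s} (indicator B) 0 \<le> W k m {0..real j * s} (indicator B) 0 + ennreal e3"
    using fJ tv[OF J0 e3] by (intro eventually_ball_finite) auto
  show ?thesis
  proof (intro exI[of _ d0] conjI d0(1))
    show "\<forall>\<^sub>F n in sequentially. \<forall>t r r' A. 0 \<le> t \<longrightarrow> t \<le> L \<longrightarrow> \<bar>r - r'\<bar> < d0 \<longrightarrow> A \<in> sets borel \<longrightarrow>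
        W (ks n) m {0..t} (\<lambda>s. indicator A (s + r)) 0 \<le> W k m {0..t} (\<lambda>s. indicator A (s + r')) 0 + ennreal e"
      using ev
    proof eventually_elim
      case (elim n)
      show ?case
      proof (intro allI impI)
        fix t r r' :: real and A :: "real set"
        assume t: "0 \<le> t" "t \<le> L" and r: "\<bar>r - r'\<bar> < d0" and A[measurable]: "A \<in> sets borel"
        obtain j where j: "j \<in> J" "t \<le> real j * s" "(real j * s) ^ m - t ^ m \<le> e3" using grid[OF t] by blast
        define B where "B c = {x. x + c \<in> A}" for c :: real
        have B[measurable]: "B c \<in> sets borel" for c
        proof -
          have "(\<lambda>x. x + c) -` A \<inter> space borel \<in> sets borel" by (rule measurable_sets[OF _ A]) measurable
          then show ?thesis by (simp add: B_def vimage_def)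
        qed
        have ind: "(\<lambda>s. indicator A (s + c) :: ennreal) = indicator (B c)" for c
          by (auto simp: B_def indicator_def)
        have BB: "B r = {x. x + (r - r') \<in> B r'}" by (auto simp: B_def)
        \<comment> \<open>Enlarge the window to the grid horizon, replace \<open>ks n\<close> by
          \<open>k\<close> there, shift by \<open>r - r'\<close>, and shrink the window again. The
          last three moves cost \<open>e3\<close> each; the first is free by monotonicity.\<close>
        have "W (ks n) m {0..t} (indicator (B r)) 0 \<le> W (ks n) m {0..real j * s} (indicator (B r)) 0"
          using j by (intro conv_integral_mono) auto
        also have "\<dots> \<le> W k m {0..real j * s} (indicator (B r)) 0 + ennreal e3"
          using elim j B by blast
        also have "W k m {0..real j * s} (indicator (B r)) 0 \<le> W k m {0..real j * s} (indicator (B r')) 0 + ennreal e3"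
          unfolding BB using d(2)[OF j(1) _ B, of "r - r'" r'] r d0(2)[OF j(1)] by simp
        also have "W k m {0..real j * s} (indicator (B r')) 0 \<le> W k m {0..t} (indicator (B r')) 0 + ennreal ((real j * s) ^ m - t ^ m)"
          by (rule conv_integral_indicator_le[OF k B t(1) j(2)])
        also have "ennreal ((real j * s) ^ m - t ^ m) \<le> ennreal e3"
          using j(3) by (rule ennreal_leI)
        finally have "W (ks n) m {0..t} (indicator (B r)) 0 \<le> W k m {0..t} (indicator (B r')) 0 + ennreal e3 + ennreal e3 + ennreal e3"
          by (simp add: add_mono)
        also have "\<dots> = W k m {0..t} (indicator (B r')) 0 + ennreal e"
          using e by (simp add: add.assoc e3_def flip: ennreal_plus)
        finally show "W (ks n) m {0..t} (\<lambda>s. indicator A (s + r)) 0 \<le> W k m {0..t} (\<lambda>s. indicator A (s + r')) 0 + ennreal e"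
          unfolding ind .
      qed
    qed
  qed
qed

end

lemma nn_integral_indicator_compose:
  assumes "{x\<in>space M. f x \<in> A} \<in> sets M"
  shows "(\<integral>\<^sup>+x. indicator A (f x) \<partial>M) = emeasure M {x\<in>space M. f x \<in> A}"
proof -
  have "(\<integral>\<^sup>+x. indicator A (f x) \<partial>M) = (\<integral>\<^sup>+x. indicator {x\<in>space M. f x \<in> A} x \<partial>M)"
    by (intro nn_integral_cong) (simp add: indicator_def)
  then show ?thesis using nn_integral_indicator[OF assms] by simp
qed

section \<open>Splitting the series at the arrival that follows the first \<open>p\<close>
  points\<close>

context marked_poisson
begin

text \<open>The contribution of all points from time \<open>t\<close> on. The first of them sits at
  \<open>t\<close> itself; the others are given by a fresh sequence started at
  \<open>t\<close>.\<close>

definition rest :: "(real \<times> 'b \<Rightarrow> real) \<Rightarrow> real \<Rightarrow> 'b \<times> (nat \<Rightarrow> real \<times> 'b) \<Rightarrow> real" where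
  "rest k t y = k (t, fst y) + (\<Sum>i. k (t + arrival (snd y) (Suc i), snd (snd y i)))"

lemma measurable_rest[measurable]:
  assumes [measurable]: "integrand k" "f \<in> borel_measurable M" "g \<in> M \<rightarrow>\<^sub>M \<sigma> \<Otimes>\<^sub>M S"
  shows "(\<lambda>x. rest k (f x) (g x)) \<in> borel_measurable M"
proof -
  have s: "(\<lambda>x. snd (g x)) \<in> M \<rightarrow>\<^sub>M S" by measurable
  have [measurable]: "(\<lambda>x. arrival (snd (g x)) n) \<in> borel_measurable M" for n
    by (rule measurable_compose[OF s measurable_arrival])
  have [measurable]: "(\<lambda>x. snd (g x) n) \<in> M \<rightarrow>\<^sub>M borel \<Otimes>\<^sub>M \<sigma>" for n
    by (rule measurable_compose[OF s]) measurable
  show ?thesis unfolding rest_def by measurable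
qed

lemma arrival_add: "arrival \<omega> n + arrival (\<lambda>i. \<omega> (n + i)) m = arrival \<omega> (n + m)"
  by (induction m) (simp_all add: arrival_def)

lemma rest_eq:
  "rest k (arrival \<omega> (Suc p)) (snd (\<omega> p), \<lambda>i. \<omega> (Suc p + i)) = k (point \<omega> p) + (\<Sum>i. k (point \<omega> (Suc p + i)))"
  unfolding rest_def fst_conv snd_conv arrival_add by (simp add: point_def)

text \<open>The mean over the remainder is pulled outside the convolution, so that two integrands
  can be compared for each fixed time \<open>t\<close> and remainder \<open>y\<close>.\<close>

lemma nn_integral_first_points_rest:
  assumes k[measurable]: "integrand k"
    and F[measurable]: "(\<lambda>(t, r, y). F t r y) \<in> borel_measurable (borel \<Otimes>\<^sub>M borel \<Otimes>\<^sub>M (\<sigma> \<Otimes>\<^sub>M S))"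
  shows "(\<integral>\<^sup>+\<omega>. F (arrival \<omega> (Suc p)) (\<Sum>i<p. k (point \<omega> i)) (snd (\<omega> p), \<lambda>i. \<omega> (Suc p + i)) \<partial>S) =
    (\<integral>\<^sup>+t. indicator {0..} t * (gamma_weight p t *
       (\<integral>\<^sup>+y. W k p {0..t} (\<lambda>r. F t r y) 0 \<partial>(\<sigma> \<Otimes>\<^sub>M S))) \<partial>lborel)"
proof -
  interpret SS: pair_prob_space \<sigma> S ..
  have F': "(\<lambda>y. F (a y) (b y) (c y)) \<in> borel_measurable M"
    if "a \<in> borel_measurable M" "b \<in> borel_measurable M" "c \<in> M \<rightarrow>\<^sub>M \<sigma> \<Otimes>\<^sub>M S"
    for a b c and M :: "'c measure"
    using measurable_compose[OF measurable_Pair[OF that(1) measurable_Pair[OF that(2,3)]] F] by simp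
  have "(\<integral>\<^sup>+\<omega>. F (0 + arrival \<omega> (Suc p)) (0 + (\<Sum>i<p. k (0 + arrival \<omega> (Suc i), snd (\<omega> i)))) (snd (\<omega> p), \<lambda>i. \<omega> (Suc p + i)) \<partial>S) =
    (\<integral>\<^sup>+t. indicator {0..} t * (ennreal (\<alpha> ^ Suc p / fact p * exp (- \<alpha> * (t - 0))) *
       W k p {0..t} (\<lambda>r. \<integral>\<^sup>+x. \<integral>\<^sup>+w. F t r (x, w) \<partial>S \<partial>\<sigma>) 0) \<partial>lborel)"
    by (rule nn_integral_first_points[where F="\<lambda>t r x w. F t r (x, w)", OF k])
      (unfold split_beta', rule F'; measurable)
  moreover have "(\<integral>\<^sup>+x. \<integral>\<^sup>+w. F t r (x, w) \<partial>S \<partial>\<sigma>) = (\<integral>\<^sup>+y. F t r y \<partial>(\<sigma> \<Otimes>\<^sub>M S))" for t r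
  proof -
    have "(\<lambda>y. F t r y) \<in> borel_measurable (\<sigma> \<Otimes>\<^sub>M S)" by (rule F'; measurable)
    from seq.P.nn_integral_fst[OF this] show ?thesis .
  qed
  moreover have "W k p {0..t} (\<lambda>r. \<integral>\<^sup>+y. F t r y \<partial>(\<sigma> \<Otimes>\<^sub>M S)) 0 = (\<integral>\<^sup>+y. W k p {0..t} (\<lambda>r. F t r y) 0 \<partial>(\<sigma> \<Otimes>\<^sub>M S))" for t
  proof (rule conv_integral_nn_integral)
    show "sigma_finite_measure (\<sigma> \<Otimes>\<^sub>M S)" by (rule SS.P.sigma_finite_measure_axioms)
    show "(\<lambda>(y, r). F t r y) \<in> borel_measurable ((\<sigma> \<Otimes>\<^sub>M S) \<Otimes>\<^sub>M borel)"
      unfolding split_beta' by (rule F'; measurable)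
  qed measurable
  ultimately show ?thesis by (simp add: point_def)
qed

text \<open>Without the power of \<open>t\<close> the weight is a multiple of the exponential
  density. The constant is the total effect of an error in the unnormalised convolution that is
  uniform in \<open>t\<close>.\<close>

lemma nn_integral_gamma_weight: "(\<integral>\<^sup>+t. indicator {0..} t * (gamma_weight p t * e) \<partial>lborel) = ennreal (\<alpha> ^ p / fact p) * e"
proof -
  have "(\<integral>\<^sup>+t. indicator {0..} t * (gamma_weight p t * e) \<partial>lborel) =
     (\<integral>\<^sup>+t. ennreal (\<alpha> ^ p / fact p) * e * (ennreal (exponential_density \<alpha> t) * 1) \<partial>lborel)"
  proof (rule nn_integral_cong)
    fix t :: real
    have "gamma_weight p t = ennreal (\<alpha> ^ p / fact p) * ennreal (exponential_density \<alpha> t)" if "0 \<le> t"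
      using \<alpha>_pos that by (subst ennreal_mult[symmetric]) (auto simp: exponential_density_def mult_ac)
    then show "indicator {0..} t * (gamma_weight p t * e) =
        ennreal (\<alpha> ^ p / fact p) * e * (ennreal (exponential_density \<alpha> t) * 1)"
      by (cases "0 \<le> t") (simp_all add: mult_ac exponential_density_def)
  qed
  also have "\<dots> = ennreal (\<alpha> ^ p / fact p) * e * (\<integral>\<^sup>+t. ennreal (exponential_density \<alpha> t) * 1 \<partial>lborel)"
    by (rule nn_integral_cmult) measurable
  also have "(\<integral>\<^sup>+t. ennreal (exponential_density \<alpha> t) * 1 \<partial>lborel) = 1"
    by (subst nn_integral_Q_fst[symmetric]) (auto simp: Q.emeasure_space_1)
  finally show ?thesis by simp
qed

lemma arrival_tail:
  assumes e: "e > 0"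
  shows "\<exists>L>0. emeasure S {\<omega>\<in>space S. L < arrival \<omega> n} \<le> ennreal e"
proof -
  have "(\<lambda>j. emeasure S {\<omega>\<in>space S. real j < arrival \<omega> n}) \<longlonglongrightarrow> emeasure S (\<Inter>j. {\<omega>\<in>space S. real j < arrival \<omega> n})"
    by (rule Lim_emeasure_decseq) (auto simp: decseq_def)
  moreover have "(\<Inter>j. {\<omega>\<in>space S. real j < arrival \<omega> n}) = {}"
  proof (rule equals0I)
    fix \<omega> assume *: "\<omega> \<in> (\<Inter>j. {\<omega>\<in>space S. real j < arrival \<omega> n})"
    obtain j where "arrival \<omega> n < real j" using reals_Archimedean2 by blast
    moreover have "real j < arrival \<omega> n" using * by blast
    ultimately show False by simp
  qed
  ultimately have "\<forall>\<^sub>F j in sequentially. emeasure S {\<omega>\<in>space S. real j < arrival \<omega> n} \<le> ennreal e"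
    using e by (intro tendsto_0_ennrealD) auto
  then obtain N where "\<And>j. j \<ge> N \<Longrightarrow> emeasure S {\<omega>\<in>space S. real j < arrival \<omega> n} \<le> ennreal e"
    by (auto simp: eventually_sequentially)
  from this[of "Suc N"] show ?thesis by (intro exI[of _ "real (Suc N)"]) auto
qed

text \<open>For a fixed arrival time and fixed remainders less than \<open>d\<close> apart,
  \<open>conv_integral_uniform\<close> compares the two shifted convolutions. Times beyond
  \<open>L\<close> and remainders far apart are paid for by extra indicators in the integrand on the
  side of \<open>h\<close>, so one inequality covers all cases and can be integrated.\<close>

theorem law_converges:
  assumes hs: "\<And>n. admissible (hs n) (as n)" and h: "admissible h a"
    and as: "as \<longlonglongrightarrow> a"
    and diff: "(\<lambda>n. \<integral>\<^sup>+z. ennreal (min ((hs n z - h z)\<^sup>2) 1) \<partial>\<Lambda>) \<longlonglongrightarrow> 0"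
    and h_neq: "AE z in \<Lambda>. \<bar>h z\<bar> \<noteq> 1"
    and tv: "\<And>t e. t > 0 \<Longrightarrow> e > 0 \<Longrightarrow> \<forall>\<^sub>F n in sequentially. \<forall>B\<in>sets borel.
       W (hs n) p {0..t} (indicator B) 0 \<le> W h p {0..t} (indicator B) 0 + ennreal e"
    and tr: "\<And>t e. t > 0 \<Longrightarrow> e > 0 \<Longrightarrow> \<exists>d>0. \<forall>r B. \<bar>r\<bar> < d \<longrightarrow> B \<in> sets borel \<longrightarrow>
       W h p {0..t} (indicator {x. x + r \<in> B}) 0 \<le> W h p {0..t} (indicator B) 0 + ennreal e"
    and e: "e > 0"
  shows "\<forall>\<^sub>F n in sequentially. \<forall>A\<in>sets borel.
    emeasure S {\<omega>\<in>space S. (\<Sum>i. hs n (point \<omega> i)) \<in> A} \<le> emeasure S {\<omega>\<in>space S. (\<Sum>i. h (point \<omega> i)) \<in> A} + ennreal e"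
proof -
  have [measurable]: "\<And>n. hs n \<in> borel_measurable (borel \<Otimes>\<^sub>M \<sigma>)" "integrand h"
    using hs h by (auto simp: admissible_def)
  interpret SS: pair_prob_space \<sigma> S ..
  define c where "c = \<alpha> ^ p / fact p"
  have c: "c > 0" using \<alpha>_pos by (simp add: c_def)
  \<comment> \<open>Integration over the arrival time multiplies the error by \<open>c\<close>; the
    division compensates.\<close>
  define e1 where "e1 = e / 3 / c"
  have e1: "e1 > 0" using e c by (simp add: e1_def)
  obtain L where L: "L > 0" "emeasure S {\<omega>\<in>space S. L < arrival \<omega> (Suc p)} \<le> ennreal (e / 3)"
    using arrival_tail[of "e / 3"] e by auto
  obtain d where d: "d > 0" and evd: "\<forall>\<^sub>F n in sequentially. \<forall>t r r' A. 0 \<le> t \<longrightarrow> t \<le> L \<longrightarrow> \<bar>r - r'\<bar> < d \<longrightarrow> A \<in> sets borel \<longrightarrow>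
    W (hs n) p {0..t} (\<lambda>s. indicator A (s + r)) 0 \<le> W h p {0..t} (\<lambda>s. indicator A (s + r')) 0 + ennreal e1"
    using conv_integral_uniform[of hs h p e1 L] tv tr e1 L(1) by auto
  let ?D = "\<lambda>n. {\<omega>\<in>space S. d \<le> \<bar>(\<Sum>i. hs n (point \<omega> (p + i))) - (\<Sum>i. h (point \<omega> (p + i)))\<bar>}"
  have "\<forall>\<^sub>F n in sequentially. emeasure S (?D n) \<le> ennreal (e / 3)"
    using e d by (intro tendsto_0_ennrealD tail_converges_in_probability[OF hs h _ _ as diff h_neq]) auto
  with evd show ?thesis
  proof eventually_elim
    case (elim n)
    show ?case
    proof
      fix A :: "real set" assume A[measurable]: "A \<in> sets borel"
      define G :: "real \<Rightarrow> real \<Rightarrow> 'b \<times> (nat \<Rightarrow> real \<times> 'b) \<Rightarrow> ennreal" where "G t r y = indicator A (r + rest h t y) +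
        (indicator {L<..} t + indicator {d..} \<bar>rest (hs n) t y - rest h t y\<bar>)" for t r y
      have Gm: "(\<lambda>(t, r, y). G t r y) \<in> borel_measurable (borel \<Otimes>\<^sub>M borel \<Otimes>\<^sub>M (\<sigma> \<Otimes>\<^sub>M S))"
        unfolding G_def split_beta' by measurable
      have key: "W (hs n) p {0..t} (\<lambda>r. indicator A (r + rest (hs n) t y)) 0 \<le> W h p {0..t} (\<lambda>r. G t r y) 0 + ennreal e1"
        if "0 \<le> t" for t y
      proof (cases "t \<le> L \<and> \<bar>rest (hs n) t y - rest h t y\<bar> < d")
        case True
        then have "W (hs n) p {0..t} (\<lambda>r. indicator A (r + rest (hs n) t y)) 0 \<le>
            W h p {0..t} (\<lambda>r. indicator A (r + rest h t y)) 0 + ennreal e1"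
          using elim(1) that A by blast
        also have "W h p {0..t} (\<lambda>r. indicator A (r + rest h t y)) 0 \<le> W h p {0..t} (\<lambda>r. G t r y) 0"
          by (intro conv_integral_mono) (auto simp: G_def)
        finally show ?thesis by (simp add: add_right_mono)
      \<comment> \<open>On the exceptional part the right side is at least the full mass, which is
        the same for \<open>hs n\<close> and \<open>h\<close>.\<close>
      next
        case False
        have "W (hs n) p {0..t} (\<lambda>r. indicator A (r + rest (hs n) t y)) 0 \<le> W (hs n) p {0..t} (\<lambda>_. 1) 0"
          by (intro conv_integral_mono) (auto simp: indicator_def)
        also have "\<dots> = W h p {0..t} (\<lambda>_. 1) 0" by (simp add: conv_integral_const)
        also have "\<dots> \<le> W h p {0..t} (\<lambda>r. G t r y) 0"
        proof (intro conv_integral_mono order_refl)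
          have "1 \<le> indicator {L<..} t + (indicator {d..} \<bar>rest (hs n) t y - rest h t y\<bar> :: ennreal)"
            using False by (auto simp: indicator_def)
          then show "1 \<le> G t s y" for s unfolding G_def by (rule order_trans) simp
        qed
        finally show ?thesis by (rule order_trans) simp
      qed
      have tail: "(\<Sum>i. k (point \<omega> (p + i))) = rest k (arrival \<omega> (Suc p)) (snd (\<omega> p), \<lambda>i. \<omega> (Suc p + i))"
        and series: "(\<Sum>i. k (point \<omega> i)) = (\<Sum>i<p. k (point \<omega> i)) + rest k (arrival \<omega> (Suc p)) (snd (\<omega> p), \<lambda>i. \<omega> (Suc p + i))"
        if "summable (\<lambda>i. k (point \<omega> i))" for k :: "real \<times> 'b \<Rightarrow> real" and \<omega>
      proof -
        show t: "(\<Sum>i. k (point \<omega> (p + i))) = rest k (arrival \<omega> (Suc p)) (snd (\<omega> p), \<lambda>i. \<omega> (Suc p + i))"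
          unfolding rest_eq using suminf_split_head[OF summable_ignore_initial_segment[OF that, of p]]
          by (simp add: add.commute)
        show "(\<Sum>i. k (point \<omega> i)) = (\<Sum>i<p. k (point \<omega> i)) + rest k (arrival \<omega> (Suc p)) (snd (\<omega> p), \<lambda>i. \<omega> (Suc p + i))"
          unfolding t[symmetric] using suminf_split_initial_segment[OF that, of p] by (simp add: add.commute)
      qed
      have "emeasure S {\<omega>\<in>space S. (\<Sum>i. hs n (point \<omega> i)) \<in> A} =
        (\<integral>\<^sup>+\<omega>. indicator A (\<Sum>i. hs n (point \<omega> i)) \<partial>S)"
        by (rule nn_integral_indicator_compose[symmetric]) measurable
      also have "\<dots> = (\<integral>\<^sup>+\<omega>. indicator A ((\<Sum>i<p. hs n (point \<omega> i)) + rest (hs n) (arrival \<omega> (Suc p)) (snd (\<omega> p), \<lambda>i. \<omega> (Suc p + i))) \<partial>S)"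
        using admissible_summable[OF hs[of n]]
        by (intro nn_integral_cong_AE) (auto elim!: eventually_mono simp: series)
      also have "\<dots> = (\<integral>\<^sup>+t. indicator {0..} t * (gamma_weight p t *
         (\<integral>\<^sup>+y. W (hs n) p {0..t} (\<lambda>r. indicator A (r + rest (hs n) t y)) 0 \<partial>(\<sigma> \<Otimes>\<^sub>M S))) \<partial>lborel)"
        by (rule nn_integral_first_points_rest[where F="\<lambda>t r y. indicator A (r + rest (hs n) t y)"]) measurable
      also have "\<dots> \<le> (\<integral>\<^sup>+t. indicator {0..} t * (gamma_weight p t *
         ((\<integral>\<^sup>+y. W h p {0..t} (\<lambda>r. G t r y) 0 \<partial>(\<sigma> \<Otimes>\<^sub>M S)) + ennreal e1)) \<partial>lborel)"
      proof (rule nn_integral_mono)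
        fix t :: real
        have Wm: "(\<lambda>y. W h p {0..t} (\<lambda>r. G t r y) 0) \<in> borel_measurable (\<sigma> \<Otimes>\<^sub>M S)"
          unfolding G_def by (rule measurable_conv_integral') measurable
        have "(\<integral>\<^sup>+y. W (hs n) p {0..t} (\<lambda>r. indicator A (r + rest (hs n) t y)) 0 \<partial>(\<sigma> \<Otimes>\<^sub>M S)) \<le>
           (\<integral>\<^sup>+y. W h p {0..t} (\<lambda>r. G t r y) 0 + ennreal e1 \<partial>(\<sigma> \<Otimes>\<^sub>M S))" if "0 \<le> t"
          using that by (intro nn_integral_mono key)
        also have "(\<integral>\<^sup>+y. W h p {0..t} (\<lambda>r. G t r y) 0 + ennreal e1 \<partial>(\<sigma> \<Otimes>\<^sub>M S)) =
            (\<integral>\<^sup>+y. W h p {0..t} (\<lambda>r. G t r y) 0 \<partial>(\<sigma> \<Otimes>\<^sub>M S)) + ennreal e1"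
          by (subst nn_integral_add[OF Wm]) (auto simp: SS.P.emeasure_space_1)
        finally show "indicator {0..} t * (gamma_weight p t *
           (\<integral>\<^sup>+y. W (hs n) p {0..t} (\<lambda>r. indicator A (r + rest (hs n) t y)) 0 \<partial>(\<sigma> \<Otimes>\<^sub>M S))) \<le>
          indicator {0..} t * (gamma_weight p t *
           ((\<integral>\<^sup>+y. W h p {0..t} (\<lambda>r. G t r y) 0 \<partial>(\<sigma> \<Otimes>\<^sub>M S)) + ennreal e1))"
          by (cases "0 \<le> t") (auto intro!: mult_left_mono)
      qed
      also have "\<dots> = (\<integral>\<^sup>+t. indicator {0..} t * (gamma_weight p t *
         (\<integral>\<^sup>+y. W h p {0..t} (\<lambda>r. G t r y) 0 \<partial>(\<sigma> \<Otimes>\<^sub>M S))) \<partial>lborel) +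
         (\<integral>\<^sup>+t. indicator {0..} t * (gamma_weight p t * ennreal e1) \<partial>lborel)"
      proof -
        have [measurable]: "(\<lambda>x. W h p {0..fst x} (\<lambda>r. G (fst x) r (snd x)) 0) \<in> borel_measurable (lborel \<Otimes>\<^sub>M (\<sigma> \<Otimes>\<^sub>M S))"
          unfolding G_def by (rule measurable_conv_integral') measurable
        have "(\<lambda>t. \<integral>\<^sup>+y. W h p {0..t} (\<lambda>r. G t r y) 0 \<partial>(\<sigma> \<Otimes>\<^sub>M S)) \<in> borel_measurable lborel"
          by (rule SS.P.borel_measurable_nn_integral) (simp add: split_beta')
        then show ?thesis
          unfolding distrib_left by (intro nn_integral_add) measurable
      qed
      \<comment> \<open>The representation is now read backwards, with the points of
        \<open>h\<close>.\<close>
      also have "(\<integral>\<^sup>+t. indicator {0..} t * (gamma_weight p t *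
         (\<integral>\<^sup>+y. W h p {0..t} (\<lambda>r. G t r y) 0 \<partial>(\<sigma> \<Otimes>\<^sub>M S))) \<partial>lborel) =
         (\<integral>\<^sup>+\<omega>. G (arrival \<omega> (Suc p)) (\<Sum>i<p. h (point \<omega> i)) (snd (\<omega> p), \<lambda>i. \<omega> (Suc p + i)) \<partial>S)"
        by (rule nn_integral_first_points_rest[OF _ Gm, symmetric]) measurable
      also have "\<dots> = (\<integral>\<^sup>+\<omega>. indicator A (\<Sum>i. h (point \<omega> i)) + (indicator {L<..} (arrival \<omega> (Suc p)) + indicator {d..}
          \<bar>(\<Sum>i. hs n (point \<omega> (p + i))) - (\<Sum>i. h (point \<omega> (p + i)))\<bar>) \<partial>S)"
      proof (rule nn_integral_cong_AE)
        show "AE \<omega> in S. G (arrival \<omega> (Suc p)) (\<Sum>i<p. h (point \<omega> i)) (snd (\<omega> p), \<lambda>i. \<omega> (Suc p + i)) =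
          indicator A (\<Sum>i. h (point \<omega> i)) + (indicator {L<..} (arrival \<omega> (Suc p)) + indicator {d..}
          \<bar>(\<Sum>i. hs n (point \<omega> (p + i))) - (\<Sum>i. h (point \<omega> (p + i)))\<bar>)"
          using admissible_summable[OF hs[of n]] admissible_summable[OF h]
        proof eventually_elim
          case (elim \<omega>)
          show ?case
            unfolding G_def series[of h, OF elim(2)] tail[of h, OF elim(2)] tail[of "hs n", OF elim(1)] ..
        qed
      qed
      also have "\<dots> = (\<integral>\<^sup>+\<omega>. indicator A (\<Sum>i. h (point \<omega> i)) \<partial>S) +
          ((\<integral>\<^sup>+\<omega>. indicator {L<..} (arrival \<omega> (Suc p)) \<partial>S) + (\<integral>\<^sup>+\<omega>. indicator {d..}
          \<bar>(\<Sum>i. hs n (point \<omega> (p + i))) - (\<Sum>i. h (point \<omega> (p + i)))\<bar> \<partial>S))"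
        by (subst nn_integral_add, measurable) (subst nn_integral_add, measurable)
      also have "(\<integral>\<^sup>+\<omega>. indicator A (\<Sum>i. h (point \<omega> i)) \<partial>S) = emeasure S {\<omega>\<in>space S. (\<Sum>i. h (point \<omega> i)) \<in> A}"
        by (subst nn_integral_indicator_compose) simp_all
      also have "(\<integral>\<^sup>+\<omega>. indicator {L<..} (arrival \<omega> (Suc p)) \<partial>S) = emeasure S {\<omega>\<in>space S. L < arrival \<omega> (Suc p)}"
        by (subst nn_integral_indicator_compose) simp_all
      also have "(\<integral>\<^sup>+\<omega>. indicator {d..} \<bar>(\<Sum>i. hs n (point \<omega> (p + i))) - (\<Sum>i. h (point \<omega> (p + i)))\<bar> \<partial>S) = emeasure S (?D n)"
        by (subst nn_integral_indicator_compose) simp_all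
      also note nn_integral_gamma_weight
      also have "emeasure S {\<omega>\<in>space S. (\<Sum>i. h (point \<omega> i)) \<in> A} +
          (emeasure S {\<omega>\<in>space S. L < arrival \<omega> (Suc p)} + emeasure S (?D n)) + ennreal (\<alpha> ^ p / fact p) * ennreal e1 \<le>
        emeasure S {\<omega>\<in>space S. (\<Sum>i. h (point \<omega> i)) \<in> A} + (ennreal (e / 3) + ennreal (e / 3)) + ennreal (e / 3)"
      proof (intro add_mono order_refl L(2) elim(2))
        have "ennreal (\<alpha> ^ p / fact p) * ennreal e1 = ennreal (c * e1)"
          using c e1 by (simp add: c_def[symmetric] ennreal_mult)
        also have "c * e1 = e / 3" using c by (simp add: e1_def)
        finally show "ennreal (\<alpha> ^ p / fact p) * ennreal e1 \<le> ennreal (e / 3)" by simp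
      qed
      also have "\<dots> = emeasure S {\<omega>\<in>space S. (\<Sum>i. h (point \<omega> i)) \<in> A} + ennreal e"
        using e by (simp add: add.assoc flip: ennreal_plus)
      finally show "emeasure S {\<omega>\<in>space S. (\<Sum>i. hs n (point \<omega> i)) \<in> A} \<le>
         emeasure S {\<omega>\<in>space S. (\<Sum>i. h (point \<omega> i)) \<in> A} + ennreal e" .
    qed
  qed
qed

end

section \<open>Transfer to the given probability space\<close>

context mark_space
begin

text \<open>If all \<open>m\<close> points have the value \<open>c\<close>, the sum is
  \<open>m * c\<close>. Hence an atom of the image intensity forces an atom of the convolution
  power. The offset \<open>r\<close> is general for the sake of the induction.\<close>

lemma conv_integral_atom_ge:
  assumes k[measurable]: "integrand k" and J[measurable]: "J \<in> sets borel"
    and "r + real m * c = b"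
  shows "(\<integral>\<^sup>+z. indicator J (fst z) * indicator {c} (k z) \<partial>\<Lambda>) ^ m \<le> W k m J (indicator {b}) r"
  using assms(3)
proof (induction m arbitrary: r)
  case (Suc m)
  let ?\<mu> = "\<integral>\<^sup>+z. indicator J (fst z) * indicator {c} (k z) \<partial>\<Lambda>"
  have "?\<mu> ^ Suc m = (\<integral>\<^sup>+z. indicator J (fst z) * indicator {c} (k z) * ?\<mu> ^ m \<partial>\<Lambda>)"
    by (subst nn_integral_multc) auto
  also have "\<dots> \<le> (\<integral>\<^sup>+z. indicator J (fst z) * W k m J (indicator {b}) (r + k z) \<partial>\<Lambda>)"
  proof (rule nn_integral_mono)
    fix z
    show "indicator J (fst z) * indicator {c} (k z) * ?\<mu> ^ m \<le> indicator J (fst z) * W k m J (indicator {b}) (r + k z)"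
    proof (cases "k z = c")
      case True
      then show ?thesis using Suc.IH[of "r + c"] Suc.prems
        by (auto simp: algebra_simps intro!: mult_left_mono)
    qed simp
  qed
  finally show ?case by simp
qed simp

lemma nn_integral_restrict_time:
  assumes J[measurable]: "J \<in> sets borel" and g[measurable]: "integrand g"
  shows "(\<integral>\<^sup>+z. g z \<partial>(restrict_space lborel J \<Otimes>\<^sub>M \<sigma>)) = (\<integral>\<^sup>+z. indicator J (fst z) * g z \<partial>\<Lambda>)"
proof -
  have idm: "(\<lambda>z. z) \<in> restrict_space lborel J \<Otimes>\<^sub>M \<sigma> \<rightarrow>\<^sub>M borel \<Otimes>\<^sub>M \<sigma>"
  proof -
    have "fst \<in> restrict_space lborel J \<Otimes>\<^sub>M \<sigma> \<rightarrow>\<^sub>M (borel :: real measure)"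
      by (rule measurable_compose[OF measurable_fst]) (simp add: measurable_restrict_space1)
    from measurable_Pair[OF this measurable_snd] show ?thesis by simp
  qed
  have "(\<integral>\<^sup>+z. g z \<partial>(restrict_space lborel J \<Otimes>\<^sub>M \<sigma>)) = (\<integral>\<^sup>+t. \<integral>\<^sup>+x. g (t, x) \<partial>\<sigma> \<partial>restrict_space lborel J)"
    by (rule nn_integral_fst[symmetric]) (rule measurable_compose[OF idm g])
  also have "\<dots> = (\<integral>\<^sup>+t. (\<integral>\<^sup>+x. g (t, x) \<partial>\<sigma>) * indicator J t \<partial>lborel)"
    by (rule nn_integral_restrict_space) simp
  also have "\<dots> = (\<integral>\<^sup>+t. \<integral>\<^sup>+x. indicator J t * g (t, x) \<partial>\<sigma> \<partial>lborel)"
    by (intro nn_integral_cong) (simp add: nn_integral_cmult mult.commute)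
  also have "\<dots> = (\<integral>\<^sup>+z. indicator J (fst z) * g z \<partial>\<Lambda>)"
    by (subst nn_integral_fst[symmetric]) auto
  finally show ?thesis .
qed

text \<open>The bridge from the convolution power on a product space to iterated integrals.
  \<open>k'\<close> stands for a given function and \<open>k\<close> for its measurable extension to
  all times; only values at times in \<open>J\<close> enter.\<close>

lemma emeasure_image_convolution_power:
  assumes J[measurable]: "J \<in> sets borel" and k[measurable]: "integrand k"
    and eq: "\<And>t x. t \<in> J \<Longrightarrow> k' (t, x) = k (t, x)"
    and B[measurable]: "B \<in> sets borel"
  shows "emeasure (image_convolution_power (restrict_space lborel J \<Otimes>\<^sub>M \<sigma>) k' p) B = W k p J (indicator B) 0"
proof -
  let ?N = "restrict_space lborel J \<Otimes>\<^sub>M \<sigma>"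
  interpret J: sigma_finite_measure "restrict_space lborel J"
    by (rule sigma_finite_measure_restrict_space) (auto intro: sigma_finite_lborel)
  interpret JS: pair_sigma_finite "restrict_space lborel J" \<sigma> ..
  interpret P: product_sigma_finite "\<lambda>_::nat. ?N"
    by (simp add: product_sigma_finite_def JS.sigma_finite_measure_axioms)
  have [measurable]: "k \<in> borel_measurable ?N"
  proof -
    have "fst \<in> ?N \<rightarrow>\<^sub>M (borel :: real measure)"
      by (rule measurable_compose[OF measurable_fst]) (simp add: measurable_restrict_space1)
    from measurable_compose[OF measurable_Pair[OF this measurable_snd] k] show ?thesis by simp
  qed
  have G: "(\<integral>\<^sup>+z. G (r + (\<Sum>i<p. k (z i))) \<partial>(\<Pi>\<^sub>M i\<in>{..<p}. ?N)) = W k p J G r"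
    if [measurable]: "G \<in> borel_measurable borel" for G :: "real \<Rightarrow> ennreal" and p r
  proof (induction p arbitrary: r)
    case 0
    then show ?case by (simp add: PiM_empty nn_integral_count_space_finite)
  next
    case (Suc p)
    have [measurable]: "(\<lambda>z. W k p J G (r + k z)) \<in> borel_measurable (borel \<Otimes>\<^sub>M \<sigma>)"
      by (rule measurable_conv_integral') auto
    have "(\<integral>\<^sup>+z. G (r + (\<Sum>i<Suc p. k (z i))) \<partial>(\<Pi>\<^sub>M i\<in>{..<Suc p}. ?N)) =
       (\<integral>\<^sup>+y. \<integral>\<^sup>+z. G (r + (\<Sum>i<Suc p. k ((z(p := y)) i))) \<partial>(\<Pi>\<^sub>M i\<in>{..<p}. ?N) \<partial>?N)"
      unfolding lessThan_Suc[of p] by (rule P.product_nn_integral_insert_rev) auto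
    also have "\<dots> = (\<integral>\<^sup>+y. W k p J G (r + k y) \<partial>?N)"
      unfolding Suc[symmetric] by (intro nn_integral_cong) (simp add: add_ac)
    also have "\<dots> = W k (Suc p) J G r"
      by (simp add: nn_integral_restrict_time)
    finally show ?case .
  qed
  have "image_convolution_power ?N k' p = image_convolution_power ?N k p"
    unfolding image_convolution_power_def
  proof (rule distr_cong)
    fix z assume z: "z \<in> space (\<Pi>\<^sub>M i\<in>{..<p}. ?N)"
    have "k' (z i) = k (z i)" if "i < p" for i
    proof -
      have "z i \<in> space ?N" using z that by (auto simp: space_PiM)
      then have "fst (z i) \<in> J" by (auto simp: space_pair_measure space_restrict_space)
      then show ?thesis using eq[of "fst (z i)" "snd (z i)"] by simp
    qed
    then show "(\<Sum>i<p. k' (z i)) = (\<Sum>i<p. k (z i))" by simp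
  qed auto
  then have "emeasure (image_convolution_power ?N k' p) B = (\<integral>\<^sup>+x. indicator B x \<partial>image_convolution_power ?N k p)"
    by (simp add: image_convolution_power_def)
  also have "\<dots> = (\<integral>\<^sup>+z. indicator B (0 + (\<Sum>i<p. k (z i))) \<partial>(\<Pi>\<^sub>M i\<in>{..<p}. ?N))"
    unfolding image_convolution_power_def by (subst nn_integral_distr) auto
  also have "\<dots> = W k p J (indicator B) 0" by (rule G) measurable
  finally show ?thesis .
qed

end

section \<open>Independence of the pairs of waiting time and mark\<close>

context prob_space
begin

text \<open>The \<open>\<sigma>\<close>-algebra of the arrival times contains the events of the increments.\<close>

lemma indep_vars_increments_marks:
  fixes D :: "nat \<Rightarrow> 'a \<Rightarrow> 'd::second_countable_topology" and E T :: "nat \<Rightarrow> 'a \<Rightarrow> real"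
  assumes D: "indep_vars (\<lambda>_. borel) D UNIV" and E: "indep_vars (\<lambda>_. borel) E UNIV"
    and T: "\<And>i \<omega>. T i \<omega> = (\<Sum>j\<le>i. E j \<omega>)"
    and DT: "indep_set
      (sets (vimage_algebra (space M) (\<lambda>\<omega> i. D i \<omega>) (\<Pi>\<^sub>M i\<in>UNIV. borel)))
      (sets (vimage_algebra (space M) (\<lambda>\<omega> i. T i \<omega>) (\<Pi>\<^sub>M i\<in>UNIV. borel)))"
  shows "indep_vars (\<lambda>_. borel \<Otimes>\<^sub>M borel) (\<lambda>i \<omega>. (E i \<omega>, D i \<omega>)) UNIV"
    and "distr M borel (E i) \<Otimes>\<^sub>M distr M borel (D i) = distr M (borel \<Otimes>\<^sub>M borel) (\<lambda>\<omega>. (E i \<omega>, D i \<omega>))"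
proof -
  have [measurable]: "random_variable borel (E i)" "random_variable borel (D i)" for i
    using D E by (auto simp: indep_vars_def)
  let ?\<D> = "vimage_algebra (space M) (\<lambda>\<omega> i. D i \<omega>) (\<Pi>\<^sub>M i\<in>UNIV. borel)"
  let ?\<T> = "vimage_algebra (space M) (\<lambda>\<omega> i. T i \<omega>) (\<Pi>\<^sub>M i\<in>UNIV. borel)"
  define GE where "GE i A = E i -` A \<inter> space M" for i A
  define GD where "GD i A = D i -` A \<inter> space M" for i A
  \<comment> \<open>Rectangles: they are stable under intersection and generate the events of one
    pair, so independence need only be checked for them.\<close>
  define G where "G i = {GE i A \<inter> GD i B | A B. A \<in> sets borel \<and> B \<in> sets borel}" for i
  have GDm: "GD i A \<in> sets ?\<D>" if [measurable]: "A \<in> sets borel" for i A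
  proof -
    have "{f \<in> space (\<Pi>\<^sub>M i\<in>UNIV. borel). f i \<in> A} \<in> sets (\<Pi>\<^sub>M i\<in>(UNIV::nat set). (borel :: 'd measure))"
      by measurable
    from in_vimage_algebra[OF this, of "\<lambda>\<omega> i. D i \<omega>" "space M"] show ?thesis
      by (simp add: GD_def vimage_def space_PiM)
  qed
  have GEm: "GE i A \<in> sets ?\<T>" if [measurable]: "A \<in> sets borel" for i A
  proof -
    \<comment> \<open>A waiting time is the difference of consecutive arrival times; for index 0 the
      previous arrival time is taken to be 0.\<close>
    have "{f \<in> space (\<Pi>\<^sub>M i\<in>UNIV. borel). f i - (if i = 0 then 0 else f (i - 1)) \<in> A} \<in> sets (\<Pi>\<^sub>M i\<in>(UNIV::nat set). (borel :: real measure))"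
      by measurable
    from in_vimage_algebra[OF this, of "\<lambda>\<omega> i. T i \<omega>" "space M"]
    have "(\<lambda>\<omega> i. T i \<omega>) -` {f \<in> space (\<Pi>\<^sub>M i\<in>UNIV. borel). f i - (if i = 0 then 0 else f (i - 1)) \<in> A} \<inter> space M \<in> sets ?\<T>" .
    moreover have "T i \<omega> - (if i = 0 then 0 else T (i - 1) \<omega>) = E i \<omega>" for \<omega>
      by (cases i) (simp_all add: T)
    ultimately show ?thesis by (simp add: GE_def vimage_def space_PiM)
  qed
  have ev: "GE i A \<in> events" "GD i A' \<in> events" if "A \<in> sets borel" "A' \<in> sets borel" for i A A'
    using that by (auto simp: GE_def GD_def)
  have ind: "prob (X \<inter> Y) = prob X * prob Y" if "X \<in> sets ?\<T>" "Y \<in> sets ?\<D>" for X Y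
    using indep_setD[OF DT that(2,1)] by (simp add: Int_commute mult.commute)
  have "indep_sets G UNIV"
    unfolding indep_sets_def
  proof (intro conjI ballI allI impI)
    fix i show "G i \<subseteq> events" using ev by (auto simp: G_def)
  next
    fix J and A assume J: "J \<subseteq> (UNIV :: nat set)" "J \<noteq> {}" "finite J" and A: "A \<in> Pi J G"
    then have "\<forall>j\<in>J. \<exists>a b. a \<in> sets borel \<and> b \<in> sets borel \<and> A j = GE j a \<inter> GD j b"
      by (auto simp: G_def Pi_iff)
    then obtain a b where ab: "\<And>j. j \<in> J \<Longrightarrow> a j \<in> sets borel" "\<And>j. j \<in> J \<Longrightarrow> b j \<in> sets borel"
      "\<And>j. j \<in> J \<Longrightarrow> A j = GE j (a j) \<inter> GD j (b j)" by metis
    have "(\<Inter>j\<in>J. A j) = (\<Inter>j\<in>J. GE j (a j)) \<inter> (\<Inter>j\<in>J. GD j (b j))"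
      using ab(3) J by auto
    \<comment> \<open>Factor first between arrival times and marks, then inside each family, and
      finally regroup the factors index by index.\<close>
    then have "prob (\<Inter>j\<in>J. A j) = prob (\<Inter>j\<in>J. GE j (a j)) * prob (\<Inter>j\<in>J. GD j (b j))"
      using J ab by (auto intro!: ind sets.finite_INT GEm GDm)
    also have "prob (\<Inter>j\<in>J. GE j (a j)) = (\<Prod>j\<in>J. prob (GE j (a j)))"
      unfolding GE_def using J ab by (intro indep_varsD[OF E]) auto
    also have "prob (\<Inter>j\<in>J. GD j (b j)) = (\<Prod>j\<in>J. prob (GD j (b j)))"
      unfolding GD_def using J ab by (intro indep_varsD[OF D]) auto
    also have "(\<Prod>j\<in>J. prob (GE j (a j))) * (\<Prod>j\<in>J. prob (GD j (b j))) = (\<Prod>j\<in>J. prob (A j))"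
      unfolding prod.distrib[symmetric] using ab by (intro prod.cong) (simp_all add: ind GEm GDm)
    finally show "prob (\<Inter>j\<in>J. A j) = (\<Prod>j\<in>J. prob (A j))" .
  qed
  then have "indep_sets (\<lambda>i. sigma_sets (space M) (G i)) UNIV"
  proof (rule indep_sets_sigma)
    fix i show "Int_stable (G i)"
    proof (rule Int_stableI)
      fix X Y assume "X \<in> G i" "Y \<in> G i"
      then obtain a b a' b' where "a \<in> sets borel" "b \<in> sets borel" "a' \<in> sets borel" "b' \<in> sets borel"
        "X = GE i a \<inter> GD i b" "Y = GE i a' \<inter> GD i b'" by (auto simp: G_def)
      moreover from this have "X \<inter> Y = GE i (a \<inter> a') \<inter> GD i (b \<inter> b')"
        by (auto simp: GE_def GD_def)
      ultimately show "X \<inter> Y \<in> G i" unfolding G_def by blast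
    qed
  qed
  then have "indep_sets (\<lambda>i. {(\<lambda>\<omega>. (E i \<omega>, D i \<omega>)) -` A \<inter> space M |A. A \<in> sets (borel \<Otimes>\<^sub>M borel)}) UNIV"
  proof (rule indep_sets_mono_sets)
    fix i
    let ?X = "\<lambda>\<omega>. (E i \<omega>, D i \<omega>)"
    let ?R = "{a \<times> b | a b. a \<in> sets (borel :: real measure) \<and> b \<in> sets (borel :: 'd measure)}"
    have "{?X -` A \<inter> space M |A. A \<in> sigma_sets UNIV ?R} = sigma_sets (space M) {?X -` A \<inter> space M |A. A \<in> ?R}"
      by (rule sigma_sets_vimage_commute) auto
    also have "\<dots> \<subseteq> sigma_sets (space M) (G i)"
    proof (rule sigma_sets_mono', rule subsetI)
      fix X assume "X \<in> {?X -` A \<inter> space M |A. A \<in> ?R}"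
      then obtain a b where "X = ?X -` (a \<times> b) \<inter> space M" "a \<in> sets borel" "b \<in> sets borel" by auto
      then show "X \<in> G i" unfolding G_def GE_def GD_def by (intro CollectI exI[of _ a] exI[of _ b]) auto
    qed
    finally show "{?X -` A \<inter> space M |A. A \<in> sets (borel \<Otimes>\<^sub>M borel)} \<subseteq> sigma_sets (space M) (G i)"
      by (simp add: sets_pair_measure)
  qed
  then show "indep_vars (\<lambda>_. borel \<Otimes>\<^sub>M borel) (\<lambda>i \<omega>. (E i \<omega>, D i \<omega>)) UNIV"
    unfolding indep_vars_def2 by auto
  interpret e: prob_space "distr M borel (E i)" by (rule prob_space_distr) measurable
  interpret d: prob_space "distr M borel (D i)" by (rule prob_space_distr) measurable
  show "distr M borel (E i) \<Otimes>\<^sub>M distr M borel (D i) = distr M (borel \<Otimes>\<^sub>M borel) (\<lambda>\<omega>. (E i \<omega>, D i \<omega>))"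
  proof (rule pair_measure_eqI)
    fix A B assume "A \<in> sets (distr M borel (E i))" "B \<in> sets (distr M borel (D i))"
    then have AB[measurable]: "A \<in> sets borel" "B \<in> sets borel" by auto
    have "(\<lambda>\<omega>. (E i \<omega>, D i \<omega>)) -` (A \<times> B) \<inter> space M = GE i A \<inter> GD i B"
      by (auto simp: GE_def GD_def)
    then have "emeasure (distr M (borel \<Otimes>\<^sub>M borel) (\<lambda>\<omega>. (E i \<omega>, D i \<omega>))) (A \<times> B) = ennreal (prob (GE i A \<inter> GD i B))"
      by (subst emeasure_distr) (auto simp: emeasure_eq_measure)
    also have "\<dots> = ennreal (prob (GE i A)) * ennreal (prob (GD i B))"
      by (simp add: ind GEm GDm AB ennreal_mult)
    also have "\<dots> = emeasure (distr M borel (E i)) A * emeasure (distr M borel (D i)) B"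
      by (simp add: emeasure_distr emeasure_eq_measure GE_def GD_def)
    finally show "emeasure (distr M borel (E i)) A * emeasure (distr M borel (D i)) B =
        emeasure (distr M (borel \<Otimes>\<^sub>M borel) (\<lambda>\<omega>. (E i \<omega>, D i \<omega>))) (A \<times> B)" by simp
  qed (auto intro: e.sigma_finite_measure_axioms d.sigma_finite_measure_axioms sets_pair_measure_cong)
qed

end

text \<open>Extension by zero gives functions measurable at all times from functions measurable on
  the half line only. Since the waiting times are nonnegative, the series is unchanged.\<close>

definition on_halfline :: "(real \<times> 'b \<Rightarrow> real) \<Rightarrow> real \<times> 'b \<Rightarrow> real" where
  "on_halfline k z = (if 0 \<le> fst z then k z else 0)"

lemma measurable_on_halfline:
  assumes k: "k \<in> borel_measurable (restrict_space borel {0..} \<Otimes>\<^sub>M N)"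
  shows "on_halfline k \<in> borel_measurable (borel \<Otimes>\<^sub>M N)"
proof -
  \<comment> \<open>Clamping moves every time into the half line, where \<open>k\<close> is known to
    be measurable.\<close>
  have "(\<lambda>z. max 0 (fst z)) \<in> borel \<Otimes>\<^sub>M N \<rightarrow>\<^sub>M restrict_space (borel :: real measure) {0..}"
    by (rule measurable_restrict_space2) auto
  from measurable_compose[OF measurable_Pair[OF this measurable_snd] k]
  have [measurable]: "(\<lambda>z. k (max 0 (fst z), snd z)) \<in> borel_measurable (borel \<Otimes>\<^sub>M N)" .
  have "on_halfline k = (\<lambda>z. if 0 \<le> fst z then k (max 0 (fst z), snd z) else 0)"
    by (auto simp: on_halfline_def max_def)
  then show ?thesis by simp
qed

section \<open>From the hypotheses of the theorem to those of \<open>law_converges\<close>\<close>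

locale euclidean_marked_poisson = marked_poisson \<sigma> \<alpha> for \<sigma> :: "'a::euclidean_space measure" and \<alpha> +
  assumes sets_\<sigma>[measurable_cong]: "sets \<sigma> = sets borel" and \<sigma>_0: "emeasure \<sigma> {0} = 0"
begin

lemma sets_product: "sets (borel \<Otimes>\<^sub>M \<sigma>) = sets (borel \<Otimes>\<^sub>M (borel :: 'a measure))"
  by (intro sets_pair_measure_cong sets_\<sigma> refl)

lemma on_halfline_borel_measurable:
  assumes "k \<in> borel_measurable (restrict_space borel {0..} \<Otimes>\<^sub>M borel)"
  shows "on_halfline k \<in> borel_measurable (borel \<Otimes>\<^sub>M \<sigma>)"
  using measurable_on_halfline[OF assms] measurable_cong_sets[OF sets_product refl] by blast

lemma AE_mark_neq_0: "AE z in \<Lambda>. snd z \<noteq> 0"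
proof (rule AE_I')
  have "emeasure \<Lambda> (UNIV \<times> {0}) = emeasure lborel (UNIV :: real set) * emeasure \<sigma> {0}"
    by (intro emeasure_pair_measure_Times) (auto simp: sets_\<sigma>)
  then show "UNIV \<times> {0} \<in> null_sets \<Lambda>"
    using \<sigma>_0 by (auto simp: null_sets_def sets_\<sigma>)
qed auto

lemma small_jump_integral_eq:
  "small_jump_integral \<sigma> k = (\<integral>\<^sup>+z. ennreal (min ((on_halfline k z)\<^sup>2) 1) \<partial>\<Lambda>)"
  unfolding small_jump_integral_def
proof (rule nn_integral_cong_AE)
  show "AE z in \<Lambda>. ennreal (min (\<bar>k z\<bar>\<^sup>2) 1) * indicator ({0..} \<times> (UNIV - {0})) z =
    ennreal (min ((on_halfline k z)\<^sup>2) 1)"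
    using AE_mark_neq_0 by eventually_elim (auto simp: on_halfline_def indicator_def mem_Times_iff)
qed

text \<open>The two windows differ by the time 0 and the mark 0, both negligible for
  \<open>\<Lambda>\<close>; the factor \<alpha> is built into \<open>drift\<close>.\<close>

lemma drift_truncate_eq:
  assumes k: "k \<in> borel_measurable (restrict_space borel {0..} \<Otimes>\<^sub>M borel)"
  shows "drift (truncate (on_halfline k)) 0 s = \<alpha> * truncated_integral \<sigma> k s"
proof -
  note [measurable] = on_halfline_borel_measurable[OF k]
  have "{0..s} \<times> (UNIV - {0}) \<in> sets \<Lambda>"
    by (rule pair_measureI) (auto simp: sets_\<sigma>)
  then have [measurable]: "{0..s} \<times> (UNIV - {0}) \<in> sets (borel \<Otimes>\<^sub>M \<sigma>)"
    by (simp cong: sets_pair_measure_cong)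
  have "truncated_integral \<sigma> k s = (\<integral>z. indicator ({0..s} \<times> (UNIV - {0})) z * truncate (on_halfline k) z \<partial>\<Lambda>)"
    unfolding truncated_integral_def set_lebesgue_integral_def
    by (intro Bochner_Integration.integral_cong) (auto simp: indicator_def truncate_def on_halfline_def)
  also have "\<dots> = (\<integral>z. indicator {0<..s} (fst z) * truncate (on_halfline k) z \<partial>\<Lambda>)"
  proof (rule integral_cong_AE)
    show "AE z in \<Lambda>. indicator ({0..s} \<times> (UNIV - {0})) z * truncate (on_halfline k) z =
        indicator {0<..s} (fst z) * truncate (on_halfline k) z"
      using AE_mark_neq_0 AE_fst_neq[of 0] by eventually_elim (auto simp: indicator_def mem_Times_iff)
  qed measurable
  finally show ?thesis by (simp add: drift_def)
qed

lemma admissible_on_halfline: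
  assumes k: "k \<in> borel_measurable (restrict_space borel {0..} \<Otimes>\<^sub>M borel)"
    and "small_jump_integral \<sigma> k < \<infinity>" "centering_exists \<sigma> k"
  shows "admissible (on_halfline k) (\<alpha> * centering \<sigma> k)"
proof -
  obtain l where l: "(truncated_integral \<sigma> k \<longlongrightarrow> l) at_top"
    using assms(3) by (auto simp: centering_exists_def)
  then have "centering \<sigma> k = l" unfolding centering_def by (intro tendsto_Lim) auto
  then have "(drift (truncate (on_halfline k)) 0 \<longlongrightarrow> \<alpha> * centering \<sigma> k) at_top"
    unfolding drift_truncate_eq[OF k] using l by (auto intro: tendsto_mult_left)
  then show ?thesis
    using assms(2) on_halfline_borel_measurable[OF k]
    unfolding admissible_def small_jump_integral_eq by (simp add: on_halfline_def)
qed

abbreviation "conv_power p J k \<equiv> image_convolution_power (restrict_space lborel J \<Otimes>\<^sub>M \<sigma>) k p"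

lemma emeasure_image_convolution_power_interval:
  assumes k: "k \<in> borel_measurable (restrict_space borel {0..} \<Otimes>\<^sub>M borel)"
    and "J \<in> sets borel" "J \<subseteq> {0..}" "B \<in> sets borel"
  shows "emeasure (conv_power p J k) B = W (on_halfline k) p J (indicator B) 0"
  using assms by (intro emeasure_image_convolution_power on_halfline_borel_measurable) (auto simp: on_halfline_def)

lemma finite_image_convolution_power:
  fixes k :: "real \<times> 'a \<Rightarrow> real"
  assumes k: "k \<in> borel_measurable (restrict_space borel {0..} \<Otimes>\<^sub>M borel)"
  shows "finite_measure (conv_power p {0..t} k)"
proof (rule finite_measureI)
  have "emeasure (conv_power p {0..t} k) UNIV = W (on_halfline k) p {0..t} (\<lambda>_. 1) 0"
    by (subst emeasure_image_convolution_power_interval[OF k]) (auto simp: indicator_def)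
  also have "\<dots> < \<infinity>" by (cases "0 \<le> t") (auto simp: conv_integral_const ennreal_power power_0_left)
  finally show "emeasure (conv_power p {0..t} k)
      (space (conv_power p {0..t} k)) \<noteq> \<infinity>"
    by (simp add: image_convolution_power_def)
qed

text \<open>A value \<open>c\<close> taken with positive intensity would give the single point
  \<open>p * c\<close> positive mass under the convolution power, against absolute continuity. This
  is applied to \<open>c\<close> = 1 and \<open>c\<close> = -1.\<close>

lemma AE_abs_neq_1:
  assumes k: "k \<in> borel_measurable (restrict_space borel {0..} \<Otimes>\<^sub>M borel)"
    and ac: "absolutely_continuous lborel (conv_power p {0..} k)"
  shows "AE z in \<Lambda>. \<bar>on_halfline k z\<bar> \<noteq> 1"
proof -
  note [measurable] = on_halfline_borel_measurable[OF k]
  have *: "AE z in \<Lambda>. 0 \<le> fst z \<longrightarrow> on_halfline k z \<noteq> c" for c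
  proof -
    let ?\<mu> = "\<integral>\<^sup>+z. indicator {0..} (fst z) * indicator {c} (on_halfline k z) \<partial>\<Lambda>"
    have "{real p * c} \<in> null_sets lborel" by (auto simp: null_sets_def)
    then have "emeasure (conv_power p {0..} k) {real p * c} = 0"
      using ac unfolding absolutely_continuous_def by (blast dest: null_setsD1)
    then have "W (on_halfline k) p {0..} (indicator {real p * c}) 0 = 0"
      by (subst (asm) emeasure_image_convolution_power_interval[OF k]) auto
    then have "?\<mu> ^ p = 0"
      using conv_integral_atom_ge[of "on_halfline k" "{0..}" 0 p c "real p * c"] by simp
    then have "?\<mu> = 0" by (rule power_eq_0_iff[THEN iffD1, THEN conjunct1])
    then have "AE z in \<Lambda>. indicator {0..} (fst z) * indicator {c} (on_halfline k z) = (0::ennreal)"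
      by (subst (asm) nn_integral_0_iff_AE) auto
    then show ?thesis by eventually_elim (auto simp: indicator_def)
  qed
  show ?thesis
    using *[of 1] *[of "-1"] by eventually_elim (auto simp: abs_if on_halfline_def split: if_splits)
qed

text \<open>The power over \<open>{0..t}\<close> is dominated by the one over the half line, so it
  inherits absolute continuity; being finite, it admits
  \<open>absolutely_continuous_translate\<close>.\<close>

lemma convolution_translate:
  assumes k: "k \<in> borel_measurable (restrict_space borel {0..} \<Otimes>\<^sub>M borel)"
    and ac: "absolutely_continuous lborel (conv_power p {0..} k)"
    and e: "e > 0"
  shows "\<exists>d>0. \<forall>r B. \<bar>r\<bar> < d \<longrightarrow> B \<in> sets borel \<longrightarrow>
    W (on_halfline k) p {0..t} (indicator {x. x + r \<in> B}) 0 \<le> W (on_halfline k) p {0..t} (indicator B) 0 + ennreal e"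
proof -
  let ?\<nu> = "conv_power p {0..t} k"
  have s: "sets ?\<nu> = sets borel" by (simp add: image_convolution_power_def)
  have "absolutely_continuous lborel ?\<nu>"
    unfolding absolutely_continuous_def
  proof
    fix B assume B: "B \<in> null_sets (lborel :: real measure)"
    then have [measurable]: "B \<in> sets borel" by auto
    have "emeasure ?\<nu> B \<le> emeasure (conv_power p {0..} k) B"
      by (subst (1 2) emeasure_image_convolution_power_interval[OF k]) (auto intro: conv_integral_mono)
    also have "\<dots> = 0" using ac B unfolding absolutely_continuous_def by (blast dest: null_setsD1)
    finally show "B \<in> null_sets ?\<nu>" using s by (auto simp: null_sets_def)
  qed
  from absolutely_continuous_translate[OF finite_image_convolution_power[OF k] s this e]
  obtain d where d: "d > 0" "\<And>r B. \<bar>r\<bar> < d \<Longrightarrow> B \<in> sets borel \<Longrightarrow> emeasure ?\<nu> {x. x + r \<in> B} \<le> emeasure ?\<nu> B + ennreal e"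
    by blast
  show ?thesis
  proof (intro exI[of _ d] conjI allI impI d(1))
    fix r B assume r: "\<bar>r\<bar> < d" and B: "B \<in> sets (borel :: real measure)"
    have "(\<lambda>x. x + r) -` B \<inter> space borel \<in> sets borel" by (rule measurable_sets[OF _ B]) measurable
    then have Br: "{x. x + r \<in> B} \<in> sets borel" by (simp add: vimage_def)
    have sub: "{0..t} \<subseteq> {0..}" by auto
    from d(2)[OF r B] show "W (on_halfline k) p {0..t} (indicator {x. x + r \<in> B}) 0 \<le> W (on_halfline k) p {0..t} (indicator B) 0 + ennreal e"
      unfolding emeasure_image_convolution_power_interval[OF k atLeastAtMost_borel sub Br]
        emeasure_image_convolution_power_interval[OF k atLeastAtMost_borel sub B] .
  qed
qed

lemma convolution_variation:
  assumes ks: "\<And>n. ks n \<in> borel_measurable (restrict_space borel {0..} \<Otimes>\<^sub>M borel)"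
    and k: "k \<in> borel_measurable (restrict_space borel {0..} \<Otimes>\<^sub>M borel)"
    and conv: "converges_in_variation
        (\<lambda>n. conv_power p {0..t} (ks n))
        (conv_power p {0..t} k)"
    and e: "e > 0"
  shows "\<forall>\<^sub>F n in sequentially. \<forall>B\<in>sets borel.
       W (on_halfline (ks n)) p {0..t} (indicator B) 0 \<le> W (on_halfline k) p {0..t} (indicator B) 0 + ennreal e"
proof -
  let ?\<nu> = "\<lambda>k. conv_power p {0..t} k"
  have s: "sets (?\<nu> k) = sets borel" for k by (simp add: image_convolution_power_def)
  have sub: "{0..t} \<subseteq> {0..}" by auto
  note fin = finite_image_convolution_power
  have "\<forall>\<^sub>F n in sequentially. tv_norm (\<lambda>A. measure (?\<nu> (ks n)) A - measure (?\<nu> k) A) < e"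
    using conv e unfolding converges_in_variation_def by (rule order_tendstoD)
  then show ?thesis
  proof eventually_elim
    case (elim n)
    show ?case
    proof
      fix B :: "real set" assume B: "B \<in> sets borel"
      have "\<bar>measure (?\<nu> (ks n)) B - measure (?\<nu> k) B\<bar> < e"
        using measure_diff_le_tv_norm[OF fin[OF ks] fin[OF k] s s B] elim by (rule le_less_trans)
      then have "ennreal (measure (?\<nu> (ks n)) B) \<le> ennreal (measure (?\<nu> k) B + e)"
        by (intro ennreal_leI) linarith
      then have "emeasure (?\<nu> (ks n)) B \<le> emeasure (?\<nu> k) B + ennreal e"
        using e by (simp add: finite_measure.emeasure_eq_measure[OF fin[OF ks]] finite_measure.emeasure_eq_measure[OF fin[OF k]] ennreal_plus)
      then show "W (on_halfline (ks n)) p {0..t} (indicator B) 0 \<le> W (on_halfline k) p {0..t} (indicator B) 0 + ennreal e"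
        unfolding emeasure_image_convolution_power_interval[OF k atLeastAtMost_borel sub B]
          emeasure_image_convolution_power_interval[OF ks atLeastAtMost_borel sub B] .
    qed
  qed
qed

end

theorem proposition3p1:
  fixes M :: "'w measure"
    and \<Delta> :: "nat \<Rightarrow> 'w \<Rightarrow> 'a::euclidean_space"
    and E T :: "nat \<Rightarrow> 'w \<Rightarrow> real"
    and \<sigma> :: "'a measure"
    and \<alpha> :: real
    and hs :: "nat \<Rightarrow> real \<times> 'a \<Rightarrow> real"
    and h :: "real \<times> 'a \<Rightarrow> real"
  assumes prob: "prob_space M"
    and \<Delta>_indep: "prob_space.indep_vars M (\<lambda>_. borel) \<Delta> UNIV"
    and \<Delta>_law: "\<And>i. distr M borel (\<Delta> i) = \<sigma>"
    and \<sigma>_0: "emeasure \<sigma> {0} = 0"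
    and \<alpha>_pos: "\<alpha> > 0"
    and E_indep: "prob_space.indep_vars M (\<lambda>_. borel) E UNIV"
    and E_law: "\<And>i. distributed M lborel (E i) (exponential_density \<alpha>)"
    and E_nonneg: "\<And>i \<omega>. \<omega> \<in> space M \<Longrightarrow> 0 \<le> E i \<omega>"
    and T_def: "\<And>i \<omega>. T i \<omega> = (\<Sum>j\<le>i. E j \<omega>)"
    and \<Delta>_T_indep: "prob_space.indep_set M
      (sets (vimage_algebra (space M) (\<lambda>\<omega> i. \<Delta> i \<omega>) (\<Pi>\<^sub>M i\<in>UNIV. borel)))
      (sets (vimage_algebra (space M) (\<lambda>\<omega> i. T i \<omega>) (\<Pi>\<^sub>M i\<in>UNIV. borel)))"
    and meas: "\<And>k. k \<in> insert h (range hs) \<Longrightarrow>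
      k \<in> borel_measurable (restrict_space borel {0..} \<Otimes>\<^sub>M borel)"
    and integrability: "\<And>k. k \<in> insert h (range hs) \<Longrightarrow> small_jump_integral \<sigma> k < \<infinity>"
    and a_exists: "\<And>k. k \<in> insert h (range hs) \<Longrightarrow> centering_exists \<sigma> k"
    and cond1: "(\<lambda>n. centering \<sigma> (hs n)) \<longlonglongrightarrow> centering \<sigma> h"
    and cond2: "(\<lambda>n. small_jump_integral \<sigma> (\<lambda>z. hs n z - h z)) \<longlonglongrightarrow> 0"
    and cond3: "\<exists>p\<ge>1.
      absolutely_continuous lborel
        (image_convolution_power (restrict_space lborel {0..} \<Otimes>\<^sub>M \<sigma>) h p) \<and>
      (\<forall>t>0. converges_in_variation
        (\<lambda>n. image_convolution_power (restrict_space lborel {0..t} \<Otimes>\<^sub>M \<sigma>) (hs n) p)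
        (image_convolution_power (restrict_space lborel {0..t} \<Otimes>\<^sub>M \<sigma>) h p))"
  shows "converges_in_variation
    (\<lambda>n. distr M borel (\<lambda>\<omega>. \<Sum>i. hs n (T i \<omega>, \<Delta> i \<omega>)))
    (distr M borel (\<lambda>\<omega>. \<Sum>i. h (T i \<omega>, \<Delta> i \<omega>)))"
proof -
  interpret prob_space M by (rule prob)
  have E_m[measurable]: "E i \<in> borel_measurable M" and D_m[measurable]: "\<Delta> i \<in> borel_measurable M" for i
    using E_indep \<Delta>_indep by (auto simp: indep_vars_def)
  interpret s: prob_space \<sigma>
    unfolding \<Delta>_law[of 0, symmetric] by (rule prob_space_distr) measurable
  interpret P: euclidean_marked_poisson \<sigma> \<alpha>
    by unfold_locales (use \<alpha>_pos \<sigma>_0 in \<open>auto simp flip: \<Delta>_law[of 0]\<close>)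
  note pairs = indep_vars_increments_marks[OF \<Delta>_indep E_indep T_def \<Delta>_T_indep]
  have E_distr: "distr M borel (E i) = density lborel (exponential_density \<alpha>)" for i
    using distributed_distr_eq_density[OF E_law[of i]] distr_cong[of M M lborel borel "E i" "E i"] by simp
  \<comment> \<open>\<open>\<Phi>\<close> carries the given variables to the canonical sequence
    space. Once its law is identified, only laws on that space matter.\<close>
  define \<Phi> where "\<Phi> \<omega> i = (E i \<omega>, \<Delta> i \<omega>)" for \<omega> i
  have \<Phi>_law: "distr M P.S \<Phi> = P.S"
  proof -
    have "distr M (borel \<Otimes>\<^sub>M borel) (\<lambda>\<omega>. (E i \<omega>, \<Delta> i \<omega>)) = P.Q" for i
      unfolding pairs(2)[of i, symmetric] E_distr \<Delta>_law P.Q_def ..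
    moreover have "distr M (\<Pi>\<^sub>M i\<in>UNIV. borel \<Otimes>\<^sub>M borel) (\<lambda>\<omega>. \<lambda>i\<in>UNIV. (E i \<omega>, \<Delta> i \<omega>)) =
        (\<Pi>\<^sub>M i\<in>UNIV. distr M (borel \<Otimes>\<^sub>M borel) (\<lambda>\<omega>. (E i \<omega>, \<Delta> i \<omega>)))"
      by (rule iffD1[OF indep_vars_iff_distr_eq_PiM' pairs(1)]) auto
    moreover have "sets P.S = sets (\<Pi>\<^sub>M i\<in>(UNIV::nat set). (borel \<Otimes>\<^sub>M borel :: (real \<times> 'a) measure))"
      by (intro sets_PiM_cong refl) (simp add: P.sets_Q P.sets_product)
    ultimately show ?thesis
      by (simp add: \<Phi>_def[abs_def] restrict_UNIV cong: distr_cong)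
  qed
  have \<Phi>_m[measurable]: "\<Phi> \<in> M \<rightarrow>\<^sub>M P.S"
  proof -
    have Q: "sets P.Q = sets (borel \<Otimes>\<^sub>M borel)" by (simp only: P.sets_Q P.sets_product)
    have "(\<lambda>\<omega>. \<Phi> \<omega> i) \<in> M \<rightarrow>\<^sub>M P.Q" for i
      unfolding \<Phi>_def measurable_cong_sets[OF refl Q] by measurable
    moreover have "space P.Q = UNIV" by (simp add: sets_eq_imp_space_eq[OF Q] space_pair_measure)
    then have "(\<lambda>\<omega> i. \<Phi> \<omega> i) \<in> space M \<rightarrow> (\<Pi>\<^sub>E i\<in>UNIV. space P.Q)"
      by (simp only: PiE_UNIV_domain Pi_UNIV UNIV_I Pi_iff)
    ultimately show ?thesis by (rule measurable_PiM_single')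
  qed
  have k_m: "on_halfline k \<in> borel_measurable (borel \<Otimes>\<^sub>M \<sigma>)" if "k \<in> insert h (range hs)" for k
    using P.on_halfline_borel_measurable[OF meas[OF that]] .
  have law: "emeasure (distr M borel (\<lambda>\<omega>. \<Sum>i. k (T i \<omega>, \<Delta> i \<omega>))) A =
      emeasure P.S {\<omega>\<in>space P.S. (\<Sum>i. on_halfline k (P.point \<omega> i)) \<in> A}"
    and rv: "(\<lambda>\<omega>. \<Sum>i. k (T i \<omega>, \<Delta> i \<omega>)) \<in> borel_measurable M"
    if k: "k \<in> insert h (range hs)" and [measurable]: "A \<in> sets borel" for k A
  proof -
    note [measurable] = k_m[OF k]
    \<comment> \<open>The sum over \<open>j \<le> i\<close> is the one over
      \<open>j < Suc i\<close>, which is how \<open>point\<close> is indexed.\<close>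
    have T_eq: "(T i \<omega>, \<Delta> i \<omega>) = P.point (\<Phi> \<omega>) i" for i \<omega>
      by (simp add: P.point_def P.arrival_def \<Phi>_def T_def lessThan_Suc_atMost)
    have eq: "(\<Sum>i. k (T i \<omega>, \<Delta> i \<omega>)) = (\<Sum>i. on_halfline k (P.point (\<Phi> \<omega>) i))" if "\<omega> \<in> space M" for \<omega>
      using E_nonneg[OF that] unfolding T_eq[symmetric] by (simp add: on_halfline_def T_def sum_nonneg)
    have m: "(\<lambda>\<omega>. \<Sum>i. on_halfline k (P.point \<omega> i)) \<in> borel_measurable P.S" by measurable
    show "(\<lambda>\<omega>. \<Sum>i. k (T i \<omega>, \<Delta> i \<omega>)) \<in> borel_measurable M"
      by (subst measurable_cong[OF eq]) (auto intro: measurable_compose[OF \<Phi>_m m])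
    have "distr M borel (\<lambda>\<omega>. \<Sum>i. k (T i \<omega>, \<Delta> i \<omega>)) = distr M borel (\<lambda>\<omega>. \<Sum>i. on_halfline k (P.point (\<Phi> \<omega>) i))"
      by (intro distr_cong refl eq)
    also have "\<dots> = distr (distr M P.S \<Phi>) borel (\<lambda>\<omega>. \<Sum>i. on_halfline k (P.point \<omega> i))"
      by (subst distr_distr[OF m \<Phi>_m]) (simp add: comp_def)
    also have "\<dots> = distr P.S borel (\<lambda>\<omega>. \<Sum>i. on_halfline k (P.point \<omega> i))"
      unfolding \<Phi>_law ..
    finally show "emeasure (distr M borel (\<lambda>\<omega>. \<Sum>i. k (T i \<omega>, \<Delta> i \<omega>))) A =
        emeasure P.S {\<omega>\<in>space P.S. (\<Sum>i. on_halfline k (P.point \<omega> i)) \<in> A}"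
      using m by (simp add: emeasure_distr vimage_def Int_def conj_commute)
  qed
  obtain p where p: "absolutely_continuous lborel
        (image_convolution_power (restrict_space lborel {0..} \<Otimes>\<^sub>M \<sigma>) h p)"
      "\<And>t. t > 0 \<Longrightarrow> converges_in_variation
        (\<lambda>n. image_convolution_power (restrict_space lborel {0..t} \<Otimes>\<^sub>M \<sigma>) (hs n) p)
        (image_convolution_power (restrict_space lborel {0..t} \<Otimes>\<^sub>M \<sigma>) h p)"
    using cond3 by blast
  have hs_in: "hs n \<in> insert h (range hs)" and h_in: "h \<in> insert h (range hs)" for n by auto
  have adm: "P.admissible (on_halfline k) (\<alpha> * centering \<sigma> k)" if "k \<in> insert h (range hs)" for k
    by (intro P.admissible_on_halfline meas integrability a_exists that)
  have diff: "(\<lambda>n. \<integral>\<^sup>+z. ennreal (min ((on_halfline (hs n) z - on_halfline h z)\<^sup>2) 1) \<partial>P.\<Lambda>) \<longlonglongrightarrow> 0"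
  proof -
    have "on_halfline (\<lambda>z. hs n z - h z) z = on_halfline (hs n) z - on_halfline h z" for n z
      by (simp add: on_halfline_def)
    then show ?thesis using cond2 by (simp add: P.small_jump_integral_eq)
  qed
  have ev: "\<forall>\<^sub>F n in sequentially. \<forall>A\<in>sets borel.
     emeasure P.S {\<omega>\<in>space P.S. (\<Sum>i. on_halfline (hs n) (P.point \<omega> i)) \<in> A} \<le>
     emeasure P.S {\<omega>\<in>space P.S. (\<Sum>i. on_halfline h (P.point \<omega> i)) \<in> A} + ennreal e" if "e > 0" for e
  proof (rule P.law_converges[OF adm[OF hs_in] adm[OF h_in] _ diff _ _ _ that])
    show "(\<lambda>n. \<alpha> * centering \<sigma> (hs n)) \<longlonglongrightarrow> \<alpha> * centering \<sigma> h"
      using cond1 by (rule tendsto_mult_left)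
    show "AE z in P.\<Lambda>. \<bar>on_halfline h z\<bar> \<noteq> 1"
      by (rule P.AE_abs_neq_1[OF meas[OF h_in] p(1)])
    show "\<forall>\<^sub>F n in sequentially. \<forall>B\<in>sets borel. P.W (on_halfline (hs n)) p {0..t} (indicator B) 0 \<le>
        P.W (on_halfline h) p {0..t} (indicator B) 0 + ennreal e" if "t > 0" "e > 0" for t e
      by (rule P.convolution_variation[OF meas[OF hs_in] meas[OF h_in] p(2)[OF that(1)] that(2)])
    show "\<exists>d>0. \<forall>r B. \<bar>r\<bar> < d \<longrightarrow> B \<in> sets borel \<longrightarrow>
       P.W (on_halfline h) p {0..t} (indicator {x. x + r \<in> B}) 0 \<le> P.W (on_halfline h) p {0..t} (indicator B) 0 + ennreal e"
      if "e > 0" for t e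
      by (rule P.convolution_translate[OF meas[OF h_in] p(1) that])
  qed
  let ?\<mu> = "\<lambda>k. distr M borel (\<lambda>\<omega>. \<Sum>i. k (T i \<omega>, \<Delta> i \<omega>))"
  have pr: "prob_space (?\<mu> k)" if "k \<in> insert h (range hs)" for k
    by (intro prob_space_distr rv[OF that, of UNIV]) simp
  show ?thesis
    unfolding converges_in_variation_def
  proof (rule tendstoI)
    fix e :: real assume e: "e > 0"
    \<comment> \<open>A third of \<open>e\<close>, since \<open>tv_norm_le\<close> doubles it and
      the result must stay strictly below \<open>e\<close>.\<close>
    have "\<forall>\<^sub>F n in sequentially. \<forall>A\<in>sets borel. emeasure (?\<mu> (hs n)) A \<le> emeasure (?\<mu> h) A + ennreal (e / 3)"
      using ev[of "e / 3"] e by (simp add: law[OF hs_in] law[OF h_in])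
    then show "\<forall>\<^sub>F n in sequentially. dist (tv_norm (\<lambda>A. measure (?\<mu> (hs n)) A - measure (?\<mu> h) A)) 0 < e"
    proof eventually_elim
      case (elim n)
      interpret m: prob_space "?\<mu> (hs n)" by (rule pr[OF hs_in])
      interpret m': prob_space "?\<mu> h" by (rule pr[OF h_in])
      have "measure (?\<mu> (hs n)) A \<le> measure (?\<mu> h) A + e / 3" if "A \<in> sets borel" for A
      proof -
        have "ennreal (measure (?\<mu> (hs n)) A) \<le> ennreal (measure (?\<mu> h) A + e / 3)"
          using elim[rule_format, OF that] e
          unfolding m.emeasure_eq_measure m'.emeasure_eq_measure by (simp add: ennreal_plus)
        then show ?thesis using e by (subst (asm) ennreal_le_iff) auto
      qed
      note tv = tv_norm_le[OF pr[OF hs_in] pr[OF h_in] _ _ this]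
      show ?case using tv e by (simp add: dist_real_def)
    qed
  qed
qed

end
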